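(* Let $T:I\to I$ be a proper one-dimensional Iwasawa continued fraction map satisfying Condition $( * )$, and let $H$ be its transfer operator, acting on the complex space $BV(I)$. Then the eigenvalue $1$ of $H$ is simple, and $H$ has no other eigenvalues of modulus $1$.
   Context: Setting: $I=[a,b]$ is a compact nondegenerate interval and $m$ is Lebesgue measure. A (one-dimensional) Iwasawa continued fraction map is a map $T:I\to I$ for which $I$ admits a countable partition (up to common endpoints, and up to the point $0$ where the value of $T$ is irrelevant) into nondegenerate subintervals such that on each of them $T(x)=\iota(x)+\text{const}$, where $\iota$ is one fixed function among $1/x,\,-1/x,\,|1/x|,\,-|1/x|$; hence $|T'(x)|=1/x^2$. Let $\mathcal H$ be the set of inverse branches of $T$; for $h\in\mathcal H$, $I_h$ is the partition interval which is the range of $h$, and $TI_h$ is the domain of $h$. It is required that $TI_h=I$ for every $h$, except possibly for the leftmost and rightmost partition intervals, for which $TI_h$ must still be an interval sharing an endpoint with $I$. $T$ is proper if $\gamma:=\max\{|a|,|b|\}<1$. Transfer operator: for $f\in L^1(I)$ (complex-valued), $Hf(x)=\sum_{h\in\mathcal H}|h'(x)|\,f(h(x))\,\chi_{TI_h}(x)$. $BV(I)\subset L^1(I)$ is the Banach space of (classes of) complex functions of bounded variation, with norm $\|f\|_{BV}=\|f\|_1+\inf_{g=f\text{ a.e.}}\mathrm{var}_I\, g$. There is a $T$-invariant probability measure $f_1 m$ with $f_1\in BV(I)$, so $Hf_1=f_1$ and $1$ is an eigenvalue of $H$. Condition $( * )$: for any (nondegenerate) subintervals $J,K$ of $I$ there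 exists $N\ge 0$ such that $m(T^N(J)\cap T^N(K))>0$. *)

theory Defs
  imports "HOL-Analysis.Analysis"
begin

text \<open>
  The partition \<open>P\<close> consists of closed intervals, so neighbouring pieces share an endpoint.
  On the interior of a piece \<open>J\<close> the map is \<open>x \<mapsto> \<iota> x + c J\<close>; the values of \<open>T\<close> at the countably
  many endpoints and at 0 are only required to lie in \<open>I = {a..b}\<close>.
  The set written \<open>T I\<^sub>h\<close> on paper is the image of the closed piece under its branch.
  The leftmost and rightmost pieces, where they exist, are those containing \<open>a\<close> and \<open>b\<close>.
  No piece can contain 0, because \<open>T\<close> is bounded.
\<close>

definition branch :: "(real \<Rightarrow> real) \<Rightarrow> (real set \<Rightarrow> real) \<Rightarrow> real set \<Rightarrow> real \<Rightarrow> real" where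
  "branch \<iota> c J = (\<lambda>x. \<iota> x + c J)"

definition inverse_branch :: "(real \<Rightarrow> real) \<Rightarrow> (real set \<Rightarrow> real) \<Rightarrow> real set \<Rightarrow> real \<Rightarrow> real" where
  "inverse_branch \<iota> c J = inv_into J (branch \<iota> c J)"

locale iwasawa_cf_map =
  fixes a b :: real
    and T \<iota> :: "real \<Rightarrow> real"
    and P :: "real set set"
    and c :: "real set \<Rightarrow> real"
  assumes nondegenerate: "a < b"
    and self_map: "T ` {a..b} \<subseteq> {a..b}"
    and inversion:
      "\<iota> \<in> {\<lambda>x. 1 / x, \<lambda>x. - (1 / x), \<lambda>x. \<bar>1 / x\<bar>, \<lambda>x. - \<bar>1 / x\<bar>}"
    and countable_partition: "countable P"
    and pieces: "\<And>J. J \<in> P \<Longrightarrow> \<exists>u v. u < v \<and> J = {u..v} \<and> J \<subseteq> {a..b}"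
    and non_overlapping: "pairwise (\<lambda>J K. interior J \<inter> interior K = {}) P"
    and covering: "{a..b} - {0} \<subseteq> \<Union>P"
    and T_on_piece: "\<And>J x. J \<in> P \<Longrightarrow> x \<in> interior J \<Longrightarrow> T x = branch \<iota> c J x"
    and full_branch:
      "\<And>J. J \<in> P \<Longrightarrow> a \<notin> J \<Longrightarrow> b \<notin> J \<Longrightarrow> branch \<iota> c J ` J = {a..b}"
    and end_branch:
      "\<And>J. J \<in> P \<Longrightarrow> a \<in> J \<or> b \<in> J \<Longrightarrow>
         is_interval (branch \<iota> c J ` J) \<and> branch \<iota> c J ` J \<subseteq> {a..b} \<and>
         (a \<in> branch \<iota> c J ` J \<or> b \<in> branch \<iota> c J ` J)"

definition proper :: "real \<Rightarrow> real \<Rightarrow> bool" where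
  "proper a b \<longleftrightarrow> max \<bar>a\<bar> \<bar>b\<bar> < 1"

definition nondegenerate_subinterval :: "real \<Rightarrow> real \<Rightarrow> real set \<Rightarrow> bool" where
  "nondegenerate_subinterval a b J \<longleftrightarrow> is_interval J \<and> J \<subseteq> {a..b} \<and> interior J \<noteq> {}"

definition condition_star :: "real \<Rightarrow> real \<Rightarrow> (real \<Rightarrow> real) \<Rightarrow> bool" where
  "condition_star a b T \<longleftrightarrow>
     (\<forall>J K. nondegenerate_subinterval a b J \<and> nondegenerate_subinterval a b K \<longrightarrow>
        (\<exists>N. emeasure lebesgue ((T ^^ N) ` J \<inter> (T ^^ N) ` K) > 0))"

text \<open>
  Classes in \<open>L\<^sup>1(I)\<close> are handled through representatives \<open>f :: real \<Rightarrow> complex\<close>, compared almost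
  everywhere on \<open>I\<close>. For integrable \<open>f\<close> the series below converges absolutely for almost every \<open>x\<close>.
  The value of \<open>deriv\<close> at the endpoints of the domain of an inverse branch is immaterial.
\<close>

definition transfer_operator ::
    "(real \<Rightarrow> real) \<Rightarrow> real set set \<Rightarrow> (real set \<Rightarrow> real) \<Rightarrow> (real \<Rightarrow> complex) \<Rightarrow> real \<Rightarrow> complex" where
  "transfer_operator \<iota> P c f x =
     (\<Sum>\<^sub>\<infinity>J\<in>P. complex_of_real \<bar>deriv (inverse_branch \<iota> c J) x\<bar> * f (inverse_branch \<iota> c J x)
                 * indicator (branch \<iota> c J ` J) x)"

definition variation :: "real \<Rightarrow> real \<Rightarrow> (real \<Rightarrow> complex) \<Rightarrow> ennreal" where
  "variation a b g =
     (SUP (t, n) \<in> {t :: nat \<Rightarrow> real. mono t \<and> range t \<subseteq> {a..b}} \<times> UNIV.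
        ennreal (\<Sum>i<n. norm (g (t (Suc i)) - g (t i))))"

definition BV :: "real \<Rightarrow> real \<Rightarrow> (real \<Rightarrow> complex) set" where
  "BV a b = {f. integrable (lebesgue_on {a..b}) f \<and>
     (\<exists>g. (AE x in lebesgue_on {a..b}. g x = f x) \<and> variation a b g < \<infinity>)}"

definition BV_eigenvalue ::
    "real \<Rightarrow> real \<Rightarrow> ((real \<Rightarrow> complex) \<Rightarrow> real \<Rightarrow> complex) \<Rightarrow> complex \<Rightarrow> bool" where
  "BV_eigenvalue a b H \<mu> \<longleftrightarrow>
     (\<exists>f\<in>BV a b. \<not> (AE x in lebesgue_on {a..b}. f x = 0) \<and>
        (AE x in lebesgue_on {a..b}. H f x = \<mu> * f x))"

definition BV_generalized_eigenspace ::
    "real \<Rightarrow> real \<Rightarrow> ((real \<Rightarrow> complex) \<Rightarrow> real \<Rightarrow> complex) \<Rightarrow> complex \<Rightarrow> (real \<Rightarrow> complex) set" where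
  "BV_generalized_eigenspace a b H \<mu> =
     {f \<in> BV a b. \<exists>n. AE x in lebesgue_on {a..b}. ((\<lambda>g x. H g x - \<mu> * g x) ^^ n) f x = 0}"

text \<open>
  Simplicity means algebraic multiplicity one: the generalized eigenspace is one-dimensional
  modulo null functions (hence so is the eigenspace).
\<close>

definition BV_simple_eigenvalue ::
    "real \<Rightarrow> real \<Rightarrow> ((real \<Rightarrow> complex) \<Rightarrow> real \<Rightarrow> complex) \<Rightarrow> complex \<Rightarrow> bool" where
  "BV_simple_eigenvalue a b H \<mu> \<longleftrightarrow> BV_eigenvalue a b H \<mu> \<and>
     (\<exists>e \<in> BV_generalized_eigenspace a b H \<mu>. \<not> (AE x in lebesgue_on {a..b}. e x = 0) \<and>
        (\<forall>f \<in> BV_generalized_eigenspace a b H \<mu>.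
           \<exists>k. AE x in lebesgue_on {a..b}. f x = k * e x))"

end

(*
  Existence of an eigenfunction for the eigenvalue 1. The n-th iterate of the transfer operator has
  the weights G_n = product of g(T^k y), k < n, with g(y) = y^2 = 1 / |T' y|. If g is set to 0 at
  the endpoints of the pieces (a countable set), then var(H^n f) <= var(G_n f), no matter whether
  the two end pieces are full. As G_n <= gamma^(2 n) has bounded variation, the interval splits
  into finitely many pieces on which var G_n <= 4 gamma^(2 n); this gives the Lasota-Yorke
  inequality var(H^n f) <= 5 gamma^(2 n) var f + K for f >= 0 of integral at most 1. A pointwise
  cluster point of the Cesaro means of H^k 1 (Tychonoff) is invariant, of bounded variation, and
  nonzero because Riemann sums approximate the integral uniformly on functions of bounded variation.

  Peripheral spectrum. Let H f = mu f with |mu| = 1. The operator H is an L^1 contraction, so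
  equality holds in the triangle inequality |H f| <= H |f|; hence H |f| = |f| and
  sgn f = mu (sgn f o T) wherever f is nonzero. If sgn f took two different values at points of
  continuity, it would be close to them on two small intervals J and K, and Condition star yields
  y in J and z in K with T^N y = T^N z, so sgn f(y) = sgn f(z), a contradiction. Hence f = u |f| for
  a constant u. This forces mu = 1, and an eigenfunction for 1 of integral 0 vanishes, so the
  eigenspace is one-dimensional. If H p = p + q and H q = q then |p + k q|_1 <= |p|_1 for all k,
  so q = 0: there is no Jordan block.
*)
theory Submission
  imports Defs
begin

section \<open>Bounds on the variation\<close>

text \<open>The transfer operator is determined only almost everywhere, while a variation needs a
  value at every point. The existence part therefore uses a real operator
  \<open>pointwise_transfer\<close> that is defined everywhere and agrees with \<open>H\<close>
  almost everywhere on bounded functions. A weight with values in \<open>[0, \<epsilon>]\<close> may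
  jump by \<open>\<epsilon>\<close> on either side of a point, and no finer subdivision removes such
  jumps. So a factor like 5 remains, and only a high iterate beats it. That \<open>G_n\<close> has
  bounded variation rests on the summability over the pieces of the supremum of \<open>y^2\<close>:
  on a full piece it is at most a multiple of the length, and only finitely many pieces can fail to
  be full. A cluster point in an uncountable product is a limit along a filter, where dominated
  convergence of integrals is not at hand; hence the Riemann sums. The phase relation holds off a
  null set only, while Condition star speaks of images under \<open>T^N\<close>. Hence null sets
  have to be controlled under both images and preimages of \<open>T\<close>.\<close>

text \<open>
  A bound on the variation is witnessed by a majorant \<open>W\<close> of the increments. Unlike a supremum over
  partitions, such a witness can be restricted, concatenated, composed and summed directly.
\<close>

definition variation_le :: "(real \<Rightarrow> 'a::real_normed_vector) \<Rightarrow> real \<Rightarrow> real \<Rightarrow> real \<Rightarrow> bool" where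
  "variation_le \<phi> u v V \<longleftrightarrow>
     (\<exists>W. (\<forall>x y. u \<le> x \<longrightarrow> x \<le> y \<longrightarrow> y \<le> v \<longrightarrow> norm (\<phi> y - \<phi> x) \<le> W y - W x) \<and> W v - W u \<le> V)"

lemma variation_leI:
  assumes "\<And>x y. u \<le> x \<Longrightarrow> x \<le> y \<Longrightarrow> y \<le> v \<Longrightarrow> norm (\<phi> y - \<phi> x) \<le> W y - W x" "W v - W u \<le> V"
  shows "variation_le \<phi> u v V"
  using assms unfolding variation_le_def by blast

text \<open>Normalising the majorant to vanish at \<open>u\<close> turns the bound on its total
  increment into a bound on its values. It is monotone because each increment dominates a
  norm.\<close>

lemma variation_leE:
  assumes "variation_le \<phi> u v V"
  obtains W where "\<And>x y. u \<le> x \<Longrightarrow> x \<le> y \<Longrightarrow> y \<le> v \<Longrightarrow> norm (\<phi> y - \<phi> x) \<le> W y - W x"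
    "W u = 0" "W v \<le> V" "mono_on {u..v} W"
proof -
  obtain W where W: "\<forall>x y. u \<le> x \<longrightarrow> x \<le> y \<longrightarrow> y \<le> v \<longrightarrow> norm (\<phi> y - \<phi> x) \<le> W y - W x" "W v - W u \<le> V"
    using assms unfolding variation_le_def by (elim exE conjE)
  have m: "mono_on {u..v} (\<lambda>x. W x - W u)"
  proof (rule mono_onI)
    fix r s assume "r \<in> {u..v}" "s \<in> {u..v}" "r \<le> s"
    then have "norm (\<phi> s - \<phi> r) \<le> W s - W r"
      using W(1) by simp
    then show "W r - W u \<le> W s - W u"
      using norm_ge_zero[of "\<phi> s - \<phi> r"] by linarith
  qed
  show thesis
  proof (rule that[of "\<lambda>x. W x - W u"])
    show "norm (\<phi> y - \<phi> x) \<le> (W y - W u) - (W x - W u)" if "u \<le> x" "x \<le> y" "y \<le> v" for x y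
      using W(1) that by simp
    show "mono_on {u..v} (\<lambda>x. W x - W u)" by (rule m)
  qed (use W(2) in simp_all)
qed

lemma variation_le_nonneg:
  assumes "variation_le \<phi> u v V" "u \<le> v"
  shows "0 \<le> V"
proof -
  obtain W where W: "\<And>x y. u \<le> x \<Longrightarrow> x \<le> y \<Longrightarrow> y \<le> v \<Longrightarrow> norm (\<phi> y - \<phi> x) \<le> W y - W x"
    "W u = 0" "W v \<le> V" "mono_on {u..v} W"
    by (rule variation_leE[OF assms(1)]) (rule that)
  show ?thesis
    using order_trans[OF norm_ge_zero W(1)[of u v]] W(2,3) assms(2) by simp
qed

lemma variation_le_mono: "variation_le \<phi> u v V \<Longrightarrow> V \<le> V' \<Longrightarrow> variation_le \<phi> u v V'"
  unfolding variation_le_def by fastforce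

lemma variation_le_const: "variation_le (\<lambda>_. k) u v 0"
  by (rule variation_leI[where W = "\<lambda>_. 0"]) auto

lemma variation_le_cong:
  assumes "variation_le \<phi> u v V" "\<And>x. u \<le> x \<Longrightarrow> x \<le> v \<Longrightarrow> \<phi> x = \<psi> x"
  shows "variation_le \<psi> u v V"
proof -
  obtain W where W: "\<And>x y. u \<le> x \<Longrightarrow> x \<le> y \<Longrightarrow> y \<le> v \<Longrightarrow> norm (\<phi> y - \<phi> x) \<le> W y - W x"
    "W u = 0" "W v \<le> V" "mono_on {u..v} W"
    by (rule variation_leE[OF assms(1)]) (rule that)
  show ?thesis
  proof (rule variation_leI[of _ _ _ W])
    fix x y assume "u \<le> x" "x \<le> y" "y \<le> v"
    then show "norm (\<psi> y - \<psi> x) \<le> W y - W x"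
      using W(1)[of x y] assms(2)[of x] assms(2)[of y] by simp
  qed (use W in simp)
qed

lemma variation_le_bound:
  assumes "variation_le \<phi> u v V" "x \<in> {u..v}" "y \<in> {u..v}"
  shows "norm (\<phi> y - \<phi> x) \<le> V"
proof -
  obtain W where W: "\<And>x y. u \<le> x \<Longrightarrow> x \<le> y \<Longrightarrow> y \<le> v \<Longrightarrow> norm (\<phi> y - \<phi> x) \<le> W y - W x"
    "W u = 0" "W v \<le> V" "mono_on {u..v} W"
    by (rule variation_leE[OF assms(1)]) (rule that)
  have *: "norm (\<phi> y - \<phi> x) \<le> V" if "u \<le> x" "x \<le> y" "y \<le> v" for x y
  proof -
    have "W y \<le> W v" "W u \<le> W x"
      using that by (auto intro!: mono_onD[OF W(4)])
    then show ?thesis using W(1)[OF that] W(2,3) by linarith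
  qed
  show ?thesis
    using *[of x y] *[of y x] assms(2,3) by (cases "x \<le> y") (auto simp: norm_minus_commute)
qed

lemma variation_le_join:
  assumes "u \<le> m" "m \<le> v" "variation_le \<phi> u m V" "variation_le \<phi> m v V'"
  shows "variation_le \<phi> u v (V + V')"
proof -
  obtain W where W: "\<And>x y. u \<le> x \<Longrightarrow> x \<le> y \<Longrightarrow> y \<le> m \<Longrightarrow> norm (\<phi> y - \<phi> x) \<le> W y - W x"
    "W u = 0" "W m \<le> V" "mono_on {u..m} W"
    by (rule variation_leE[OF assms(3)]) (rule that)
  obtain W' where W': "\<And>x y. m \<le> x \<Longrightarrow> x \<le> y \<Longrightarrow> y \<le> v \<Longrightarrow> norm (\<phi> y - \<phi> x) \<le> W' y - W' x"
    "W' m = 0" "W' v \<le> V'" "mono_on {m..v} W'"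
    by (rule variation_leE[OF assms(4)]) (rule that)
  define Z where "Z x = (if x \<le> m then W x else W' x + W m)" for x
  show ?thesis
  proof (rule variation_leI[of _ _ _ Z])
    fix x y assume xy: "u \<le> x" "x \<le> y" "y \<le> v"
    consider "y \<le> m" | "m < x" | "x \<le> m" "m < y" by linarith
    then show "norm (\<phi> y - \<phi> x) \<le> Z y - Z x"
    proof cases
      case 3
      have "norm (\<phi> y - \<phi> x) \<le> norm (\<phi> y - \<phi> m) + norm (\<phi> m - \<phi> x)"
        using norm_triangle_ineq[of "\<phi> y - \<phi> m" "\<phi> m - \<phi> x"] by simp
      then show ?thesis
        using W(1)[of x m] W'(1)[of m y] 3 xy W'(2) by (simp add: Z_def)
    qed (use W(1)[of x y] W'(1)[of x y] xy in \<open>auto simp: Z_def\<close>)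
  next
    show "Z v - Z u \<le> V + V'"
      using assms(1,2) W(2,3) W'(2,3) by (cases "v = m") (auto simp: Z_def)
  qed
qed

text \<open>The slack of the majorant is given to the right half, so the two bounds add up exactly
  to \<open>V\<close>. An estimate with a fixed factor before the variation then survives
  gluing.\<close>

lemma variation_le_split:
  assumes "u \<le> m" "m \<le> v" "variation_le \<phi> u v V"
  obtains V1 V2 where "variation_le \<phi> u m V1" "variation_le \<phi> m v V2" "V1 + V2 = V"
proof -
  obtain W where W: "\<And>x y. u \<le> x \<Longrightarrow> x \<le> y \<Longrightarrow> y \<le> v \<Longrightarrow> norm (\<phi> y - \<phi> x) \<le> W y - W x"
    "W u = 0" "W v \<le> V" "mono_on {u..v} W"
    by (rule variation_leE[OF assms(3)]) (rule that)
  show thesis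
  proof
    show "variation_le \<phi> u m (W m - W u)"
      by (rule variation_leI[of _ _ _ W]) (use assms W in auto)
    show "variation_le \<phi> m v (V - W m)"
      by (rule variation_leI[of _ _ _ W]) (use assms W in auto)
  qed (simp add: W)
qed

lemma variation_le_compose:
  assumes "variation_le \<phi> u v V" "h ` {p..q} \<subseteq> {u..v}" "p \<le> q" "mono_on {p..q} h \<or> antimono_on {p..q} h"
  shows "variation_le (\<lambda>x. \<phi> (h x)) p q V"
proof -
  obtain W where W: "\<And>x y. u \<le> x \<Longrightarrow> x \<le> y \<Longrightarrow> y \<le> v \<Longrightarrow> norm (\<phi> y - \<phi> x) \<le> W y - W x"
    "W u = 0" "W v \<le> V" "mono_on {u..v} W"
    by (rule variation_leE[OF assms(1)]) (rule that)
  have rng: "u \<le> h x" "h x \<le> v" if "p \<le> x" "x \<le> q" for x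
    using assms(2) that by (auto simp: image_subset_iff)
  have bnd: "0 \<le> W (h x)" "W (h x) \<le> V" if "p \<le> x" "x \<le> q" for x
  proof -
    have "W u \<le> W (h x)" "W (h x) \<le> W v"
      using rng[OF that] by (auto intro!: mono_onD[OF W(4)])
    then show "0 \<le> W (h x)" "W (h x) \<le> V" using W(2,3) by auto
  qed
  from assms(4) show ?thesis
  proof
    assume h: "mono_on {p..q} h"
    have le: "h x \<le> h y" if "p \<le> x" "x \<le> y" "y \<le> q" for x y
      using that by (intro mono_onD[OF h]) auto
    show ?thesis
      by (rule variation_leI[of _ _ _ "\<lambda>x. W (h x)"])
        (use bnd[of p] bnd[of q] assms(3) in \<open>auto intro!: W(1) le rng\<close>)
  next
    assume h: "antimono_on {p..q} h"
    have le: "h y \<le> h x" if "p \<le> x" "x \<le> y" "y \<le> q" for x y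
      using that by (intro monotone_onD[OF h]) auto
    show ?thesis
    \<comment> \<open>An antitone \<open>h\<close> reverses the order of the arguments, so the
      negated majorant is the increasing one.\<close>
    proof (rule variation_leI[of _ _ _ "\<lambda>x. - W (h x)"])
      fix x y assume "p \<le> x" "x \<le> y" "y \<le> q"
      then show "norm (\<phi> (h y) - \<phi> (h x)) \<le> - W (h y) - - W (h x)"
        using W(1)[of "h y" "h x"] le[of x y] rng[of x] rng[of y] by (simp add: norm_minus_commute)
    qed (use bnd[of p] bnd[of q] assms(3) in auto)
  qed
qed

lemma variation_le_mult:
  fixes \<phi> G :: "real \<Rightarrow> real"
  assumes "variation_le \<phi> u v V" "variation_le G u v V'" "u \<le> v"
    and "\<And>x. x \<in> {u..v} \<Longrightarrow> \<bar>G x\<bar> \<le> A" "\<And>x. x \<in> {u..v} \<Longrightarrow> \<bar>\<phi> x\<bar> \<le> B"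
  shows "variation_le (\<lambda>x. G x * \<phi> x) u v (A * V + B * V')"
proof -
  obtain W where W: "\<And>x y. u \<le> x \<Longrightarrow> x \<le> y \<Longrightarrow> y \<le> v \<Longrightarrow> norm (\<phi> y - \<phi> x) \<le> W y - W x"
    "W u = 0" "W v \<le> V" "mono_on {u..v} W"
    by (rule variation_leE[OF assms(1)]) (rule that)
  obtain W' where W': "\<And>x y. u \<le> x \<Longrightarrow> x \<le> y \<Longrightarrow> y \<le> v \<Longrightarrow> norm (G y - G x) \<le> W' y - W' x"
    "W' u = 0" "W' v \<le> V'" "mono_on {u..v} W'"
    by (rule variation_leE[OF assms(2)]) (rule that)
  have AB: "0 \<le> A" "0 \<le> B"
    using assms(4)[of u] assms(5)[of u] assms(3) by auto
  show ?thesis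
  proof (rule variation_leI[of _ _ _ "\<lambda>x. A * W x + B * W' x"])
    fix x y assume xy: "u \<le> x" "x \<le> y" "y \<le> v"
    have "\<bar>G y * \<phi> y - G x * \<phi> x\<bar> = \<bar>G y * (\<phi> y - \<phi> x) + \<phi> x * (G y - G x)\<bar>"
      by (simp add: algebra_simps)
    also have "\<dots> \<le> \<bar>G y\<bar> * \<bar>\<phi> y - \<phi> x\<bar> + \<bar>\<phi> x\<bar> * \<bar>G y - G x\<bar>"
      by (metis abs_mult abs_triangle_ineq)
    also have "\<dots> \<le> A * (W y - W x) + B * (W' y - W' x)"
      using W(1)[OF xy] W'(1)[OF xy] assms(4)[of y] assms(5)[of x] AB xy
      by (intro add_mono mult_mono) auto
    finally show "norm (G y * \<phi> y - G x * \<phi> x) \<le> A * W y + B * W' y - (A * W x + B * W' x)"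
      by (simp add: algebra_simps)
  qed (use W W' AB in \<open>auto intro!: add_mono mult_left_mono\<close>)
qed

lemma variation_le_add:
  assumes "variation_le \<phi> u v V" "variation_le \<psi> u v V'"
  shows "variation_le (\<lambda>x. \<phi> x + \<psi> x) u v (V + V')"
proof -
  obtain W where W: "\<And>x y. u \<le> x \<Longrightarrow> x \<le> y \<Longrightarrow> y \<le> v \<Longrightarrow> norm (\<phi> y - \<phi> x) \<le> W y - W x"
    "W u = 0" "W v \<le> V" "mono_on {u..v} W"
    by (rule variation_leE[OF assms(1)]) (rule that)
  obtain W' where W': "\<And>x y. u \<le> x \<Longrightarrow> x \<le> y \<Longrightarrow> y \<le> v \<Longrightarrow> norm (\<psi> y - \<psi> x) \<le> W' y - W' x"
    "W' u = 0" "W' v \<le> V'" "mono_on {u..v} W'"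
    by (rule variation_leE[OF assms(2)]) (rule that)
  show ?thesis
  proof (rule variation_leI[of _ _ _ "\<lambda>x. W x + W' x"])
    fix x y assume xy: "u \<le> x" "x \<le> y" "y \<le> v"
    have "norm (\<phi> y + \<psi> y - (\<phi> x + \<psi> x)) \<le> norm (\<phi> y - \<phi> x) + norm (\<psi> y - \<psi> x)"
      by (metis add_diff_add norm_triangle_ineq)
    then show "norm (\<phi> y + \<psi> y - (\<phi> x + \<psi> x)) \<le> W y + W' y - (W x + W' x)"
      using W(1)[OF xy] W'(1)[OF xy] by linarith
  qed (use W W' in auto)
qed

lemma variation_le_cmult:
  fixes \<phi> :: "real \<Rightarrow> 'a::real_normed_field"
  assumes "variation_le \<phi> u v V"
  shows "variation_le (\<lambda>x. k * \<phi> x) u v (norm k * V)"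
proof -
  obtain W where W: "\<And>x y. u \<le> x \<Longrightarrow> x \<le> y \<Longrightarrow> y \<le> v \<Longrightarrow> norm (\<phi> y - \<phi> x) \<le> W y - W x"
    "W u = 0" "W v \<le> V" "mono_on {u..v} W"
    by (rule variation_leE[OF assms(1)]) (rule that)
  show ?thesis
  proof (rule variation_leI[of _ _ _ "\<lambda>x. norm k * W x"])
    fix x y assume xy: "u \<le> x" "x \<le> y" "y \<le> v"
    show "norm (k * \<phi> y - k * \<phi> x) \<le> norm k * W y - norm k * W x"
      using mult_left_mono[OF W(1)[OF xy] norm_ge_zero[of k]]
      by (simp add: norm_mult flip: right_diff_distrib)
  qed (use W in \<open>auto intro!: mult_left_mono\<close>)
qed

lemma variation_le_of_real:
  "variation_le (\<lambda>x. complex_of_real (\<phi> x)) u v V \<longleftrightarrow> variation_le \<phi> u v V"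
  by (simp add: variation_le_def norm_of_real flip: of_real_diff)

lemma variation_le_sum:
  fixes \<phi> :: "nat \<Rightarrow> real \<Rightarrow> real"
  assumes "\<And>i. i < n \<Longrightarrow> variation_le (\<phi> i) u v (V i)"
  shows "variation_le (\<lambda>x. \<Sum>i<n. \<phi> i x) u v (\<Sum>i<n. V i)"
  using assms by (induction n) (auto simp: variation_le_const intro!: variation_le_add)

text \<open>The majorant receives an extra jump of height \<open>R\<close> at each end, which pays
  for dropping the end values to 0.\<close>

lemma variation_le_zero_ends:
  fixes \<phi> \<psi> :: "real \<Rightarrow> real"
  assumes "variation_le \<phi> u v V" "u \<le> v" "\<And>x. x \<in> {u..v} \<Longrightarrow> \<bar>\<phi> x\<bar> \<le> R"
    and "\<And>x. u < x \<Longrightarrow> x < v \<Longrightarrow> \<psi> x = \<phi> x" "\<psi> u = 0" "\<psi> v = 0"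
  shows "variation_le \<psi> u v (V + 2 * R)"
proof -
  obtain W where W: "\<And>x y. u \<le> x \<Longrightarrow> x \<le> y \<Longrightarrow> y \<le> v \<Longrightarrow> norm (\<phi> y - \<phi> x) \<le> W y - W x"
    "W u = 0" "W v \<le> V" "mono_on {u..v} W"
    by (rule variation_leE[OF assms(1)]) (rule that)
  have R: "0 \<le> R" using assms(3)[of u] assms(2) by auto
  define Z where "Z x = W x + (if u < x then R else 0) + (if v \<le> x then R else 0)" for x
  show ?thesis
  proof (rule variation_leI[of _ _ _ Z])
    fix x y assume xy: "u \<le> x" "x \<le> y" "y \<le> v"
    have W0: "0 \<le> W y - W x" using W(1)[OF xy] norm_ge_zero order_trans by blast
    show "norm (\<psi> y - \<psi> x) \<le> Z y - Z x"
    proof (cases "x = y")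
      case False
      consider "x = u" "y = v" | "x = u" "y < v" | "u < x" "y = v" | "u < x" "y < v"
        using xy by linarith
      then show ?thesis
      proof cases
        case 1
        then show ?thesis using assms(5,6) R W0 False xy by (simp add: Z_def)
      next
        case 2
        have "\<bar>\<psi> y\<bar> \<le> R" using assms(3)[of y] assms(4)[of y] 2 xy False by auto
        then show ?thesis using 2 assms(5) W0 False xy by (auto simp: Z_def)
      next
        case 3
        have "\<bar>\<psi> x\<bar> \<le> R" using assms(3)[of x] assms(4)[of x] 3 xy False by auto
        then show ?thesis using 3 assms(6) W0 False xy by (auto simp: Z_def)
      next
        case 4
        then show ?thesis using assms(4)[of x] assms(4)[of y] xy W(1)[OF xy] by (auto simp: Z_def)
      qed
    qed simp
  qed (use W R assms(2) in \<open>auto simp: Z_def\<close>)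
qed

text \<open>The normalised majorants are summed over the index. Since \<open>0 \<le> W J x\<close>
  and \<open>W J x \<le> V J\<close>, their sum converges at every point.\<close>

lemma variation_le_infsum:
  fixes \<phi> :: "'b \<Rightarrow> real \<Rightarrow> real"
  assumes "u \<le> v" "\<And>J. J \<in> P \<Longrightarrow> variation_le (\<phi> J) u v (V J)" "V summable_on P"
    and sm: "\<And>x. x \<in> {u..v} \<Longrightarrow> (\<lambda>J. \<phi> J x) summable_on P"
  shows "variation_le (\<lambda>x. \<Sum>\<^sub>\<infinity>J\<in>P. \<phi> J x) u v (\<Sum>\<^sub>\<infinity>J\<in>P. V J)"
proof -
  have "\<forall>J\<in>P. \<exists>W. (\<forall>x y. u \<le> x \<longrightarrow> x \<le> y \<longrightarrow> y \<le> v \<longrightarrow> norm (\<phi> J y - \<phi> J x) \<le> W y - W x) \<and>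
    W u = 0 \<and> W v \<le> V J \<and> mono_on {u..v} W"
    by (metis assms(2) variation_leE)
  then obtain W where W: "\<And>J x y. J \<in> P \<Longrightarrow> u \<le> x \<Longrightarrow> x \<le> y \<Longrightarrow> y \<le> v \<Longrightarrow> norm (\<phi> J y - \<phi> J x) \<le> W J y - W J x"
    "\<And>J. J \<in> P \<Longrightarrow> W J u = 0" "\<And>J. J \<in> P \<Longrightarrow> W J v \<le> V J" "\<And>J. J \<in> P \<Longrightarrow> mono_on {u..v} (W J)"
    by metis
  have Wb: "0 \<le> W J x" "W J x \<le> V J" if "J \<in> P" "x \<in> {u..v}" for J x
    using mono_onD[OF W(4)[OF that(1)], of u x] mono_onD[OF W(4)[OF that(1)], of x v] W(2,3)[OF that(1)] that(2)
    by auto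
  have Ws: "(\<lambda>J. W J x) summable_on P" if "x \<in> {u..v}" for x
    by (rule summable_on_comparison_test[OF assms(3)]) (use Wb that in auto)
  show ?thesis
  proof (rule variation_leI[of _ _ _ "\<lambda>x. \<Sum>\<^sub>\<infinity>J\<in>P. W J x"])
    fix x y assume xy: "u \<le> x" "x \<le> y" "y \<le> v"
    then have m: "x \<in> {u..v}" "y \<in> {u..v}" by auto
    have h: "((\<lambda>J. \<phi> J y + - \<phi> J x) has_sum ((\<Sum>\<^sub>\<infinity>J\<in>P. \<phi> J y) + - (\<Sum>\<^sub>\<infinity>J\<in>P. \<phi> J x))) P"
      by (intro has_sum_add has_sum_infsum has_sum_uminusI sm m)
    have h': "((\<lambda>J. W J y + - W J x) has_sum ((\<Sum>\<^sub>\<infinity>J\<in>P. W J y) + - (\<Sum>\<^sub>\<infinity>J\<in>P. W J x))) P"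
      by (intro has_sum_add has_sum_infsum has_sum_uminusI Ws m)
    show "norm ((\<Sum>\<^sub>\<infinity>J\<in>P. \<phi> J y) - (\<Sum>\<^sub>\<infinity>J\<in>P. \<phi> J x)) \<le> (\<Sum>\<^sub>\<infinity>J\<in>P. W J y) - (\<Sum>\<^sub>\<infinity>J\<in>P. W J x)"
      using norm_infsum_le[OF h h'] W(1) xy by simp
  next
    have "(\<Sum>\<^sub>\<infinity>J\<in>P. W J v) \<le> (\<Sum>\<^sub>\<infinity>J\<in>P. V J)"
      by (rule infsum_mono[OF Ws assms(3)]) (use assms(1) W(3) in auto)
    moreover have "(\<Sum>\<^sub>\<infinity>J\<in>P. W J u) = 0"
      by (rule infsum_0) (use W(2) in auto)
    ultimately show "(\<Sum>\<^sub>\<infinity>J\<in>P. W J v) - (\<Sum>\<^sub>\<infinity>J\<in>P. W J u) \<le> (\<Sum>\<^sub>\<infinity>J\<in>P. V J)" by simp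
  qed
qed

text \<open>Jordan decomposition: both \<open>W\<close> and \<open>\<phi> + W\<close> are
  nondecreasing, and the function is their difference.\<close>

lemma variation_le_integrable_on:
  fixes \<phi> :: "real \<Rightarrow> real"
  assumes "variation_le \<phi> u v V" "u \<le> v"
  shows "integrable (lebesgue_on {u..v}) \<phi>"
proof -
  obtain W where W: "\<And>x y. u \<le> x \<Longrightarrow> x \<le> y \<Longrightarrow> y \<le> v \<Longrightarrow> norm (\<phi> y - \<phi> x) \<le> W y - W x"
    "W u = 0" "W v \<le> V" "mono_on {u..v} W"
    by (rule variation_leE[OF assms(1)]) (rule that)
  have "mono_on {u..v} (\<lambda>x. \<phi> x + W x)"
  proof (rule mono_onI)
    fix r s assume "r \<in> {u..v}" "s \<in> {u..v}" "r \<le> s"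
    then show "\<phi> r + W r \<le> \<phi> s + W s"
      using W(1)[of r s] by (auto simp: abs_if split: if_splits)
  qed
  then have "integrable (lebesgue_on {u..v}) (\<lambda>x. \<phi> x + W x)"
    by (rule integrable_mono_on)
  moreover have "integrable (lebesgue_on {u..v}) W"
    by (rule integrable_mono_on[OF W(4)])
  ultimately have "integrable (lebesgue_on {u..v}) (\<lambda>x. \<phi> x + W x - W x)"
    by (rule Bochner_Integration.integrable_diff)
  then show ?thesis by simp
qed

lemma variation_le_sum_le:
  assumes "variation_le g a b V" "a \<le> b" "mono t" "range t \<subseteq> {a..b}"
  shows "(\<Sum>i<n. norm (g (t (Suc i)) - g (t i))) \<le> V"
proof -
  obtain W where W: "\<And>x y. a \<le> x \<Longrightarrow> x \<le> y \<Longrightarrow> y \<le> b \<Longrightarrow> norm (g y - g x) \<le> W y - W x"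
    "W a = 0" "W b \<le> V" "mono_on {a..b} W"
    by (rule variation_leE[OF assms(1)]) (rule that)
  have ti: "a \<le> t i" "t i \<le> b" for i using assms(4) by (auto simp: image_subset_iff)
  have "(\<Sum>i<n. norm (g (t (Suc i)) - g (t i))) \<le> (\<Sum>i<n. W (t (Suc i)) - W (t i))"
    by (intro sum_mono W(1)) (use ti assms(3) in \<open>auto simp: mono_def\<close>)
  also have "\<dots> = W (t n) - W (t 0)" by (rule sum_lessThan_telescope)
  also have "\<dots> \<le> V"
    using mono_onD[OF W(4), of "t n" b] mono_onD[OF W(4), of a "t 0"] ti[of 0] ti[of n] W(2,3) assms(2) by auto
  finally show ?thesis .
qed

lemma variation_le_imp_variation:
  assumes "variation_le g a b V" "a \<le> b"
  shows "variation a b g \<le> ennreal V"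
  unfolding variation_def
  using variation_le_sum_le[OF assms] by (auto intro!: SUP_least ennreal_leI)

text \<open>The majorant is the classical variation function: \<open>W x\<close> is the supremum of
  the increment sums over monotone sequences in \<open>{a..x}\<close>.\<close>

lemma finite_variation_imp_variation_le:
  assumes "variation a b g < \<infinity>" "a \<le> b"
  shows "\<exists>V. variation_le g a b V"
proof -
  define S where "S x = {(\<Sum>i<n. norm (g (t (Suc i)) - g (t i))) | t n. mono t \<and> range t \<subseteq> {a..x}}" for x
  define W where "W x = Sup (S x)" for x
  have fin: "\<exists>C. \<forall>s\<in>S b. s \<le> C"
  proof (intro exI ballI)
    fix s assume "s \<in> S b"
    then obtain t :: "nat \<Rightarrow> real" and n where t: "mono t" "range t \<subseteq> {a..b}"
      "s = (\<Sum>i<n. norm (g (t (Suc i)) - g (t i)))" by (auto simp: S_def)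
    have "ennreal s \<le> variation a b g"
      unfolding variation_def t(3)
      using t(1,2) by (intro SUP_upper2[of "(t,n)"]) auto
    then have "enn2real (ennreal s) \<le> enn2real (variation a b g)"
      using assms(1) by (intro enn2real_mono) auto
    moreover have "s \<ge> 0" unfolding t(3) by (auto intro: sum_nonneg)
    ultimately show "s \<le> enn2real (variation a b g)" by simp
  qed
  then have bdd: "bdd_above (S x)" if "x \<le> b" for x
  proof -
    have "S x \<subseteq> S b" using that by (fastforce simp: S_def)
    then show ?thesis using fin by (auto simp: bdd_above_def)
  qed
  have ne: "S x \<noteq> {}" if "a \<le> x" for x
  proof -
    have "(\<Sum>i<(0::nat). norm (g ((\<lambda>_. a) (Suc i)) - g ((\<lambda>_. a) i))) \<in> S x"
      unfolding S_def using that by (intro CollectI exI[of _ "\<lambda>_. a"] exI[of _ 0]) (auto simp: mono_def)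
    then show ?thesis by blast
  qed
  have "norm (g y - g x) \<le> W y - W x" if xy: "a \<le> x" "x \<le> y" "y \<le> b" for x y
  proof -
    have "s + norm (g y - g x) \<le> W y" if "s \<in> S x" for s
    proof -
      obtain t :: "nat \<Rightarrow> real" and n where t: "mono t" "range t \<subseteq> {a..x}"
        "s = (\<Sum>i<n. norm (g (t (Suc i)) - g (t i)))" using \<open>s \<in> S x\<close> by (auto simp: S_def)
      have ti: "a \<le> t i" "t i \<le> x" for i using t(2) by (auto simp: image_subset_iff)
      \<comment> \<open>The partition of \<open>{a..x}\<close> is prolonged by \<open>x\<close> and
        then \<open>y\<close>, and stays at \<open>y\<close>, since \<open>variation\<close> ranges
        over monotone sequences indexed by all natural numbers.\<close>
      define r where "r i = (if i \<le> n then t i else if i = Suc n then x else y)" for i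
      have "t i \<le> y" for i using ti(2)[of i] xy(2) by linarith
      note ty = this
      then have "mono r"
        unfolding r_def mono_def using t(1) ti xy by (auto simp: mono_def)
      moreover have "range r \<subseteq> {a..y}"
        using ti ty xy unfolding r_def by (auto intro: order_trans)
      ultimately have "(\<Sum>i<Suc (Suc n). norm (g (r (Suc i)) - g (r i))) \<in> S y"
        unfolding S_def by blast
      then have "(\<Sum>i<Suc (Suc n). norm (g (r (Suc i)) - g (r i))) \<le> W y"
        unfolding W_def by (rule cSup_upper) (rule bdd[OF xy(3)])
      moreover have "(\<Sum>i<n. norm (g (r (Suc i)) - g (r i))) = s"
        unfolding t(3) by (rule sum.cong) (auto simp: r_def)
      moreover have "(\<Sum>i<Suc (Suc n). norm (g (r (Suc i)) - g (r i))) =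
        (\<Sum>i<n. norm (g (r (Suc i)) - g (r i))) + norm (g x - g (t n)) + norm (g y - g x)"
        by (simp add: r_def)
      ultimately show ?thesis using norm_ge_zero[of "g x - g (t n)"] by linarith
    qed
    then have "s \<le> W y - norm (g y - g x)" if "s \<in> S x" for s
      using that by (simp add: algebra_simps)
    then have "W x \<le> W y - norm (g y - g x)"
      unfolding W_def[of x] by (intro cSup_least ne xy) auto
    then show ?thesis by simp
  qed
  then have "variation_le g a b (W b - W a)"
    by (intro variation_leI[of _ _ _ W]) auto
  then show ?thesis ..
qed

text \<open>
  A function with values in \<open>{0..\<epsilon>}\<close> has variation at most \<open>\<epsilon>\<close> on a short open interval to the right of
  \<open>x\<close>; the jump at \<open>x\<close> itself costs another \<open>\<epsilon>\<close>.
\<close>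

lemma variation_le_near_right:
  fixes G :: "real \<Rightarrow> real"
  assumes "variation_le G a b V" "0 < \<epsilon>" "\<And>x. x \<in> {a..b} \<Longrightarrow> 0 \<le> G x \<and> G x \<le> \<epsilon>" "a \<le> x" "x < b"
  shows "\<exists>d>0. \<forall>v. x \<le> v \<and> v \<le> b \<and> v < x + d \<longrightarrow> variation_le G x v (2 * \<epsilon>)"
proof -
  obtain W where W: "\<And>x y. a \<le> x \<Longrightarrow> x \<le> y \<Longrightarrow> y \<le> b \<Longrightarrow> norm (G y - G x) \<le> W y - W x"
    "W a = 0" "W b \<le> V" "mono_on {a..b} W"
    by (rule variation_leE[OF assms(1)]) (rule that)
  \<comment> \<open>\<open>L\<close> is the right limit of \<open>W\<close> at \<open>x\<close>;
    beyond \<open>x\<close> and up to \<open>y0\<close> the majorant grows by less than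
    \<open>\<epsilon>\<close> from \<open>L\<close>.\<close>
  define L where "L = Inf (W ` {x<..b})"
  have ne: "W ` {x<..b} \<noteq> {}" using assms(5) by auto
  have bdd: "bdd_below (W ` {x<..b})"
    by (rule bdd_belowI2[of _ "W x"]) (use assms(4) in \<open>auto intro!: mono_onD[OF W(4)]\<close>)
  obtain y0 where y0: "x < y0" "y0 \<le> b" "W y0 < L + \<epsilon>"
    using cInf_lessD[OF ne, of "L + \<epsilon>"] assms(2) unfolding L_def by auto
  show ?thesis
  proof (intro exI[of _ "y0 - x"] conjI allI impI)
    fix v assume v: "x \<le> v \<and> v \<le> b \<and> v < x + (y0 - x)"
    \<comment> \<open>Lowering the value at \<open>x\<close> to \<open>L - \<epsilon>\<close> makes
      every increment starting at \<open>x\<close> at least \<open>\<epsilon>\<close>, which bounds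
      any jump of a function with values in \<open>{0..\<epsilon>}\<close>, however large the jump
      of \<open>W\<close> at \<open>x\<close> is.\<close>
    define Z where "Z y = (if y = x then L - \<epsilon> else W y)" for y
    have Lle: "L \<le> W y" if "x < y" "y \<le> b" for y
      unfolding L_def by (rule cInf_lower[OF _ bdd]) (use that in auto)
    show "variation_le G x v (2 * \<epsilon>)"
    proof (rule variation_leI[of _ _ _ Z])
      fix p q assume pq: "x \<le> p" "p \<le> q" "q \<le> v"
      show "norm (G q - G p) \<le> Z q - Z p"
      proof (cases "p = x")
        case True
        show ?thesis
        proof (cases "q = x")
          case False
          have "norm (G q - G x) \<le> \<epsilon>"
            using assms(3)[of q] assms(3)[of x] pq assms(4,5) v by auto
          then show ?thesis
            using True False Lle[of q] pq v by (simp add: Z_def)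
        qed (simp add: True)
      next
        case False
        then show ?thesis using W(1)[of p q] pq v assms(4) by (auto simp: Z_def)
      qed
    next
      have "W v \<le> W y0"
        using v y0 assms(4) by (intro mono_onD[OF W(4)]) auto
      then show "Z v - Z x \<le> 2 * \<epsilon>"
        using y0 assms(2) by (auto simp: Z_def)
    qed
  qed (use y0 in auto)
qed

text \<open>Each side of \<open>x\<close> contributes \<open>2 * \<epsilon>\<close>: one
  \<open>\<epsilon>\<close> for the jump at \<open>x\<close> and one for the rest of a short
  interval.\<close>

lemma variation_le_near:
  fixes G :: "real \<Rightarrow> real"
  assumes "variation_le G a b V" "0 < \<epsilon>" "\<And>x. x \<in> {a..b} \<Longrightarrow> 0 \<le> G x \<and> G x \<le> \<epsilon>" "a \<le> x" "x \<le> b"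
  shows "\<exists>d>0. \<forall>u v. a \<le> u \<and> u \<le> x \<and> x \<le> v \<and> v \<le> b \<and> v - u < d \<longrightarrow> variation_le G u v (4 * \<epsilon>)"
proof -
  have triv: "variation_le G x x (2 * \<epsilon>)"
    by (rule variation_leI[of _ _ _ "\<lambda>_. 0"]) (use assms(2) in \<open>auto dest: antisym\<close>)
  have R: "\<exists>d>0. \<forall>v. x \<le> v \<and> v \<le> b \<and> v < x + d \<longrightarrow> variation_le G x v (2 * \<epsilon>)"
  proof (cases "x = b")
    case True
    then show ?thesis using triv by (intro exI[of _ 1]) (auto dest: antisym)
  next
    case False
    then show ?thesis using variation_le_near_right[OF assms(1-4)] assms(5) by auto
  qed
  have L: "\<exists>d>0. \<forall>u. a \<le> u \<and> u \<le> x \<and> x < u + d \<longrightarrow> variation_le G u x (2 * \<epsilon>)"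
  proof (cases "x = a")
    case True
    then show ?thesis using triv by (intro exI[of _ 1]) (auto dest: antisym)
  next
    case False
    \<comment> \<open>The left side is the right side of the reflected function.\<close>
    have refl: "variation_le (\<lambda>y. G (- y)) (-b) (-a) V"
      by (rule variation_le_compose[OF assms(1)])
        (use assms(4,5) in \<open>auto simp: monotone_on_def\<close>)
    have "\<exists>d>0. \<forall>v. - x \<le> v \<and> v \<le> - a \<and> v < - x + d \<longrightarrow> variation_le (\<lambda>y. G (- y)) (- x) v (2 * \<epsilon>)"
      by (rule variation_le_near_right[OF refl assms(2)]) (use assms(3,4,5) False in auto)
    then obtain d where d: "d > 0"
      "\<And>v. - x \<le> v \<and> v \<le> - a \<and> v < - x + d \<Longrightarrow> variation_le (\<lambda>y. G (- y)) (- x) v (2 * \<epsilon>)"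
      by auto
    have "variation_le G u x (2 * \<epsilon>)" if u: "a \<le> u" "u \<le> x" "x < u + d" for u
    proof -
      have "variation_le (\<lambda>y. G (- (- y))) u x (2 * \<epsilon>)"
        by (rule variation_le_compose[OF d(2)[of "-u"]])
          (use u in \<open>auto simp: monotone_on_def\<close>)
      then show ?thesis by simp
    qed
    then show ?thesis using d(1) by blast
  qed
  obtain d1 where d1: "d1 > 0" "\<And>v. x \<le> v \<and> v \<le> b \<and> v < x + d1 \<Longrightarrow> variation_le G x v (2 * \<epsilon>)"
    using R by auto
  obtain d2 where d2: "d2 > 0" "\<And>u. a \<le> u \<and> u \<le> x \<and> x < u + d2 \<Longrightarrow> variation_le G u x (2 * \<epsilon>)"
    using L by auto
  show ?thesis
  proof (intro exI[of _ "min d1 d2"] conjI allI impI)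
    fix u v assume uv: "a \<le> u \<and> u \<le> x \<and> x \<le> v \<and> v \<le> b \<and> v - u < min d1 d2"
    have "variation_le G u v (2 * \<epsilon> + 2 * \<epsilon>)"
      by (rule variation_le_join[of _ x]) (use uv in \<open>auto intro!: d1(2) d2(2)\<close>)
    then show "variation_le G u v (4 * \<epsilon>)" by simp
  qed (use d1 d2 in auto)
qed

section \<open>The Lasota-Yorke estimate for a weight of bounded variation\<close>

lemma variation_le_sup_bound:
  fixes \<phi> :: "real \<Rightarrow> real"
  assumes "variation_le \<phi> u v V" "u < v" "integral\<^sup>L (lebesgue_on {u..v}) \<phi> \<le> I" "x \<in> {u..v}"
  shows "\<phi> x \<le> I / (v - u) + V"
proof -
  \<comment> \<open>\<open>V\<close> bounds the oscillation, so the mean of \<open>\<phi>\<close> is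
    at least \<open>\<phi> x - V\<close>.\<close>
  have "\<phi> x - V \<le> \<phi> y" if "y \<in> {u..v}" for y
    using variation_le_bound[OF assms(1) that assms(4)] by auto
  then have "integral\<^sup>L (lebesgue_on {u..v}) (\<lambda>_. \<phi> x - V) \<le> integral\<^sup>L (lebesgue_on {u..v}) \<phi>"
    using assms(2) variation_le_integrable_on[OF assms(1)]
    by (intro integral_mono) auto
  then have "(v - u) * (\<phi> x - V) \<le> I"
    using assms(2,3) by (simp add: measure_restrict_space)
  then have "\<phi> x - V \<le> I / (v - u)"
    using assms(2) by (simp add: pos_le_divide_eq mult.commute)
  then show ?thesis by simp
qed

lemma integral_subinterval_le:
  fixes \<phi> :: "real \<Rightarrow> real"
  assumes "integrable (lebesgue_on {a..b}) \<phi>" "\<And>x. x \<in> {a..b} \<Longrightarrow> 0 \<le> \<phi> x" "a \<le> u" "v \<le> b"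
  shows "integral\<^sup>L (lebesgue_on {u..v}) \<phi> \<le> integral\<^sup>L (lebesgue_on {a..b}) \<phi>"
proof -
  have "integrable lebesgue (\<lambda>x. indicator {a..b} x *\<^sub>R \<phi> x)"
    using assms(1) by (simp add: integrable_restrict_space)
  moreover have "integrable lebesgue (\<lambda>x. indicator {u..v} x *\<^sub>R (indicator {a..b} x *\<^sub>R \<phi> x))"
    by (rule integrable_mult_indicator) (use calculation in auto)
  ultimately have "integral\<^sup>L lebesgue (\<lambda>x. indicator {u..v} x *\<^sub>R (indicator {a..b} x *\<^sub>R \<phi> x)) \<le>
      integral\<^sup>L lebesgue (\<lambda>x. indicator {a..b} x *\<^sub>R \<phi> x)"
    by (intro integral_mono) (use assms(2) in \<open>auto simp: indicator_def\<close>)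
  moreover have "(\<lambda>x. indicator {u..v} x *\<^sub>R (indicator {a..b} x *\<^sub>R \<phi> x)) = (\<lambda>x. indicator {u..v} x *\<^sub>R \<phi> x)"
    using assms(3,4) by (auto simp: indicator_def fun_eq_iff)
  ultimately show ?thesis
    by (simp add: integral_restrict_space)
qed

text \<open>The subdivision depends only on \<open>G\<close>, which is why a single \<open>K\<close>
  serves all \<open>\<phi>\<close>. It is not chosen explicitly: the Bolzano principle reduces the
  claim to short intervals around a point and to gluing, where the constants \<open>K\<close> add
  and the factor before \<open>V\<close> is unchanged.\<close>

lemma variation_le_weighted:
  fixes G :: "real \<Rightarrow> real"
  assumes "a \<le> b" "variation_le G a b VG" "0 < \<epsilon>" "\<And>x. x \<in> {a..b} \<Longrightarrow> 0 \<le> G x \<and> G x \<le> \<epsilon>"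
  shows "\<exists>K\<ge>0. \<forall>\<phi> V. (\<forall>x\<in>{a..b}. 0 \<le> \<phi> x) \<longrightarrow> variation_le \<phi> a b V \<longrightarrow>
    integral\<^sup>L (lebesgue_on {a..b}) \<phi> \<le> 1 \<longrightarrow> variation_le (\<lambda>x. G x * \<phi> x) a b (5 * \<epsilon> * V + K)"
proof -
  define Q where "Q u v K \<longleftrightarrow> (\<forall>\<phi> V. (\<forall>x\<in>{u..v}. 0 \<le> \<phi> x) \<longrightarrow> variation_le \<phi> u v V \<longrightarrow>
    integral\<^sup>L (lebesgue_on {u..v}) \<phi> \<le> 1 \<longrightarrow> variation_le (\<lambda>x. G x * \<phi> x) u v (5 * \<epsilon> * V + K))" for u v K
  \<comment> \<open>The guards are needed because the local step of \<open>Bolzano\<close> concerns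
    all short intervals around \<open>x\<close>, including those that leave
    \<open>{a..b}\<close>.\<close>
  have "a \<le> a \<longrightarrow> a \<le> b \<longrightarrow> b \<le> b \<longrightarrow> (\<exists>K\<ge>0. Q a b K)"
    using assms(1)
  proof (induction rule: Bolzano[where P = "\<lambda>u v. a \<le> u \<longrightarrow> u \<le> v \<longrightarrow> v \<le> b \<longrightarrow> (\<exists>K\<ge>0. Q u v K)"])
    case (trans u m v)
    show ?case
    proof (intro impI)
      assume uv: "a \<le> u" "u \<le> v" "v \<le> b"
      obtain K1 K2 where K: "0 \<le> K1" "Q u m K1" "0 \<le> K2" "Q m v K2"
        using trans uv by fastforce
      have "Q u v (K1 + K2)"
        unfolding Q_def
      proof (intro allI impI)
        fix \<phi> :: "real \<Rightarrow> real" and V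
        assume \<phi>: "\<forall>x\<in>{u..v}. 0 \<le> \<phi> x" "variation_le \<phi> u v V" "integral\<^sup>L (lebesgue_on {u..v}) \<phi> \<le> 1"
        obtain V1 V2 where V: "variation_le \<phi> u m V1" "variation_le \<phi> m v V2" "V1 + V2 = V"
          using variation_le_split[OF trans(3,4) \<phi>(2)] .
        have int: "integrable (lebesgue_on {u..v}) \<phi>"
          by (rule variation_le_integrable_on[OF \<phi>(2) uv(2)])
        have le: "integral\<^sup>L (lebesgue_on {u..m}) \<phi> \<le> 1" "integral\<^sup>L (lebesgue_on {m..v}) \<phi> \<le> 1"
          using integral_subinterval_le[OF int, of u m] integral_subinterval_le[OF int, of m v] \<phi>(1,3) trans(3,4)
          by auto
        have "variation_le (\<lambda>x. G x * \<phi> x) u v ((5 * \<epsilon> * V1 + K1) + (5 * \<epsilon> * V2 + K2))"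
          using K(2,4) \<phi>(1) V(1,2) le trans(3,4) unfolding Q_def
          by (intro variation_le_join[OF trans(3,4)]) auto
        then show "variation_le (\<lambda>x. G x * \<phi> x) u v (5 * \<epsilon> * V + (K1 + K2))"
          by (rule variation_le_mono) (simp add: V(3)[symmetric] algebra_simps)
      qed
      then show "\<exists>K\<ge>0. Q u v K" using K by (intro exI[of _ "K1 + K2"]) auto
    qed
  next
    case (local x)
    obtain d where d: "d > 0"
      "\<And>u v. a \<le> u \<and> u \<le> x \<and> x \<le> v \<and> v \<le> b \<and> v - u < d \<Longrightarrow> variation_le G u v (4 * \<epsilon>)"
      using variation_le_near[OF assms(2-4) local] by auto
    show ?case
    proof (rule exI[of _ d], intro conjI allI impI d(1))
      fix u v assume uv: "u \<le> x \<and> x \<le> v \<and> v - u < d" "a \<le> u" "u \<le> v" "v \<le> b"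
      have vG: "variation_le G u v (4 * \<epsilon>)" using uv by (intro d(2)) auto
      show "\<exists>K\<ge>0. Q u v K"
      proof (cases "u = v")
        \<comment> \<open>On a degenerate interval there is no mean value to compare with, but every
          increment is 0.\<close>
        case True
        have "Q u v 0"
          unfolding Q_def True
        proof (intro allI impI)
          fix \<phi> :: "real \<Rightarrow> real" and V assume "variation_le \<phi> v v V"
          then have "0 \<le> V" by (rule variation_le_nonneg) simp
          then show "variation_le (\<lambda>x. G x * \<phi> x) v v (5 * \<epsilon> * V + 0)"
            by (intro variation_leI[of _ _ _ "\<lambda>_. 0"]) (use assms(3) in \<open>auto dest: antisym\<close>)
        qed
        then show ?thesis by auto
      next
        case False
        then have "u < v" using uv by simp
        have "Q u v (4 * \<epsilon> / (v - u))"
          unfolding Q_def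
        proof (intro allI impI)
          fix \<phi> :: "real \<Rightarrow> real" and V
          assume \<phi>: "\<forall>x\<in>{u..v}. 0 \<le> \<phi> x" "variation_le \<phi> u v V" "integral\<^sup>L (lebesgue_on {u..v}) \<phi> \<le> 1"
          \<comment> \<open>Product rule, with \<open>1 / (v - u) + V\<close> as bound for the
            supremum of \<open>\<phi>\<close>. The variation enters once with factor
            \<open>\<epsilon>\<close> and once with \<open>4 * \<epsilon>\<close>, which gives the
            5; the mean value gives the constant.\<close>
          have "variation_le (\<lambda>x. G x * \<phi> x) u v (\<epsilon> * V + (1 / (v - u) + V) * (4 * \<epsilon>))"
          proof (rule variation_le_mult[OF \<phi>(2) vG])
            show "\<bar>G x\<bar> \<le> \<epsilon>" if "x \<in> {u..v}" for x
              using assms(4)[of x] that uv by auto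
            show "\<bar>\<phi> x\<bar> \<le> 1 / (v - u) + V" if "x \<in> {u..v}" for x
              using variation_le_sup_bound[OF \<phi>(2) \<open>u < v\<close> \<phi>(3) that] \<phi>(1) that by simp
          qed (use uv in simp)
          then show "variation_le (\<lambda>x. G x * \<phi> x) u v (5 * \<epsilon> * V + 4 * \<epsilon> / (v - u))"
            by (rule variation_le_mono) (simp add: algebra_simps)
        qed
        then show ?thesis using \<open>u < v\<close> assms(3) by (intro exI[of _ "4 * \<epsilon> / (v - u)"]) auto
      qed
    qed
  qed
  then show ?thesis using assms(1) unfolding Q_def by auto
qed

text \<open>Induction on the number of intervals: the one reaching furthest right is removed, and
  its left end becomes the new \<open>b\<close>.\<close>

lemma sum_increments_disjoint_intervals_le:
  fixes l r :: "'b \<Rightarrow> real" and W :: "real \<Rightarrow> real"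
  assumes "finite F" "mono_on {a..b} W" "a \<le> b"
    and "\<And>J. J \<in> F \<Longrightarrow> a \<le> l J \<and> l J < r J \<and> r J \<le> b"
    and "\<And>J K. J \<in> F \<Longrightarrow> K \<in> F \<Longrightarrow> J \<noteq> K \<Longrightarrow> r J \<le> l K \<or> r K \<le> l J"
  shows "(\<Sum>J\<in>F. W (r J) - W (l J)) \<le> W b - W a"
  using assms
proof (induction "card F" arbitrary: F b)
  case 0
  then show ?case by (auto intro: mono_onD[OF 0(3)])
next
  case (Suc n)
  then have ne: "F \<noteq> {}" by auto
  have "Max (r ` F) \<in> r ` F" using Suc(3) ne by (intro Max_in) auto
  then obtain J where J0: "J \<in> F" "Max (r ` F) = r J" by auto
  have J: "J \<in> F" "\<And>K. K \<in> F \<Longrightarrow> r K \<le> r J"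
    using J0 Suc(3) by (auto simp flip: J0(2))
  have "(\<Sum>J\<in>F - {J}. W (r J) - W (l J)) \<le> W (l J) - W a"
  proof (rule Suc(1))
    show "mono_on {a..l J} W"
      using Suc(6)[OF J(1)] by (intro mono_on_subset[OF Suc(4)]) auto
    show "a \<le> l J" using Suc(6)[OF J(1)] by simp
    show "a \<le> l K \<and> l K < r K \<and> r K \<le> l J" if "K \<in> F - {J}" for K
      using Suc(6)[of K] Suc(6)[OF J(1)] Suc(7)[of J K] J that by force
  qed (use Suc J in \<open>auto\<close>)
  moreover have "W (r J) \<le> W b"
    using Suc(6)[OF J(1)] by (intro mono_onD[OF Suc(4)]) auto
  ultimately show ?case
    using sum.remove[OF Suc(3) J(1), of "\<lambda>J. W (r J) - W (l J)"] by simp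
qed

section \<open>Pieces and branches\<close>

lemma reciprocal_antimono:
  fixes p q :: real
  assumes "p \<le> q" "p \<noteq> 0" "q \<noteq> 0" "0 < p \<longleftrightarrow> 0 < q"
  shows "1 / q \<le> 1 / p"
proof -
  have "0 < p * q" using assms by (auto simp: zero_less_mult_iff)
  then show ?thesis using assms(1) by (intro divide_left_mono) (auto simp: mult.commute)
qed

context iwasawa_cf_map
begin

definition lo :: "real set \<Rightarrow> real" where "lo J = Inf J"

definition hi :: "real set \<Rightarrow> real" where "hi J = Sup J"

text \<open>
  All four choices of \<open>\<iota>\<close> have the form \<open>y \<mapsto> s / y\<close> with \<open>s = \<plusminus>1\<close> on an interval that avoids 0; \<open>orient J\<close> is
  this \<open>s\<close>. The inverse branch is extended to all of \<open>\<real>\<close> by mapping points outside its domain to an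
  endpoint of \<open>J\<close>.
\<close>

definition orient :: "real set \<Rightarrow> real" where "orient J = \<iota> (hi J) * hi J"

definition inverse_clamp :: "real set \<Rightarrow> real \<Rightarrow> real" where
  "inverse_clamp J x = 1 / max (1 / hi J) (min (1 / lo J) (orient J * (x - c J)))"

lemma branch_image_subset: "J \<in> P \<Longrightarrow> branch \<iota> c J ` J \<subseteq> {a..b}"
  using full_branch[of J] end_branch[of J] by blast

lemma piece_bounds:
  assumes "J \<in> P"
  shows "lo J < hi J" "J = {lo J..hi J}" "a \<le> lo J" "hi J \<le> b" "interior J = {lo J<..<hi J}"
proof -
  obtain u v where uv: "u < v" "J = {u..v}" "J \<subseteq> {a..b}" using pieces[OF assms] by blast
  then have "lo J = u" "hi J = v" by (auto simp: lo_def hi_def)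
  then show "lo J < hi J" "J = {lo J..hi J}" "a \<le> lo J" "hi J \<le> b" "interior J = {lo J<..<hi J}"
    using uv by auto
qed

lemma piece_mem: "J \<in> P \<Longrightarrow> y \<in> J \<longleftrightarrow> lo J \<le> y \<and> y \<le> hi J"
  using piece_bounds(2)[of J] by (metis atLeastAtMost_iff)

lemma interior_piece_mem: "J \<in> P \<Longrightarrow> y \<in> interior J \<longleftrightarrow> lo J < y \<and> y < hi J"
  using piece_bounds(5)[of J] by auto

lemma inversion_abs: "y \<noteq> 0 \<Longrightarrow> \<bar>\<iota> y\<bar> = 1 / \<bar>y\<bar>"
  using inversion by auto

lemma zero_notin_piece:
  assumes "J \<in> P"
  shows "0 \<notin> J"
proof
  assume 0: "0 \<in> J"
  \<comment> \<open>\<open>M\<close> exceeds every value of \<open>|\<iota> y|\<close> that is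
    compatible with a branch image inside \<open>{a..b}\<close>.\<close>
  define M where "M = 1 + \<bar>c J\<bar> + \<bar>a\<bar> + \<bar>b\<bar>"
  have M: "M > 0" by (auto simp: M_def)
  have "\<exists>y\<in>J. y \<noteq> 0 \<and> 1 / \<bar>y\<bar> \<ge> M"
  proof (cases "hi J > 0")
    case True
    have "min (hi J) (1 / M) \<in> J"
      using 0 True M piece_bounds[OF assms] by (metis atLeastAtMost_iff divide_nonneg_pos le_less
          min.bounded_iff min.cobounded1 order_trans zero_le_one less_imp_le)
    moreover have "1 / \<bar>min (hi J) (1 / M)\<bar> \<ge> M"
      using True M by (auto simp: min_def field_simps abs_if)
    ultimately show ?thesis using True M by (intro bexI[of _ "min (hi J) (1 / M)"]) auto
  next
    case False
    then have "lo J < 0" "0 \<le> hi J"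
      using 0 piece_bounds[OF assms] by (auto simp: set_eq_iff)
    then have "max (lo J) (- (1 / M)) \<in> J"
      using M piece_bounds(2)[OF assms]
      by (metis atLeastAtMost_iff divide_pos_pos le_less max.cobounded1 max_less_iff_conj
          neg_less_0_iff_less order_trans zero_less_one)
    moreover have "1 / \<bar>max (lo J) (- (1 / M))\<bar> \<ge> M"
      using \<open>lo J < 0\<close> M by (auto simp: max_def field_simps abs_if)
    ultimately show ?thesis using \<open>lo J < 0\<close> M by (intro bexI[of _ "max (lo J) (- (1 / M))"]) auto
  qed
  then obtain y where y: "y \<in> J" "y \<noteq> 0" "1 / \<bar>y\<bar> \<ge> M" by blast
  have "branch \<iota> c J y \<in> {a..b}" using branch_image_subset[OF assms] y(1) by blast
  then have "\<bar>\<iota> y\<bar> \<le> \<bar>a\<bar> + \<bar>b\<bar> + \<bar>c J\<bar>" by (auto simp: branch_def)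
  then show False using y(3) inversion_abs[OF y(2)] by (simp add: M_def)
qed

lemma piece_sign:
  assumes "J \<in> P"
  shows "0 < lo J \<or> hi J < 0" "0 < lo J * hi J"
proof -
  show "0 < lo J \<or> hi J < 0"
    using zero_notin_piece[OF assms] piece_bounds[OF assms] by (auto simp: set_eq_iff not_le)
  then show "0 < lo J * hi J"
    using piece_bounds(1)[OF assms] by (auto intro: mult_pos_pos mult_neg_neg)
qed

lemma orient:
  assumes "J \<in> P"
  shows "orient J = 1 \<or> orient J = -1" "y \<in> J \<Longrightarrow> branch \<iota> c J y = orient J / y + c J"
proof -
  have s: "y \<in> J \<Longrightarrow> (0 < y \<longleftrightarrow> 0 < hi J) \<and> y \<noteq> 0" for y
    using piece_sign(1)[OF assms] piece_bounds(1,2)[OF assms] by (auto simp: set_eq_iff)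
  have h: "hi J \<in> J" using piece_bounds(1,2)[OF assms] by (metis atLeastAtMost_iff less_imp_le order_refl)
  show "orient J = 1 \<or> orient J = -1"
    using s[OF h] inversion unfolding orient_def by (auto simp: abs_if split: if_splits)
  assume y: "y \<in> J"
  then show "branch \<iota> c J y = orient J / y + c J"
    using s[OF h] s[OF y] inversion unfolding orient_def branch_def by (auto simp: abs_if)
qed

lemma orient_square: "J \<in> P \<Longrightarrow> orient J * (orient J * z) = z"
  using orient(1)[of J] by auto

text \<open>In the coordinate \<open>t = 1 / y\<close> the branch on \<open>J\<close> is the affine
  map \<open>t \<mapsto> orient J * t + c J\<close>. These facts transport a piece, which keeps to
  one side of 0, to its interval in this coordinate and back.\<close>

lemma reciprocal_piece:
  assumes "J \<in> P"
  shows "t \<in> {1 / hi J..1 / lo J} \<Longrightarrow> 1 / t \<in> J" "y \<in> J \<Longrightarrow> 1 / y \<in> {1 / hi J..1 / lo J}"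
    "1 / hi J < 1 / lo J" "t \<in> {1 / hi J..1 / lo J} \<Longrightarrow> t \<noteq> 0 \<and> (0 < t \<longleftrightarrow> 0 < lo J)"
proof -
  note pb = piece_bounds(1,2)[OF assms]
  show lt: "1 / hi J < 1 / lo J"
    using piece_sign(2)[OF assms] pb(1) by (intro divide_strict_left_mono) (auto simp: mult.commute)
  show sg: "t \<in> {1 / hi J..1 / lo J} \<Longrightarrow> t \<noteq> 0 \<and> (0 < t \<longleftrightarrow> 0 < lo J)" for t
    using piece_sign(1)[OF assms] pb(1)
  proof (elim disjE)
    assume "t \<in> {1 / hi J..1 / lo J}" "0 < lo J"
    moreover have "0 < 1 / hi J" using \<open>0 < lo J\<close> pb(1) by simp
    ultimately have "0 < t" unfolding atLeastAtMost_iff by linarith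
    then show ?thesis using \<open>0 < lo J\<close> by simp
  next
    assume "t \<in> {1 / hi J..1 / lo J}" "hi J < 0"
    moreover have "1 / lo J < 0" using \<open>hi J < 0\<close> pb(1) by simp
    ultimately have "t < 0" unfolding atLeastAtMost_iff by linarith
    then show ?thesis using \<open>hi J < 0\<close> pb(1) by simp
  qed
  show "1 / t \<in> J" if t: "t \<in> {1 / hi J..1 / lo J}"
    using piece_sign(1)[OF assms]
  proof
    assume "0 < lo J"
    then have "0 < t" "0 < hi J" using sg[OF t] pb(1) by auto
    then have "1 / t \<in> {lo J..hi J}" using t \<open>0 < lo J\<close> by (auto simp: field_simps)
    then show ?thesis using pb(2) by simp
  next
    assume "hi J < 0"
    then have "t < 0" "lo J < 0" using sg[OF t] pb(1) by auto
    then have "1 / t \<in> {lo J..hi J}" using t \<open>hi J < 0\<close> by (auto simp: field_simps)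
    then show ?thesis using pb(2) by simp
  qed
  show "1 / y \<in> {1 / hi J..1 / lo J}" if y: "y \<in> J"
    using piece_sign(1)[OF assms]
  proof
    assume "0 < lo J"
    moreover have "lo J \<le> y" "y \<le> hi J" using y pb(2) by auto
    ultimately show ?thesis by (auto simp: field_simps)
  next
    assume "hi J < 0"
    moreover have "lo J \<le> y" "y \<le> hi J" using y pb(2) by auto
    ultimately show ?thesis by (auto simp: field_simps)
  qed
qed

lemma inverse_clamp_arg:
  assumes "J \<in> P"
  shows "max (1 / hi J) (min (1 / lo J) t) \<in> {1 / hi J..1 / lo J}"
  using reciprocal_piece(3)[OF assms] by auto

lemma inverse_clamp_in: "J \<in> P \<Longrightarrow> inverse_clamp J x \<in> J"
  unfolding inverse_clamp_def by (intro reciprocal_piece(1) inverse_clamp_arg)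

lemma inverse_clamp_branch:
  assumes "J \<in> P" "y \<in> J"
  shows "inverse_clamp J (branch \<iota> c J y) = y"
proof -
  have "orient J * (branch \<iota> c J y - c J) = 1 / y"
    using orient(1)[OF assms(1)] by (auto simp: orient(2)[OF assms])
  then show ?thesis
    using reciprocal_piece(2)[OF assms] by (simp add: inverse_clamp_def)
qed

text \<open>Wherever the clamping has an effect it returns an endpoint of \<open>J\<close>; so at an
  interior value it did nothing, and the formula is the genuine inverse.\<close>

lemma branch_inverse_clamp:
  assumes "J \<in> P" "inverse_clamp J x \<in> interior J"
  shows "branch \<iota> c J (inverse_clamp J x) = x"
proof -
  define t where "t = orient J * (x - c J)"
  have i: "lo J < inverse_clamp J x" "inverse_clamp J x < hi J"
    using assms(2) piece_bounds(5)[OF assms(1)] by auto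
  have "max (1 / hi J) (min (1 / lo J) t) = t"
  proof (rule ccontr)
    assume "max (1 / hi J) (min (1 / lo J) t) \<noteq> t"
    then have "max (1 / hi J) (min (1 / lo J) t) \<in> {1 / hi J, 1 / lo J}"
      by (auto simp: max_def min_def)
    then have "inverse_clamp J x \<in> {hi J, lo J}"
      unfolding inverse_clamp_def t_def by auto
    then show False using i by auto
  qed
  then have eq: "inverse_clamp J x = 1 / t" by (simp add: inverse_clamp_def t_def)
  have "branch \<iota> c J (inverse_clamp J x) = orient J / inverse_clamp J x + c J"
    by (rule orient(2)[OF assms(1) inverse_clamp_in[OF assms(1)]])
  also have "\<dots> = orient J * t + c J" unfolding eq by simp
  also have "\<dots> = x" unfolding t_def orient_square[OF assms(1)] by simp
  finally show ?thesis .
qed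

lemma inverse_clamp_monotone:
  assumes "J \<in> P"
  shows "mono_on A (inverse_clamp J) \<or> antimono_on A (inverse_clamp J)"
proof -
  have le: "inverse_clamp J y \<le> inverse_clamp J x"
    if "orient J * (x - c J) \<le> orient J * (y - c J)" for x y
  proof -
    let ?f = "\<lambda>x. max (1 / hi J) (min (1 / lo J) (orient J * (x - c J)))"
    have "?f x \<le> ?f y" using that by (auto simp: max_def min_def)
    moreover have "?f x \<noteq> 0 \<and> (0 < ?f x \<longleftrightarrow> 0 < lo J)" "?f y \<noteq> 0 \<and> (0 < ?f y \<longleftrightarrow> 0 < lo J)"
      by (intro reciprocal_piece(4)[OF assms] inverse_clamp_arg[OF assms])+
    ultimately show ?thesis
      unfolding inverse_clamp_def by (intro reciprocal_antimono) blast+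
  qed
  from orient(1)[OF assms] show ?thesis
  proof
    assume "orient J = 1"
    then have "antimono_on A (inverse_clamp J)"
      by (intro monotone_onI le) auto
    then show ?thesis ..
  next
    assume "orient J = - 1"
    then have "mono_on A (inverse_clamp J)"
      by (intro monotone_onI le) auto
    then show ?thesis ..
  qed
qed

lemma branch_monotone:
  assumes "J \<in> P"
  shows "mono_on J (branch \<iota> c J) \<or> antimono_on J (branch \<iota> c J)"
proof -
  have le: "1 / y \<le> 1 / x" if "x \<in> J" "y \<in> J" "x \<le> y" for x y
  proof -
    have "x \<noteq> 0" "y \<noteq> 0" "0 < x \<longleftrightarrow> 0 < y"
      using that piece_sign(1)[OF assms] piece_bounds(2)[OF assms] by (auto simp: set_eq_iff)
    then show ?thesis using that(3) by (intro reciprocal_antimono)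
  qed
  from orient(1)[OF assms] show ?thesis
  proof
    assume "orient J = 1"
    then have "antimono_on J (branch \<iota> c J)"
      using le by (intro monotone_onI) (simp add: orient(2)[OF assms])
    then show ?thesis ..
  next
    assume "orient J = - 1"
    then have "mono_on J (branch \<iota> c J)"
      using le by (intro monotone_onI) (simp add: orient(2)[OF assms])
    then show ?thesis ..
  qed
qed

lemma pieces_disjoint:
  assumes "J \<in> P" "K \<in> P" "J \<noteq> K"
  shows "hi J \<le> lo K \<or> hi K \<le> lo J"
proof (rule ccontr)
  assume "\<not> ?thesis"
  then have "max (lo J) (lo K) < min (hi J) (hi K)"
    using piece_bounds(1)[OF assms(1)] piece_bounds(1)[OF assms(2)] by auto
  then obtain z where "max (lo J) (lo K) < z" "z < min (hi J) (hi K)" using dense by blast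
  then have "z \<in> interior J \<inter> interior K"
    using piece_bounds(5)[OF assms(1)] piece_bounds(5)[OF assms(2)] by auto
  then show False using non_overlapping assms by (auto simp: pairwise_def)
qed

lemma sum_increments_pieces_le:
  fixes W :: "real \<Rightarrow> real"
  assumes "finite F" "F \<subseteq> P" "mono_on {a..b} W"
  shows "(\<Sum>J\<in>F. W (hi J) - W (lo J)) \<le> W b - W a"
proof (rule sum_increments_disjoint_intervals_le[OF assms(1,3)])
  show "a \<le> b" using nondegenerate by simp
  show "a \<le> lo J \<and> lo J < hi J \<and> hi J \<le> b" if "J \<in> F" for J
    using piece_bounds[of J] that assms(2) by auto
  show "hi J \<le> lo K \<or> hi K \<le> lo J" if "J \<in> F" "K \<in> F" "J \<noteq> K" for J K
    using pieces_disjoint[of J K] that assms(2) by auto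
qed

text \<open>The form in which non-overlap enters the estimates. With a majorant for \<open>W\<close>
  it adds up the variations on the pieces; with the identity it adds up the lengths.\<close>

lemma summable_increments:
  fixes W :: "real \<Rightarrow> real"
  assumes "mono_on {a..b} W"
  shows "(\<lambda>J. W (hi J) - W (lo J)) summable_on P" "(\<Sum>\<^sub>\<infinity>J\<in>P. W (hi J) - W (lo J)) \<le> W b - W a"
proof -
  have nn: "0 \<le> W (hi J) - W (lo J)" if "J \<in> P" for J
    using mono_onD[OF assms, of "lo J" "hi J"] piece_bounds(1,3,4)[OF that] by simp
  show s: "(\<lambda>J. W (hi J) - W (lo J)) summable_on P"
    by (rule nonneg_bdd_above_summable_on[OF nn])
      (auto intro!: bdd_aboveI2[of _ _ "W b - W a"] sum_increments_pieces_le[OF _ _ assms])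
  show "(\<Sum>\<^sub>\<infinity>J\<in>P. W (hi J) - W (lo J)) \<le> W b - W a"
    by (rule infsum_le_finite_sums[OF s]) (rule sum_increments_pieces_le[OF _ _ assms])
qed

lemma endpoint_notin_interior:
  assumes "J \<in> P" "K \<in> P"
  shows "lo J \<notin> interior K" "hi J \<notin> interior K"
  using pieces_disjoint[OF assms] piece_bounds[OF assms(1)] piece_bounds[OF assms(2)]
  by (cases "J = K"; auto)+

end

section \<open>The pointwise transfer operator and its weights\<close>

locale proper_iwasawa_cf_map = iwasawa_cf_map +
  assumes proper: "proper a b"
begin

section \<open>Comparison of the weights with the lengths of the pieces\<close>

lemma abs_le_gamma: "x \<in> {a..b} \<Longrightarrow> \<bar>x\<bar> \<le> max \<bar>a\<bar> \<bar>b\<bar>"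
  by auto

lemma gamma_less_1: "max \<bar>a\<bar> \<bar>b\<bar> < 1"
  using proper by (simp add: proper_def)

text \<open>The image of \<open>J\<close> has length \<open>1 / lo J - 1 / hi J\<close> and lies in
  \<open>{a..b}\<close>, whose length is at most 2 for a proper map. Multiplying by
  \<open>lo J * hi J\<close> gives the claim.\<close>

lemma length_le_reciprocal:
  assumes "J \<in> P"
  shows "hi J - lo J \<le> 2 * (lo J * hi J)"
proof -
  have m: "lo J \<in> J" "hi J \<in> J"
    using piece_bounds(1,2)[OF assms] by (metis atLeastAtMost_iff less_imp_le order_refl)+
  then have "branch \<iota> c J (lo J) \<in> {a..b}" "branch \<iota> c J (hi J) \<in> {a..b}"
    using branch_image_subset[OF assms] by blast+
  then have "1 / lo J - 1 / hi J \<le> b - a"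
    using orient(1)[OF assms] by (auto simp: orient(2)[OF assms] m)
  moreover have "b - a \<le> 2" using gamma_less_1 by auto
  ultimately have "(1 / lo J - 1 / hi J) * (lo J * hi J) \<le> 2 * (lo J * hi J)"
    using piece_sign(2)[OF assms] by (intro mult_right_mono) auto
  moreover have "(1 / lo J - 1 / hi J) * (lo J * hi J) = hi J - lo J"
    using piece_sign(2)[OF assms] by (auto simp: field_simps)
  ultimately show ?thesis by simp
qed

text \<open>As the ends have modulus less than 1, the length bound shows that their moduli differ at
  most by the factor \<open>1 + 2 = 3\<close>; so the square of the larger one is at most
  \<open>3 * (lo J * hi J)\<close>.\<close>

lemma square_le_on_piece:
  assumes "J \<in> P" "y \<in> J"
  shows "y\<^sup>2 \<le> 3 * (lo J * hi J)"
proof -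
  note pb = piece_bounds(1,3,4)[OF assms(1)]
  have y: "lo J \<le> y" "y \<le> hi J" using assms piece_bounds(2)[OF assms(1)] by auto
  have ab: "-1 < a" "b < 1" using gamma_less_1 by auto
  from piece_sign(1)[OF assms(1)] show ?thesis
  proof
    assume p: "0 < lo J"
    have "lo J * hi J \<le> lo J * 1" using p pb ab by (intro mult_left_mono) auto
    then have h3: "hi J \<le> 3 * lo J" using length_le_reciprocal[OF assms(1)] by simp
    have "y\<^sup>2 \<le> hi J * hi J" unfolding power2_eq_square using y p by (intro mult_mono) auto
    also have "\<dots> \<le> (3 * lo J) * hi J" using h3 p pb by (intro mult_right_mono) auto
    finally show ?thesis by simp
  next
    assume n: "hi J < 0"
    have "(- hi J) * (- lo J) \<le> (- hi J) * 1" using n pb ab by (intro mult_left_mono) auto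
    then have h3: "- lo J \<le> 3 * (- hi J)" using length_le_reciprocal[OF assms(1)] by (simp add: mult.commute)
    have "y\<^sup>2 = (-y) * (-y)" by (simp add: power2_eq_square)
    also have "\<dots> \<le> (- lo J) * (- lo J)" using y n by (intro mult_mono) auto
    also have "\<dots> \<le> (3 * (- hi J)) * (- lo J)" using h3 n pb by (intro mult_right_mono) auto
    finally show ?thesis by (simp add: algebra_simps)
  qed
qed

text \<open>The reverse comparison: a full piece has an image of length \<open>b - a\<close>, so
  \<open>1 / lo J - 1 / hi J\<close> is at least \<open>b - a\<close>.\<close>

lemma full_piece_le:
  assumes "J \<in> P" "a \<notin> J" "b \<notin> J"
  shows "lo J * hi J \<le> (hi J - lo J) / (b - a)"
proof -
  have im: "branch \<iota> c J ` J = {a..b}" by (rule full_branch[OF assms])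
  then have "a \<in> branch \<iota> c J ` J" "b \<in> branch \<iota> c J ` J"
    using nondegenerate by auto
  then obtain p q where pq: "p \<in> J" "q \<in> J" "a = branch \<iota> c J p" "b = branch \<iota> c J q"
    by auto
  have "1 / p \<in> {1 / hi J..1 / lo J}" "1 / q \<in> {1 / hi J..1 / lo J}"
    using reciprocal_piece(2)[OF assms(1)] pq by blast+
  moreover have "b - a = orient J * (1 / q - 1 / p)"
    using pq orient(2)[OF assms(1)] by (simp add: right_diff_distrib)
  ultimately have "b - a \<le> 1 / lo J - 1 / hi J"
    using orient(1)[OF assms(1)] by auto
  then have "(b - a) * (lo J * hi J) \<le> (1 / lo J - 1 / hi J) * (lo J * hi J)"
    using piece_sign(2)[OF assms(1)] by (intro mult_right_mono) auto
  moreover have "(1 / lo J - 1 / hi J) * (lo J * hi J) = hi J - lo J"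
    using piece_sign(2)[OF assms(1)] by (auto simp: field_simps)
  ultimately show ?thesis
    using nondegenerate by (simp add: pos_le_divide_eq mult.commute)
qed

lemma finite_end_pieces: "finite {J \<in> P. a \<in> J \<or> b \<in> J}"
proof -
  have fin: "finite S" if S: "\<And>J K. J \<in> S \<Longrightarrow> K \<in> S \<Longrightarrow> J = K" for S :: "real set set"
  proof (cases "S = {}")
    case False
    then obtain J where "J \<in> S" by blast
    then have "S \<subseteq> {J}" using S by blast
    then show ?thesis by (rule finite_subset) simp
  qed simp
  have "J = K" if "J \<in> {J \<in> P. a \<in> J}" "K \<in> {J \<in> P. a \<in> J}" for J K
  proof (rule ccontr)
    assume "J \<noteq> K"
    have JK: "J \<in> P" "K \<in> P" "a \<in> J" "a \<in> K" using that by auto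
    then have "lo J = a" "lo K = a"
      using piece_bounds(3)[of J] piece_bounds(3)[of K] piece_mem by (meson antisym)+
    then show False
      using pieces_disjoint[OF JK(1,2) \<open>J \<noteq> K\<close>] piece_bounds(1)[OF JK(1)] piece_bounds(1)[OF JK(2)]
      by linarith
  qed
  then have "finite {J \<in> P. a \<in> J}" by (rule fin)
  moreover have "J = K" if "J \<in> {J \<in> P. b \<in> J}" "K \<in> {J \<in> P. b \<in> J}" for J K
  proof (rule ccontr)
    assume "J \<noteq> K"
    have JK: "J \<in> P" "K \<in> P" "b \<in> J" "b \<in> K" using that by auto
    then have "hi J = b" "hi K = b"
      using piece_bounds(4)[of J] piece_bounds(4)[of K] piece_mem by (meson antisym)+
    then show False
      using pieces_disjoint[OF JK(1,2) \<open>J \<noteq> K\<close>] piece_bounds(1)[OF JK(1)] piece_bounds(1)[OF JK(2)]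
      by linarith
  qed
  then have "finite {J \<in> P. b \<in> J}" by (rule fin)
  ultimately have "finite ({J \<in> P. a \<in> J} \<union> {J \<in> P. b \<in> J})" by simp
  then show ?thesis by (rule finite_subset[rotated]) auto
qed

text \<open>Full pieces are dominated by their lengths, whose sum is finite; pieces containing
  \<open>a\<close> or \<open>b\<close> are finite in number. With the factor 3 above, this makes the
  suprema of the weight over the pieces summable.\<close>

lemma summable_lo_hi: "(\<lambda>J. lo J * hi J) summable_on P"
proof -
  let ?E = "{J \<in> P. a \<in> J \<or> b \<in> J}"
  have "mono_on {a..b} (\<lambda>x. x)" by (auto intro: mono_onI)
  from summable_increments(1)[OF this]
  have "(\<lambda>J. hi J - lo J) summable_on (P - ?E)"
    by (rule summable_on_subset) auto
  from summable_on_cmult_left[OF this, of "1 / (b - a)"]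
  have "(\<lambda>J. (hi J - lo J) / (b - a)) summable_on (P - ?E)" by simp
  then have "(\<lambda>J. lo J * hi J) summable_on (P - ?E)"
    by (rule summable_on_comparison_test) (auto intro: full_piece_le less_imp_le piece_sign(2))
  moreover have "(\<lambda>J. lo J * hi J) summable_on ?E"
    using finite_end_pieces by (rule summable_on_finite)
  ultimately have "(\<lambda>J. lo J * hi J) summable_on ((P - ?E) \<union> ?E)"
    by (rule summable_on_Un_disjoint) auto
  then show ?thesis by (rule summable_on_subset) auto
qed

text \<open>
  As the weight is 0 at the endpoints of the pieces, no indicator of the domains of the inverse
  branches is needed in \<open>pointwise_transfer\<close>.
\<close>

definition weight :: "real \<Rightarrow> real" where
  "weight y = (if \<exists>J\<in>P. y \<in> interior J then y\<^sup>2 else 0)"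

definition pointwise_transfer :: "(real \<Rightarrow> real) \<Rightarrow> real \<Rightarrow> real" where
  "pointwise_transfer \<phi> x = (\<Sum>\<^sub>\<infinity>J\<in>P. weight (inverse_clamp J x) * \<phi> (inverse_clamp J x))"

text \<open>This is \<open>G_n\<close>: it equals \<open>1 / |(T^n)' y|\<close> if the first
  \<open>n\<close> points of the orbit of \<open>y\<close> lie in interiors of pieces, and 0
  otherwise.\<close>

primrec cocycle :: "nat \<Rightarrow> real \<Rightarrow> real" where
  "cocycle 0 = (\<lambda>_. 1)"
| "cocycle (Suc n) = (\<lambda>y. weight y * cocycle n (T y))"

lemma weight_endpoint: "J \<in> P \<Longrightarrow> weight (lo J) = 0" "J \<in> P \<Longrightarrow> weight (hi J) = 0"
  using endpoint_notin_interior by (auto simp: weight_def)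

lemma weight_interior: "J \<in> P \<Longrightarrow> y \<in> interior J \<Longrightarrow> weight y = y\<^sup>2"
  by (auto simp: weight_def)

lemma piece_cases:
  assumes "J \<in> P" "y \<in> J"
  shows "y \<in> interior J \<or> y = lo J \<or> y = hi J"
  using piece_bounds(2,5)[OF assms(1)] assms(2) by (auto simp: set_eq_iff)

lemma piece_subset: "J \<in> P \<Longrightarrow> J \<subseteq> {a..b}"
  using pieces by blast

lemma weight_nonneg: "0 \<le> weight y"
  by (simp add: weight_def)

lemma weight_le_gamma: "weight y \<le> (max \<bar>a\<bar> \<bar>b\<bar>)\<^sup>2"
proof (cases "\<exists>J\<in>P. y \<in> interior J")
  case True
  then have "y \<in> {a..b}" using piece_subset interior_subset by blast
  then have "\<bar>y\<bar> \<le> max \<bar>a\<bar> \<bar>b\<bar>" by (rule abs_le_gamma)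
  then have "\<bar>y\<bar>\<^sup>2 \<le> (max \<bar>a\<bar> \<bar>b\<bar>)\<^sup>2" by (intro power_mono) auto
  then show ?thesis using True by (simp add: weight_def)
qed (simp add: weight_def)

lemma weight_le_on_piece: "J \<in> P \<Longrightarrow> y \<in> J \<Longrightarrow> weight y \<le> 3 * (lo J * hi J)"
  using order_trans[OF zero_le_power2 square_le_on_piece[of J y]] square_le_on_piece[of J y]
  by (auto simp: weight_def)

lemma weight_transfer_term_bound:
  assumes "\<And>y. y \<in> {a..b} \<Longrightarrow> \<bar>\<phi> y\<bar> \<le> B" "J \<in> P"
  shows "\<bar>weight (inverse_clamp J x) * \<phi> (inverse_clamp J x)\<bar> \<le> 3 * (lo J * hi J) * B"
proof -
  have i: "inverse_clamp J x \<in> J" by (rule inverse_clamp_in[OF assms(2)])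
  then have "\<bar>\<phi> (inverse_clamp J x)\<bar> \<le> B" using assms piece_subset by blast
  then show ?thesis
    using weight_le_on_piece[OF assms(2) i] weight_nonneg[of "inverse_clamp J x"]
    unfolding abs_mult by (intro mult_mono) auto
qed

lemma summable_lo_hi_mult: "(\<lambda>J. 3 * (lo J * hi J) * B) summable_on P"
  by (intro summable_on_cmult_left summable_on_cmult_right summable_lo_hi)

lemma transfer_terms_summable:
  assumes "\<And>y. y \<in> {a..b} \<Longrightarrow> \<bar>\<phi> y\<bar> \<le> B"
  shows "(\<lambda>J. weight (inverse_clamp J x) * \<phi> (inverse_clamp J x)) summable_on P"
proof -
  have "(\<lambda>J. norm (weight (inverse_clamp J x) * \<phi> (inverse_clamp J x))) summable_on P"
    by (rule summable_on_comparison_test[OF summable_lo_hi_mult[of B]])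
      (use weight_transfer_term_bound[OF assms] in auto)
  then show ?thesis by (rule abs_summable_summable)
qed

text \<open>The summand of \<open>J\<close> is \<open>weight * \<phi>\<close> on \<open>J\<close>
  composed with the monotone map \<open>inverse_clamp J\<close>, hence varies by at most the
  increment of the majorant over \<open>J\<close>. These increments belong to non-overlapping pieces
  and add up to at most \<open>V\<close>.\<close>

lemma pointwise_transfer_variation:
  assumes "variation_le (\<lambda>y. weight y * \<phi> y) a b V"
  shows "variation_le (pointwise_transfer \<phi>) a b V"
proof -
  obtain W where W: "\<And>x y. a \<le> x \<Longrightarrow> x \<le> y \<Longrightarrow> y \<le> b \<Longrightarrow> norm (weight y * \<phi> y - weight x * \<phi> x) \<le> W y - W x"
    "W a = 0" "W b \<le> V" "mono_on {a..b} W"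
    by (rule variation_leE[OF assms]) (rule that)
  note s = summable_increments[OF W(4)]
  have piece: "variation_le (\<lambda>y. weight y * \<phi> y) (lo J) (hi J) (W (hi J) - W (lo J))" if "J \<in> P" for J
    by (rule variation_leI[of _ _ _ W]) (use W(1) piece_bounds(3,4)[OF that] in auto)
  have "variation_le (\<lambda>x. \<Sum>\<^sub>\<infinity>J\<in>P. weight (inverse_clamp J x) * \<phi> (inverse_clamp J x)) a b
      (\<Sum>\<^sub>\<infinity>J\<in>P. W (hi J) - W (lo J))"
  proof (rule variation_le_infsum[OF _ _ s(1)])
    show "variation_le (\<lambda>x. weight (inverse_clamp J x) * \<phi> (inverse_clamp J x)) a b (W (hi J) - W (lo J))"
      if "J \<in> P" for J
      by (rule variation_le_compose[OF piece[OF that]])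
        (use inverse_clamp_monotone[OF that] inverse_clamp_in[OF that] piece_bounds(2)[OF that] nondegenerate in auto)
    show "(\<lambda>J. weight (inverse_clamp J x) * \<phi> (inverse_clamp J x)) summable_on P" for x
    proof (rule abs_summable_summable, rule summable_on_comparison_test[OF s(1)])
      fix J assume J: "J \<in> P"
      have i: "inverse_clamp J x \<in> {lo J..hi J}"
        using inverse_clamp_in[OF J] piece_bounds(2)[OF J] by auto
      \<comment> \<open>The weight vanishes at \<open>lo J\<close>, so each term is itself an
        increment and is bounded by the variation on \<open>J\<close>.\<close>
      show "norm (weight (inverse_clamp J x) * \<phi> (inverse_clamp J x)) \<le> W (hi J) - W (lo J)"
        using variation_le_bound[OF piece[OF J] _ i, of "lo J"] piece_bounds(1)[OF J] weight_endpoint[OF J] by auto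
    qed auto
  qed (use nondegenerate in auto)
  then show ?thesis
    unfolding pointwise_transfer_def[abs_def] by (rule variation_le_mono) (use s(2) W(2,3) in auto)
qed

lemma cocycle_bounds: "0 \<le> cocycle n y \<and> cocycle n y \<le> (max \<bar>a\<bar> \<bar>b\<bar>) ^ (2 * n)"
proof (induction n arbitrary: y)
  case (Suc n)
  have "weight y * cocycle n (T y) \<le> (max \<bar>a\<bar> \<bar>b\<bar>)\<^sup>2 * (max \<bar>a\<bar> \<bar>b\<bar>) ^ (2 * n)"
    using Suc[of "T y"] weight_le_gamma[of y] weight_nonneg[of y] by (intro mult_mono) auto
  then show ?case using Suc[of "T y"] weight_nonneg[of y] by (simp add: power_add power2_eq_square)
qed simp

lemma cocycle_le_1: "cocycle n y \<le> 1"
proof -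
  have "(max \<bar>a\<bar> \<bar>b\<bar>) ^ (2 * n) \<le> 1" using gamma_less_1 by (intro power_le_one) auto
  then show ?thesis using cocycle_bounds[of n y] by linarith
qed

text \<open>Wherever the weight of a term is nonzero, \<open>T (inverse_clamp J x) = x\<close>; so a
  factor depending on \<open>x\<close> can be carried into the sum as a function of
  \<open>T\<close>.\<close>

lemma cocycle_transfer:
  "cocycle n x * pointwise_transfer \<phi> x = pointwise_transfer (\<lambda>y. cocycle n (T y) * \<phi> y) x"
proof -
  have "cocycle n x * (weight (inverse_clamp J x) * \<phi> (inverse_clamp J x)) =
    weight (inverse_clamp J x) * (cocycle n (T (inverse_clamp J x)) * \<phi> (inverse_clamp J x))" if J: "J \<in> P" for J
  proof (cases "inverse_clamp J x \<in> interior J")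
    case True
    then show ?thesis by (simp add: T_on_piece[OF J] branch_inverse_clamp[OF J])
  next
    case False
    then have "weight (inverse_clamp J x) = 0"
      using piece_cases[OF J inverse_clamp_in[OF J, of x]] weight_endpoint[OF J] by auto
    then show ?thesis by simp
  qed
  then show ?thesis
    unfolding pointwise_transfer_def infsum_cmult_right'[symmetric] by (intro infsum_cong)
qed

text \<open>The function is the sum over \<open>J\<close> of its compositions with the projection
  \<open>cl J\<close> onto \<open>J\<close>: outside the interior of \<open>J\<close> such a
  composition takes an endpoint value, which is 0.\<close>

lemma piecewise_variation:
  fixes \<psi> :: "real \<Rightarrow> real"
  assumes "\<And>J. J \<in> P \<Longrightarrow> variation_le \<psi> (lo J) (hi J) (V J)" "V summable_on P"
    and zero: "\<And>y. \<forall>J\<in>P. y \<notin> interior J \<Longrightarrow> \<psi> y = 0"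
  shows "variation_le \<psi> a b (\<Sum>\<^sub>\<infinity>J\<in>P. V J)"
proof -
  define cl where "cl J y = max (lo J) (min (hi J) y)" for J y
  have ends: "\<psi> (lo J) = 0" "\<psi> (hi J) = 0" if "J \<in> P" for J
    using zero endpoint_notin_interior that by blast+
  have out: "\<psi> (cl J y) = 0" if "J \<in> P" "y \<notin> interior J" for J y
    using ends[OF that(1)] that piece_bounds(1,5)[OF that(1)] by (auto simp: cl_def max_def min_def)
  have sum: "((\<lambda>J. \<psi> (cl J y)) has_sum \<psi> y) P" for y
  proof (cases "\<exists>K\<in>P. y \<in> interior K")
    case True
    then obtain K where K: "K \<in> P" "y \<in> interior K" by blast
    have "\<psi> (cl J y) = 0" if "J \<in> P - {K}" for J
      using that K non_overlapping by (intro out) (auto simp: pairwise_def)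
    moreover have "\<psi> (cl K y) = \<psi> y"
      using K(2) piece_bounds(5)[OF K(1)] by (auto simp: cl_def)
    moreover have "((\<lambda>J. \<psi> (cl J y)) has_sum (\<Sum>J\<in>{K}. \<psi> (cl J y))) {K}"
      by (rule has_sum_finite) simp
    ultimately show ?thesis
      using K(1) by (subst has_sum_cong_neutral[where T = "{K}" and g = "\<lambda>J. \<psi> (cl J y)"]) auto
  next
    case False
    then have "\<psi> (cl J y) = 0" if "J \<in> P" for J using out that by blast
    moreover have "\<psi> y = 0" using zero False by blast
    ultimately show ?thesis using has_sum_0[of P "\<lambda>J. \<psi> (cl J y)"] by simp
  qed
  have "variation_le (\<lambda>y. \<Sum>\<^sub>\<infinity>J\<in>P. \<psi> (cl J y)) a b (\<Sum>\<^sub>\<infinity>J\<in>P. V J)"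
  proof (rule variation_le_infsum[OF _ _ assms(2)])
    show "variation_le (\<lambda>y. \<psi> (cl J y)) a b (V J)" if "J \<in> P" for J
      by (rule variation_le_compose[OF assms(1)[OF that]])
        (use piece_bounds(1)[OF that] nondegenerate in \<open>auto simp: cl_def monotone_on_def\<close>)
    show "(\<lambda>J. \<psi> (cl J y)) summable_on P" for y
      using sum by (auto simp: summable_on_def)
  qed (use nondegenerate in auto)
  then show ?thesis by (simp add: infsumI[OF sum])
qed

text \<open>Each branch may carry the whole variation of \<open>cocycle n\<close> onto its piece,
  but there it is multiplied by \<open>y\<^sup>2\<close>, whose supremum is summable over the
  pieces.\<close>

lemma cocycle_variation: "\<exists>V. variation_le (cocycle n) a b V"
proof (induction n)
  case 0
  then show ?case using variation_le_const[of 1 a b] by auto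
next
  case (Suc n)
  then obtain V where V: "variation_le (cocycle n) a b V" by blast
  \<comment> \<open>The bracket is the product rule for \<open>y\<^sup>2\<close> and the composed
    cocycle, which is at most 1; the last summand pays for the zeros at the two ends of
    \<open>J\<close>.\<close>
  let ?V = "\<lambda>J. (3 * (lo J * hi J) * V + 1 * (2 * (hi J - lo J))) + 2 * (3 * (lo J * hi J))"
  have "variation_le (cocycle (Suc n)) (lo J) (hi J) (?V J)" if J: "J \<in> P" for J
  proof -
    note pb = piece_bounds[OF J]
    have "variation_le (\<lambda>y. cocycle n (branch \<iota> c J y)) (lo J) (hi J) V"
      by (rule variation_le_compose[OF V])
        (use branch_image_subset[OF J] branch_monotone[OF J] pb(1,2) in auto)
    moreover have "variation_le (\<lambda>y. y\<^sup>2) (lo J) (hi J) (2 * (hi J - lo J))"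
    proof (rule variation_leI[of _ _ _ "\<lambda>y. 2 * y"])
      fix x y assume xy: "lo J \<le> x" "x \<le> y" "y \<le> hi J"
      have "y\<^sup>2 - x\<^sup>2 = (y + x) * (y - x)" by (simp add: power2_eq_square algebra_simps)
      then have "\<bar>y\<^sup>2 - x\<^sup>2\<bar> = \<bar>y + x\<bar> * (y - x)" using xy by (simp add: abs_mult)
      also have "\<dots> \<le> 2 * (y - x)"
        using gamma_less_1 pb(3,4) xy by (intro mult_right_mono) auto
      finally show "norm (y\<^sup>2 - x\<^sup>2) \<le> 2 * y - 2 * x" by simp
    qed simp
    ultimately have "variation_le (\<lambda>y. y\<^sup>2 * cocycle n (branch \<iota> c J y)) (lo J) (hi J)
        (3 * (lo J * hi J) * V + 1 * (2 * (hi J - lo J)))"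
      by (rule variation_le_mult)
        (use square_le_on_piece[OF J] cocycle_bounds cocycle_le_1 pb(1,2) in auto)
    moreover have "\<bar>y\<^sup>2 * cocycle n (branch \<iota> c J y)\<bar> \<le> 3 * (lo J * hi J)" if "y \<in> {lo J..hi J}" for y
    proof -
      have "y\<^sup>2 * cocycle n (branch \<iota> c J y) \<le> 3 * (lo J * hi J) * 1"
        using square_le_on_piece[OF J, of y] cocycle_bounds cocycle_le_1 pb(2) that piece_sign(2)[OF J]
        by (intro mult_mono) auto
      then show ?thesis using cocycle_bounds by simp
    qed
    ultimately show ?thesis
      by (rule variation_le_zero_ends[OF _ less_imp_le[OF pb(1)]])
        (use pb(5) in \<open>auto simp: weight_interior[OF J] T_on_piece[OF J] weight_endpoint[OF J]\<close>)
  qed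
  moreover have "?V summable_on P"
  proof -
    have "mono_on {a..b} (\<lambda>x. x)" by (auto intro: mono_onI)
    note s = summable_increments(1)[OF this]
    show ?thesis
      by (intro summable_on_add summable_on_cmult_left summable_on_cmult_right summable_lo_hi s)
  qed
  ultimately have "variation_le (cocycle (Suc n)) a b (\<Sum>\<^sub>\<infinity>J\<in>P. ?V J)"
    by (rule piecewise_variation) (auto simp: weight_def)
  then show ?case ..
qed

text \<open>At each step the outer cocycle is pulled inside the transfer by
  \<open>cocycle_transfer\<close>, where it merges with the weight. Thus no constant accumulates
  over \<open>n\<close> steps.\<close>

lemma iterated_transfer_variation:
  "variation_le (\<lambda>y. cocycle n y * \<phi> y) a b V \<Longrightarrow> variation_le ((pointwise_transfer ^^ n) \<phi>) a b V"
proof (induction n arbitrary: \<phi>)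
  case (Suc n)
  have "variation_le (\<lambda>y. weight y * (cocycle n (T y) * \<phi> y)) a b V"
    using Suc(2) by (simp add: mult.assoc)
  then have "variation_le (pointwise_transfer (\<lambda>y. cocycle n (T y) * \<phi> y)) a b V"
    by (rule pointwise_transfer_variation)
  then have "variation_le (\<lambda>x. cocycle n x * pointwise_transfer \<phi> x) a b V"
    by (simp add: cocycle_transfer)
  then have "variation_le ((pointwise_transfer ^^ n) (pointwise_transfer \<phi>)) a b V"
    by (rule Suc(1))
  then show ?case by (simp add: funpow_swap1)
qed simp

end

section \<open>The transfer operator on integrable functions\<close>

text \<open>By completeness of Lebesgue measure the exceptional set need not be shown measurable,
  which matters for its images and preimages under \<open>T\<close>.\<close>

lemma AE_lebesgue_on_iff_negligible:
  assumes "S \<in> sets lebesgue"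
  shows "(AE x in lebesgue_on S. Q x) \<longleftrightarrow> negligible {x \<in> S. \<not> Q x}"
proof -
  have "(AE x in lebesgue_on S. Q x) \<longleftrightarrow> (AE x in lebesgue. x \<in> S \<longrightarrow> Q x)"
    using assms by (simp add: AE_restrict_space_iff)
  also have "\<dots> \<longleftrightarrow> (\<exists>N\<in>null_sets lebesgue. {x \<in> S. \<not> Q x} \<subseteq> N)"
    by (auto simp: eventually_ae_filter)
  also have "\<dots> \<longleftrightarrow> negligible {x \<in> S. \<not> Q x}"
    using negligible_iff_null_sets negligible_subset by blast
  finally show ?thesis .
qed

text \<open>Equality in the triangle inequality for a series. After rotating by \<open>cnj u\<close>
  the sum is real and nonnegative, and the nonnegative terms
  \<open>norm (z i) - Re (z i * cnj u)\<close> have sum 0. If the sum is 0, all terms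
  vanish.\<close>

lemma norm_infsum_eq_imp_aligned:
  fixes z :: "'i \<Rightarrow> complex"
  assumes "(\<lambda>i. norm (z i)) summable_on A" "norm (infsum z A) = (\<Sum>\<^sub>\<infinity>i\<in>A. norm (z i))" "i \<in> A"
  shows "z i = norm (z i) * sgn (infsum z A)"
proof (cases "infsum z A = 0")
  case True
  then have "norm (z i) = 0"
    using assms by (intro nonneg_infsum_le_0D[of "\<lambda>i. norm (z i)" A]) auto
  then show ?thesis by simp
next
  case False
  define u where "u = sgn (infsum z A)"
  have u: "norm u = 1" using False by (simp add: u_def norm_sgn)
  then have uu: "u * cnj u = 1" by (simp add: complex_norm_square[symmetric])
  have hz: "(z has_sum infsum z A) A"
    by (rule has_sum_infsum, rule abs_summable_summable[OF assms(1)])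
  have inf: "infsum z A = norm (infsum z A) * u"
    using False by (simp add: u_def sgn_eq)
  have "Re (infsum z A * cnj u) = norm (infsum z A)"
  proof -
    have "infsum z A * cnj u = norm (infsum z A) * (u * cnj u)"
      by (subst inf) (simp add: mult.assoc)
    then show ?thesis using uu by simp
  qed
  then have "((\<lambda>i. Re (z i * cnj u)) has_sum norm (infsum z A)) A"
    using has_sum_Re[OF has_sum_cmult_left[OF hz, of "cnj u"]] by simp
  then have "((\<lambda>i. norm (z i) + - Re (z i * cnj u)) has_sum
      ((\<Sum>\<^sub>\<infinity>i\<in>A. norm (z i)) + - norm (infsum z A))) A"
    by (intro has_sum_add has_sum_uminusI has_sum_infsum assms(1))
  moreover have "0 \<le> norm (z i) + - Re (z i * cnj u)" for i
    using complex_Re_le_cmod[of "z i * cnj u"] u by (simp add: norm_mult)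
  moreover have "(\<Sum>\<^sub>\<infinity>i\<in>A. norm (z i)) + - norm (infsum z A) \<le> 0"
    using assms(2) by simp
  ultimately have "norm (z i) + - Re (z i * cnj u) = 0"
    using nonneg_has_sum_le_0D[of "\<lambda>i. norm (z i) + - Re (z i * cnj u)"] assms(3) by blast
  then have "Re (z i * cnj u) = norm (z i * cnj u)"
    using u by (simp add: norm_mult)
  moreover from this have "Im (z i * cnj u) = 0"
    using cmod_power2[of "z i * cnj u"] by simp
  ultimately have "z i * cnj u = norm (z i * cnj u)"
    by (intro complex_eqI) auto
  then have "z i * cnj u = norm (z i)"
    using u by (simp add: norm_mult)
  then have 1: "z i * cnj u * u = norm (z i) * u" by (simp only:)
  have 2: "z i * cnj u * u = z i" using uu by (simp add: mult.assoc mult.commute)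
  show ?thesis using trans[OF sym[OF 2] 1] unfolding u_def .
qed

context iwasawa_cf_map
begin

abbreviation M :: "real measure" where "M \<equiv> lebesgue_on {a..b}"

definition transfer_term :: "(real \<Rightarrow> complex) \<Rightarrow> real set \<Rightarrow> real \<Rightarrow> complex" where
  "transfer_term f J x = complex_of_real \<bar>deriv (inverse_branch \<iota> c J) x\<bar> * f (inverse_branch \<iota> c J x)
     * indicator (branch \<iota> c J ` J) x"

abbreviation H :: "(real \<Rightarrow> complex) \<Rightarrow> real \<Rightarrow> complex" where
  "H \<equiv> transfer_operator \<iota> P c"

lemma H_eq: "H f x = (\<Sum>\<^sub>\<infinity>J\<in>P. transfer_term f J x)"
  by (simp add: transfer_operator_def transfer_term_def)

text \<open>
  Off this countable set the junk values of \<open>inv_into\<close> and \<open>deriv\<close> do not matter.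
\<close>

definition branch_ends :: "real set" where
  "branch_ends = (\<Union>J\<in>P. branch \<iota> c J ` {lo J, hi J})"

lemma countable_branch_ends: "countable branch_ends"
  unfolding branch_ends_def using countable_partition by (intro countable_UN) auto

lemma inj_on_branch: "J \<in> P \<Longrightarrow> inj_on (branch \<iota> c J) J"
  by (rule inj_on_inverseI[of _ "inverse_clamp J"]) (rule inverse_clamp_branch)

lemma inverse_branch_branch: "J \<in> P \<Longrightarrow> y \<in> J \<Longrightarrow> inverse_branch \<iota> c J (branch \<iota> c J y) = y"
  unfolding inverse_branch_def by (rule inv_into_f_f[OF inj_on_branch])

lemma branch_reciprocal:
  assumes "J \<in> P" "1 / (orient J * (t - c J)) \<in> J"
  shows "branch \<iota> c J (1 / (orient J * (t - c J))) = t"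
proof -
  have "branch \<iota> c J (1 / (orient J * (t - c J))) = orient J * (orient J * (t - c J)) + c J"
    by (simp only: orient(2)[OF assms] divide_divide_eq_right div_by_1)
  then show ?thesis by (simp only: orient_square[OF assms(1)] diff_add_cancel)
qed

text \<open>On the open set \<open>?U\<close> the inverse branch agrees with the explicit map
  \<open>t \<mapsto> 1 / (orient J * (t - c J))\<close>. Agreement on a neighbourhood is what
  excludes the arbitrary values of \<open>inv_into\<close> outside the image.\<close>

lemma inverse_branch_derivative:
  assumes "J \<in> P" "y \<in> interior J"
  shows "(inverse_branch \<iota> c J has_field_derivative - orient J * y\<^sup>2) (at (branch \<iota> c J y))"
proof -
  let ?r = "\<lambda>t. orient J * (t - c J)"
  let ?U = "?r -` {1 / hi J<..<1 / lo J}"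
  have yJ: "y \<in> J" using assms(2) interior_subset by blast
  have y0: "y \<noteq> 0" using zero_notin_piece[OF assms(1)] yJ by auto
  have r: "?r (branch \<iota> c J y) = 1 / y"
    using orient_square[OF assms(1), of "1 / y"] by (simp add: orient(2)[OF assms(1) yJ])
  have open_U: "open ?U"
    by (intro open_vimage continuous_intros)
  have "1 / y \<in> {1 / hi J..1 / lo J}" by (rule reciprocal_piece(2)[OF assms(1) yJ])
  moreover have "1 / y \<noteq> 1 / hi J" "1 / y \<noteq> 1 / lo J"
    using assms(2) y0 interior_piece_mem[OF assms(1)] by auto
  ultimately have "branch \<iota> c J y \<in> ?U"
    unfolding vimage_eq r by (auto simp: less_le)
  have eq: "1 / ?r t = inverse_branch \<iota> c J t" if "t \<in> ?U" for t
  proof -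
    have t: "?r t \<in> {1 / hi J..1 / lo J}" using that by auto
    have J: "1 / ?r t \<in> J" by (rule reciprocal_piece(1)[OF assms(1) t])
    show ?thesis
      using inverse_branch_branch[OF assms(1) J] unfolding branch_reciprocal[OF assms(1) J] by simp
  qed
  have "((\<lambda>t. 1 / ?r t) has_field_derivative - orient J / (?r (branch \<iota> c J y))\<^sup>2) (at (branch \<iota> c J y))"
    using r y0 by (auto intro!: derivative_eq_intros simp: power2_eq_square)
  then have "((\<lambda>t. 1 / ?r t) has_field_derivative - orient J * y\<^sup>2) (at (branch \<iota> c J y))"
    unfolding r by (simp add: power_one_over)
  then show ?thesis
    by (rule has_field_derivative_transform_within_open[OF _ open_U \<open>branch \<iota> c J y \<in> ?U\<close>]) (rule eq)
qed

lemma deriv_inverse_branch: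
  "J \<in> P \<Longrightarrow> y \<in> interior J \<Longrightarrow> \<bar>deriv (inverse_branch \<iota> c J) (branch \<iota> c J y)\<bar> = y\<^sup>2"
  using DERIV_imp_deriv[OF inverse_branch_derivative] orient(1)[of J] by (auto simp: abs_mult)

lemma branch_image_cases:
  assumes "J \<in> P" "x \<in> branch \<iota> c J ` J" "x \<notin> branch_ends"
  obtains y where "y \<in> interior J" "x = branch \<iota> c J y"
proof -
  obtain y where y: "y \<in> J" "x = branch \<iota> c J y" using assms(2) by blast
  then have "y \<noteq> lo J" "y \<noteq> hi J" using assms by (auto simp: branch_ends_def)
  then have "y \<in> interior J" using y(1) piece_mem[OF assms(1)] interior_piece_mem[OF assms(1)] by auto
  then show thesis using y(2) that by blast
qed

lemma transfer_term_branch: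
  assumes "J \<in> P" "y \<in> interior J"
  shows "transfer_term f J (branch \<iota> c J y) = y\<^sup>2 * f y"
proof -
  have "y \<in> J" using assms(2) interior_subset by blast
  then show ?thesis
    using inverse_branch_branch[OF assms(1)] deriv_inverse_branch[OF assms]
    by (simp add: transfer_term_def)
qed

lemma branch_interior_sets:
  assumes "J \<in> P"
  shows "branch \<iota> c J ` interior J \<in> sets lebesgue"
proof -
  have "branch \<iota> c J ` interior J = (\<lambda>t. orient J * (t - c J)) -` {1 / hi J<..<1 / lo J}" (is "_ = ?U")
  proof (intro equalityI subsetI)
    fix x assume "x \<in> branch \<iota> c J ` interior J"
    then obtain y where y: "y \<in> interior J" "x = branch \<iota> c J y" by blast
    have yJ: "y \<in> J" using y(1) interior_subset by blast
    have y0: "y \<noteq> 0" using zero_notin_piece[OF assms] yJ by auto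
    have r: "orient J * (x - c J) = 1 / y"
      using orient_square[OF assms, of "1 / y"] by (simp add: y(2) orient(2)[OF assms yJ])
    have "1 / y \<in> {1 / hi J..1 / lo J}" by (rule reciprocal_piece(2)[OF assms yJ])
    moreover have "1 / y \<noteq> 1 / hi J" "1 / y \<noteq> 1 / lo J"
      using y(1) y0 interior_piece_mem[OF assms] by auto
    ultimately show "x \<in> ?U" unfolding vimage_eq r by (auto simp: less_le)
  next
    fix t assume "t \<in> ?U"
    then have t: "orient J * (t - c J) \<in> {1 / hi J<..<1 / lo J}" by simp
    have J: "1 / (orient J * (t - c J)) \<in> J"
      by (rule reciprocal_piece(1)[OF assms]) (use t in auto)
    have "1 / s \<noteq> l" if "s \<noteq> 1 / l" for s l :: real
      using that by auto
    then have "1 / (orient J * (t - c J)) \<noteq> lo J" "1 / (orient J * (t - c J)) \<noteq> hi J"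
      using t by (metis greaterThanLessThan_iff less_irrefl)+
    then have i: "1 / (orient J * (t - c J)) \<in> interior J"
      using J piece_mem[OF assms] interior_piece_mem[OF assms] by fastforce
    show "t \<in> branch \<iota> c J ` interior J"
      using imageI[OF i, of "branch \<iota> c J"] unfolding branch_reciprocal[OF assms J] .
  qed
  moreover have "open ?U" by (intro open_vimage continuous_intros)
  ultimately show ?thesis by (metis borel_open sets_completionI_sets sets_lborel)
qed

lemma inverse_branch_image: "J \<in> P \<Longrightarrow> inverse_branch \<iota> c J ` branch \<iota> c J ` interior J = interior J"
  using inverse_branch_branch[of J] interior_subset[of J] by (force simp: image_image)

text \<open>With a free value \<open>v\<close>, one equivalence yields both integrability and the
  value of the integral; it is applied to \<open>f\<close> and to its norm.\<close>

lemma change_of_variables: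
  fixes f :: "real \<Rightarrow> 'a::euclidean_space"
  assumes "J \<in> P"
  shows "(\<lambda>x. \<bar>deriv (inverse_branch \<iota> c J) x\<bar> *\<^sub>R f (inverse_branch \<iota> c J x)) absolutely_integrable_on
      (branch \<iota> c J ` interior J) \<and>
    integral (branch \<iota> c J ` interior J) (\<lambda>x. \<bar>deriv (inverse_branch \<iota> c J) x\<bar> *\<^sub>R f (inverse_branch \<iota> c J x)) = v
    \<longleftrightarrow> f absolutely_integrable_on interior J \<and> integral (interior J) f = v"
proof -
  have "inj_on (inverse_branch \<iota> c J) (branch \<iota> c J ` interior J)"
    using inverse_branch_branch[OF assms] interior_subset[of J]
    by (intro inj_on_inverseI[of _ "branch \<iota> c J"]) auto
  moreover have "(inverse_branch \<iota> c J has_field_derivative deriv (inverse_branch \<iota> c J) x)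
      (at x within branch \<iota> c J ` interior J)" if "x \<in> branch \<iota> c J ` interior J" for x
  proof -
    obtain y where y: "y \<in> interior J" "x = branch \<iota> c J y" using \<open>x \<in> branch \<iota> c J ` interior J\<close> by blast
    note d = inverse_branch_derivative[OF assms y(1)]
    show ?thesis
      unfolding y(2) DERIV_imp_deriv[OF d] by (rule has_field_derivative_at_within[OF d])
  qed
  ultimately show ?thesis
    using has_absolute_integral_change_of_variables_real[OF branch_interior_sets[OF assms],
        of "inverse_branch \<iota> c J" "deriv (inverse_branch \<iota> c J)" f v]
    by (simp only: inverse_branch_image[OF assms])
qed

end

lemma countable_imp_negligible: "countable X \<Longrightarrow> negligible X" for X :: "real set"
  by (simp add: negligible_iff_null_sets null_sets_completionI countable_imp_null_set_lborel)

lemma nn_integral_set_absolutely_integrable: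
  fixes u :: "real \<Rightarrow> real"
  assumes "u absolutely_integrable_on S" "\<And>x. x \<in> S \<Longrightarrow> 0 \<le> u x"
  shows "(\<integral>\<^sup>+x. ennreal (u x) * indicator S x \<partial>lebesgue) = ennreal (integral S u)"
proof -
  have i: "integrable lebesgue (\<lambda>x. indicator S x *\<^sub>R u x)"
    using assms(1) by (simp add: set_integrable_def)
  have "(\<integral>\<^sup>+x. ennreal (u x) * indicator S x \<partial>lebesgue) = (\<integral>\<^sup>+x. ennreal (indicator S x *\<^sub>R u x) \<partial>lebesgue)"
    by (intro nn_integral_cong) (auto simp: indicator_def)
  also have "\<dots> = ennreal (LINT x:S|lebesgue. u x)"
    unfolding set_lebesgue_integral_def
    by (rule nn_integral_eq_integral[OF i]) (use assms(2) in \<open>auto simp: indicator_def\<close>)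
  also have "\<dots> = ennreal (integral S u)"
    by (simp add: set_lebesgue_integral_eq_integral(2)[OF assms(1)])
  finally show ?thesis .
qed

context iwasawa_cf_map
begin

section \<open>Action on integrable functions: mass balance and contraction\<close>

lemma integrable_M_iff: "integrable M f \<longleftrightarrow> f absolutely_integrable_on {a..b}"
  for f :: "real \<Rightarrow> 'a::euclidean_space"
  by (simp add: set_integrable_def integrable_restrict_space)

lemma interior_piece_sets: "J \<in> P \<Longrightarrow> interior J \<in> sets M"
  using pieces[of J] interior_subset[of J]
  by (auto simp: sets_restrict_space image_iff intro!: bexI[of _ "interior J"])

lemma AE_M_countable:
  assumes "countable X"
  shows "AE x in M. x \<notin> X"
proof -
  have "negligible {x \<in> {a..b}. \<not> x \<notin> X}"
    by (rule negligible_subset[OF countable_imp_negligible[OF assms]]) auto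
  then show ?thesis by (simp add: AE_lebesgue_on_iff_negligible)
qed

lemma countable_gaps: "countable ({a..b} - (\<Union>J\<in>P. interior J))"
proof -
  have "{a..b} - (\<Union>J\<in>P. interior J) \<subseteq> {0} \<union> (\<Union>J\<in>P. {lo J, hi J})"
  proof
    fix x assume x: "x \<in> {a..b} - (\<Union>J\<in>P. interior J)"
    show "x \<in> {0} \<union> (\<Union>J\<in>P. {lo J, hi J})"
    proof (cases "x = 0")
      case False
      then obtain J where "J \<in> P" "x \<in> J" using x covering by blast
      then show ?thesis using x piece_mem[of J x] interior_piece_mem[of J x] by force
    qed simp
  qed
  then show ?thesis
    by (rule countable_subset) (use countable_partition in \<open>auto intro!: countable_UN\<close>)
qed

lemma AE_M_interior: "AE x in M. x \<in> (\<Union>J\<in>P. interior J)"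
proof -
  have "AE x in M. x \<in> {a..b}" by (rule AE_I2) simp
  with AE_M_countable[OF countable_gaps] show ?thesis by eventually_elim auto
qed

lemma transfer_term_outside: "x \<notin> branch \<iota> c J ` J \<Longrightarrow> transfer_term f J x = 0"
  by (simp add: transfer_term_def)

lemma branch_image_interior_iff:
  assumes "J \<in> P" "x \<notin> branch \<iota> c J ` {lo J, hi J}"
  shows "x \<in> branch \<iota> c J ` interior J \<longleftrightarrow> x \<in> branch \<iota> c J ` J"
  using assms piece_mem[OF assms(1)] interior_piece_mem[OF assms(1)]
  by (auto simp: image_iff) (metis less_le)+

text \<open>By substitution the term of \<open>J\<close> carries exactly the mass that
  \<open>f\<close> has on \<open>J\<close>.\<close>

lemma transfer_term_integrable:
  assumes "integrable M f" "J \<in> P"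
  shows "integrable M (transfer_term f J)"
    and "(\<integral>\<^sup>+x. norm (transfer_term f J x) \<partial>M) = (\<integral>\<^sup>+x. ennreal (norm (f x)) * indicator (interior J) x \<partial>M)"
proof -
  define S where "S = branch \<iota> c J ` interior J"
  \<comment> \<open>The substitution lives on the image of the open piece, the indicator on the
    image of the closed one; they can differ only at these two points.\<close>
  define X where "X = branch \<iota> c J ` {lo J, hi J}"
  have sub: "branch \<iota> c J ` J \<subseteq> {a..b}" by (rule branch_image_subset[OF assms(2)])
  have intJ: "interior J \<subseteq> {a..b}" using pieces[OF assms(2)] interior_subset by blast
  have SJ: "S \<subseteq> branch \<iota> c J ` J" unfolding S_def using interior_subset by blast
  have f: "f absolutely_integrable_on interior J"
    by (rule set_integrable_subset[of _ "{a..b}"]) (use assms(1) intJ in \<open>auto simp: integrable_M_iff\<close>)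
  have tt: "transfer_term f J x = \<bar>deriv (inverse_branch \<iota> c J) x\<bar> *\<^sub>R f (inverse_branch \<iota> c J x)" if "x \<in> S" for x
    using that SJ by (auto simp: transfer_term_def scaleR_conv_of_real)
  have "(\<lambda>x. \<bar>deriv (inverse_branch \<iota> c J) x\<bar> *\<^sub>R f (inverse_branch \<iota> c J x)) absolutely_integrable_on S"
    using change_of_variables[OF assms(2), of f "integral (interior J) f"] f unfolding S_def by blast
  then have i: "integrable lebesgue (\<lambda>x. indicator S x *\<^sub>R transfer_term f J x)"
    unfolding set_integrable_def by (rule Bochner_Integration.integrable_cong[THEN iffD1, rotated -1]) (auto simp: indicator_def tt)
  have ind: "indicator S x *\<^sub>R transfer_term f J x = indicator {a..b} x *\<^sub>R transfer_term f J x" if "x \<notin> X" for x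
  proof (cases "x \<in> branch \<iota> c J ` J")
    case True
    then have "x \<in> S" "x \<in> {a..b}"
      using branch_image_interior_iff[OF assms(2), of x] that sub by (auto simp: X_def S_def)
    then show ?thesis by simp
  qed (simp add: transfer_term_outside)
  have "countable X" by (simp add: X_def)
  have "integrable lebesgue (\<lambda>x. indicator {a..b} x *\<^sub>R transfer_term f J x)"
    by (rule integrable_discrete_difference[THEN iffD1, OF \<open>countable X\<close> _ _ _ i]) (auto simp: ind)
  then show "integrable M (transfer_term f J)" by (simp add: integrable_restrict_space)
  have nf: "(\<lambda>x. norm (f x)) absolutely_integrable_on interior J"
    by (rule absolutely_integrable_norm[OF f, unfolded o_def])
  then have nt: "(\<lambda>x. \<bar>deriv (inverse_branch \<iota> c J) x\<bar> *\<^sub>R norm (f (inverse_branch \<iota> c J x))) absolutely_integrable_on S"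
    "integral S (\<lambda>x. \<bar>deriv (inverse_branch \<iota> c J) x\<bar> *\<^sub>R norm (f (inverse_branch \<iota> c J x))) =
      integral (interior J) (\<lambda>x. norm (f x))"
    using change_of_variables[OF assms(2), of "\<lambda>x. norm (f x)" "integral (interior J) (\<lambda>x. norm (f x))"]
    unfolding S_def by blast+
  have "(\<integral>\<^sup>+x. norm (transfer_term f J x) \<partial>M) = (\<integral>\<^sup>+x. ennreal (norm (transfer_term f J x)) * indicator {a..b} x \<partial>lebesgue)"
    by (simp add: nn_integral_restrict_space)
  also have "\<dots> = (\<integral>\<^sup>+x. ennreal (norm (transfer_term f J x)) * indicator S x \<partial>lebesgue)"
  proof (rule nn_integral_cong_AE)
    have "negligible X" using \<open>countable X\<close> by (rule countable_imp_negligible)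
    then have "AE x in lebesgue. x \<notin> X" by (simp add: negligible_iff_null_sets AE_not_in)
    then show "AE x in lebesgue. ennreal (norm (transfer_term f J x)) * indicator {a..b} x =
        ennreal (norm (transfer_term f J x)) * indicator S x"
    proof eventually_elim
      case (elim x)
      then show ?case using ind[of x] by (cases "x \<in> S"; cases "x \<in> {a..b}") auto
    qed
  qed
  also have "\<dots> = (\<integral>\<^sup>+x. ennreal (\<bar>deriv (inverse_branch \<iota> c J) x\<bar> *\<^sub>R norm (f (inverse_branch \<iota> c J x))) * indicator S x \<partial>lebesgue)"
    by (intro nn_integral_cong) (auto simp: indicator_def tt)
  also have "\<dots> = ennreal (integral (interior J) (\<lambda>x. norm (f x)))"
    using nn_integral_set_absolutely_integrable[OF nt(1)] nt(2) by simp
  also have "\<dots> = (\<integral>\<^sup>+x. ennreal (norm (f x)) * indicator (interior J) x \<partial>lebesgue)"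
    using nn_integral_set_absolutely_integrable[OF nf] by simp
  also have "\<dots> = (\<integral>\<^sup>+x. ennreal (norm (f x)) * indicator (interior J) x \<partial>M)"
    using intJ by (subst nn_integral_restrict_space) (auto simp: indicator_def intro!: nn_integral_cong)
  finally show "(\<integral>\<^sup>+x. norm (transfer_term f J x) \<partial>M) = (\<integral>\<^sup>+x. ennreal (norm (f x)) * indicator (interior J) x \<partial>M)" .
qed

text \<open>This is \<open>H\<close> applied to the modulus of \<open>f\<close>, as an integral over
  counting measure with values in \<open>ennreal\<close>, so that Tonelli applies before any
  summability is known.\<close>

definition abs_transfer :: "(real \<Rightarrow> complex) \<Rightarrow> real \<Rightarrow> ennreal" where
  "abs_transfer f x = (\<integral>\<^sup>+J. norm (transfer_term f J x) \<partial>count_space P)"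

lemma disjoint_interiors: "disjoint_family_on interior P"
  using non_overlapping by (auto simp: disjoint_family_on_def pairwise_def)

lemma abs_transfer_measurable:
  assumes "integrable M f"
  shows "abs_transfer f \<in> borel_measurable M"
proof -
  interpret sigma_finite_measure "count_space P"
    by (rule sigma_finite_measure_count_space_countable[OF countable_partition])
  have "(\<lambda>(x, J). ennreal (norm (transfer_term f J x))) \<in> borel_measurable (M \<Otimes>\<^sub>M count_space P)"
    using transfer_term_integrable(1)[OF assms]
    by (subst measurable_split_conv, intro measurable_compose_countable'[where I = P and g = snd and f = "\<lambda>J w. ennreal (norm (transfer_term f J (fst w)))"])
      (auto simp: countable_partition)
  then show ?thesis
    unfolding abs_transfer_def[abs_def] by (rule borel_measurable_nn_integral)
qed

text \<open>Tonelli exchanges integral and sum, each term contributes the mass of \<open>f\<close>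
  on its piece, and the open pieces exhaust the interval up to a countable set.\<close>

lemma nn_integral_abs_transfer:
  assumes "integrable M f"
  shows "(\<integral>\<^sup>+x. abs_transfer f x \<partial>M) = (\<integral>\<^sup>+x. norm (f x) \<partial>M)"
proof -
  \<comment> \<open>Masses on pieces are values of this measure, so countable additivity sums
    them.\<close>
  let ?D = "density M (\<lambda>x. ennreal (norm (f x)))"
  have meas: "(\<lambda>x. ennreal (norm (f x))) \<in> borel_measurable M" using assms by simp
  have "(\<integral>\<^sup>+x. abs_transfer f x \<partial>M) = (\<integral>\<^sup>+J. (\<integral>\<^sup>+x. norm (transfer_term f J x) \<partial>M) \<partial>count_space P)"
    unfolding abs_transfer_def
    by (rule nn_integral_count_space_nn_integral[OF countable_partition])
      (use transfer_term_integrable(1)[OF assms] in auto)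
  also have "\<dots> = (\<integral>\<^sup>+J. emeasure ?D (interior J) \<partial>count_space P)"
    by (intro nn_integral_cong)
      (use transfer_term_integrable(2)[OF assms] interior_piece_sets in \<open>auto simp: emeasure_density[OF meas]\<close>)
  also have "\<dots> = emeasure ?D (\<Union>J\<in>P. interior J)"
    by (rule emeasure_UN_countable[symmetric])
      (use countable_partition disjoint_interiors interior_piece_sets in auto)
  also have "\<dots> = (\<integral>\<^sup>+x. ennreal (norm (f x)) * indicator (\<Union>J\<in>P. interior J) x \<partial>M)"
    by (rule emeasure_density[OF meas])
      (use countable_partition interior_piece_sets in \<open>auto intro!: sets.countable_UN'\<close>)
  also have "\<dots> = (\<integral>\<^sup>+x. norm (f x) \<partial>M)"
    by (rule nn_integral_cong_AE) (use AE_M_interior in \<open>auto simp: indicator_def\<close>)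
  finally show ?thesis .
qed

lemma AE_abs_transfer_finite:
  assumes "integrable M f"
  shows "AE x in M. abs_transfer f x < top"
proof -
  have "(\<integral>\<^sup>+x. abs_transfer f x \<partial>M) \<noteq> \<infinity>"
    using assms by (auto simp: nn_integral_abs_transfer[OF assms] integrable_iff_bounded)
  from nn_integral_PInf_AE[OF abs_transfer_measurable[OF assms] this]
  show ?thesis by (simp add: less_top)
qed

lemma abs_transfer_finite_iff:
  "abs_transfer f x < top \<longleftrightarrow> (\<lambda>J. norm (transfer_term f J x)) summable_on P"
proof -
  have "abs_transfer f x < top \<longleftrightarrow> integrable (count_space P) (\<lambda>J. transfer_term f J x)"
    by (simp add: integrable_iff_bounded abs_transfer_def)
  then show ?thesis
    using abs_summable_equivalent[of "\<lambda>J. transfer_term f J x" P]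
    by (simp add: Infinite_Set_Sum.abs_summable_on_def)
qed

lemma abs_transfer_eq:
  assumes "abs_transfer f x < top"
  shows "abs_transfer f x = ennreal (\<Sum>\<^sub>\<infinity>J\<in>P. norm (transfer_term f J x))"
proof -
  have i: "integrable (count_space P) (\<lambda>J. transfer_term f J x)"
    using assms by (simp add: integrable_iff_bounded abs_transfer_def)
  then have "abs_transfer f x = ennreal (infsetsum (\<lambda>J. norm (transfer_term f J x)) P)"
    unfolding abs_transfer_def infsetsum_def by (subst nn_integral_eq_integral) auto
  also have "infsetsum (\<lambda>J. norm (transfer_term f J x)) P = (\<Sum>\<^sub>\<infinity>J\<in>P. norm (transfer_term f J x))"
    by (rule infsetsum_infsum) (use i in \<open>simp add: Infinite_Set_Sum.abs_summable_on_def\<close>)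
  finally show ?thesis .
qed

text \<open>For complex terms summability is absolute summability, and both sides are 0 by
  convention when it fails. As an integral with a parameter, \<open>H f\<close> is
  measurable.\<close>

lemma H_eq_integral: "H f x = (LINT J|count_space P. transfer_term f J x)"
proof (cases "integrable (count_space P) (\<lambda>J. transfer_term f J x)")
  case True
  then show ?thesis
    unfolding H_eq by (subst infsetsum_infsum[symmetric])
      (auto simp: Infinite_Set_Sum.abs_summable_on_def infsetsum_def)
next
  case False
  then have "\<not> (\<lambda>J. transfer_term f J x) summable_on P"
    unfolding summable_on_iff_abs_summable_on_complex abs_summable_equivalent
    by (simp add: Infinite_Set_Sum.abs_summable_on_def)
  then show ?thesis using False by (simp add: H_eq infsum_not_exists not_integrable_integral_eq)
qed

lemma H_measurable:
  assumes "integrable M f"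
  shows "H f \<in> borel_measurable M"
proof -
  interpret sigma_finite_measure "count_space P"
    by (rule sigma_finite_measure_count_space_countable[OF countable_partition])
  have "(\<lambda>(x, J). transfer_term f J x) \<in> borel_measurable (M \<Otimes>\<^sub>M count_space P)"
    using transfer_term_integrable(1)[OF assms]
    by (subst measurable_split_conv, intro measurable_compose_countable'[where I = P and g = snd and f = "\<lambda>J w. transfer_term f J (fst w)"])
      (auto simp: countable_partition)
  then show ?thesis
    unfolding H_eq_integral[abs_def] by (rule borel_measurable_lebesgue_integral)
qed

lemma norm_H_le:
  assumes "abs_transfer f x < top"
  shows "ennreal (norm (H f x)) \<le> abs_transfer f x"
  unfolding abs_transfer_eq[OF assms] H_eq
  using assms by (intro ennreal_leI norm_infsum_bound) (simp add: abs_transfer_finite_iff)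

lemma nn_integral_H_le:
  assumes "integrable M f"
  shows "(\<integral>\<^sup>+x. norm (H f x) \<partial>M) \<le> (\<integral>\<^sup>+x. norm (f x) \<partial>M)"
  unfolding nn_integral_abs_transfer[OF assms, symmetric]
  by (rule nn_integral_mono_AE) (use AE_abs_transfer_finite[OF assms] norm_H_le in auto)

lemma H_integrable: "integrable M f \<Longrightarrow> integrable M (H f)"
  using nn_integral_H_le[of f] H_measurable[of f]
  by (auto simp: integrable_iff_bounded intro: le_less_trans)

lemma integral_norm_H_le:
  assumes "integrable M f"
  shows "(LINT x|M. norm (H f x)) \<le> (LINT x|M. norm (f x))"
  using nn_integral_H_le[OF assms] H_integrable[OF assms] assms
  by (simp add: nn_integral_eq_integral integral_nonneg_AE)

lemma transfer_term_linear:
  "transfer_term (\<lambda>y. k * f y + l * g y) J x = k * transfer_term f J x + l * transfer_term g J x"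
  by (simp add: transfer_term_def algebra_simps)

lemma H_linear:
  assumes "integrable M f" "integrable M g"
  shows "AE x in M. H (\<lambda>y. k * f y + l * g y) x = k * H f x + l * H g x"
  using AE_abs_transfer_finite[OF assms(1)] AE_abs_transfer_finite[OF assms(2)]
proof eventually_elim
  case (elim x)
  then have "(\<lambda>J. transfer_term f J x) summable_on P" "(\<lambda>J. transfer_term g J x) summable_on P"
    by (simp_all add: abs_transfer_finite_iff abs_summable_summable)
  then show ?case
    unfolding H_eq transfer_term_linear
    by (intro infsumI has_sum_add has_sum_cmult_right has_sum_infsum)
qed

text \<open>\<open>H\<close> acts on representatives; it respects classes because the contraction
  maps a function of norm 0 to one of norm 0.\<close>

lemma H_cong_AE:
  assumes "integrable M f" "integrable M g" "AE x in M. f x = g x"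
  shows "AE x in M. H f x = H g x"
proof -
  let ?d = "\<lambda>y. 1 * f y + (-1) * g y"
  have d: "integrable M ?d" using assms by simp
  have "(\<integral>\<^sup>+x. norm (H ?d x) \<partial>M) \<le> (\<integral>\<^sup>+x. norm (?d x) \<partial>M)" by (rule nn_integral_H_le[OF d])
  also have "\<dots> = (\<integral>\<^sup>+x. 0 \<partial>M)" by (rule nn_integral_cong_AE) (use assms(3) in auto)
  finally have "(\<integral>\<^sup>+x. norm (H ?d x) \<partial>M) = 0" by simp
  then have "AE x in M. H ?d x = 0"
    using H_measurable[OF d] by (subst (asm) nn_integral_0_iff_AE) auto
  with H_linear[OF assms(1,2), of 1 "-1"] show ?thesis by eventually_elim auto
qed

end

section \<open>Existence of an invariant density\<close>

text \<open>Dominated convergence of series along an arbitrary filter: outside a finite set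
  \<open>F\<close> the tails of both series are below \<open>e / 4\<close>, and on \<open>F\<close>
  the convergence is that of a finite sum.\<close>

lemma tendsto_infsum_dominated:
  fixes A :: "'h \<Rightarrow> 'i \<Rightarrow> real"
  assumes "G \<noteq> bot" "\<And>J. J \<in> P \<Longrightarrow> ((\<lambda>h. A h J) \<longlongrightarrow> B J) G"
    and "\<forall>\<^sub>F h in G. \<forall>J\<in>P. \<bar>A h J\<bar> \<le> g J" "g summable_on P"
  shows "((\<lambda>h. \<Sum>\<^sub>\<infinity>J\<in>P. A h J) \<longlongrightarrow> (\<Sum>\<^sub>\<infinity>J\<in>P. B J)) G"
proof (rule tendstoI)
  fix e :: real assume e: "e > 0"
  have B: "\<bar>B J\<bar> \<le> g J" if "J \<in> P" for J
  proof (rule tendsto_upperbound[OF _ _ assms(1)])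
    show "((\<lambda>h. \<bar>A h J\<bar>) \<longlongrightarrow> \<bar>B J\<bar>) G" by (intro tendsto_rabs assms(2) that)
    show "\<forall>\<^sub>F h in G. \<bar>A h J\<bar> \<le> g J" using assms(3) that by (auto elim: eventually_mono)
  qed
  have "(sum g \<longlongrightarrow> infsum g P) (finite_subsets_at_top P)"
    using has_sum_infsum[OF assms(4)] by (simp add: has_sum_def)
  then have "\<forall>\<^sub>F F in finite_subsets_at_top P. dist (sum g F) (infsum g P) < e / 4"
    using e by (intro tendstoD) auto
  then obtain F where F: "finite F" "F \<subseteq> P" "dist (sum g F) (infsum g P) < e / 4"
    unfolding eventually_finite_subsets_at_top by blast
  have sg: "g summable_on (P - F)" "g summable_on F"
    using assms(4) F(2) by (auto intro: summable_on_subset)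
  have "infsum g P = sum g F + infsum g (P - F)"
    using infsum_Un_disjoint[of g F "P - F"] sg F(1,2) by (simp add: Un_absorb1)
  then have tail: "infsum g (P - F) < e / 4"
    using F(3) by (auto simp: dist_real_def)
  have split: "\<bar>infsum C P - sum C F\<bar> < e / 4" "C summable_on P" if C: "\<And>J. J \<in> P \<Longrightarrow> \<bar>C J\<bar> \<le> g J" for C
  proof -
    have ab: "(\<lambda>J. \<bar>C J\<bar>) summable_on P"
      by (rule summable_on_comparison_test[OF assms(4)]) (use C in auto)
    then show s: "C summable_on P" using abs_summable_summable[of C P] by simp
    then have "infsum C P = sum C F + infsum C (P - F)"
      using infsum_Un_disjoint[of C F "P - F"] summable_on_subset[OF s] F(1,2) by (simp add: Un_absorb1)
    moreover have "norm (infsum C (P - F)) \<le> infsum g (P - F)"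
      by (rule norm_infsum_le[OF has_sum_infsum has_sum_infsum[OF sg(1)]])
        (use summable_on_subset[OF s] C in auto)
    ultimately show "\<bar>infsum C P - sum C F\<bar> < e / 4" using tail by simp
  qed
  have "((\<lambda>h. \<Sum>J\<in>F. A h J) \<longlongrightarrow> (\<Sum>J\<in>F. B J)) G"
    using F(2) by (intro tendsto_sum assms(2)) auto
  then have "\<forall>\<^sub>F h in G. dist (\<Sum>J\<in>F. A h J) (\<Sum>J\<in>F. B J) < e / 2"
    using e by (intro tendstoD) auto
  then show "\<forall>\<^sub>F h in G. dist (\<Sum>\<^sub>\<infinity>J\<in>P. A h J) (\<Sum>\<^sub>\<infinity>J\<in>P. B J) < e"
    using assms(3)
  proof eventually_elim
    case (elim h)
    have "\<bar>infsum (A h) P - sum (A h) F\<bar> < e / 4" "\<bar>infsum B P - sum B F\<bar> < e / 4"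
      by (rule split(1), use elim(2) in blast) (rule split(1), use B in blast)
    then show ?case using elim(1) unfolding dist_real_def by linarith
  qed
qed

text \<open>\<open>G\<close> consists of the neighbourhoods of a cluster point intersected with the
  tails of the sequence. The last property lets anything true of almost all \<open>A i\<close> be
  used along \<open>G\<close>.\<close>

lemma pointwise_cluster_filter:
  fixes A :: "nat \<Rightarrow> real \<Rightarrow> real"
  assumes "\<And>i x. 0 \<le> A i x \<and> A i x \<le> B"
  obtains G f where "G \<noteq> bot" "\<And>x. ((\<lambda>h. h x) \<longlongrightarrow> f x) G" "\<And>x. 0 \<le> f x"
    "\<And>Q. eventually (\<lambda>i. Q (A i)) sequentially \<Longrightarrow> eventually Q G"
proof -
  let ?U = "PiE UNIV (\<lambda>_. {0..B}) :: (real \<Rightarrow> real) set"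
  have "compactin (product_topology (\<lambda>_. euclidean) UNIV) ?U"
    by (subst compactin_PiE) auto
  then have "compact ?U" by (simp add: euclidean_product_topology)
  moreover have "filtermap A sequentially \<noteq> bot" by (simp add: filtermap_bot_iff)
  moreover have "eventually (\<lambda>h. h \<in> ?U) (filtermap A sequentially)"
    using assms by (auto simp: eventually_filtermap PiE_def extensional_def Pi_def)
  ultimately obtain f where f: "f \<in> ?U" "inf (nhds f) (filtermap A sequentially) \<noteq> bot"
    unfolding compact_filter by blast
  show thesis
  proof
    show "inf (nhds f) (filtermap A sequentially) \<noteq> bot" by (rule f(2))
    show "0 \<le> f x" for x using f(1) by (auto simp: PiE_def Pi_def)
    show "((\<lambda>h. h x) \<longlongrightarrow> f x) (inf (nhds f) (filtermap A sequentially))" for x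
    proof (rule tendsto_mono[OF inf_le1])
      show "((\<lambda>h. h x) \<longlongrightarrow> f x) (nhds f)"
      proof (rule topological_tendstoI)
        fix S :: "real set" assume "open S" "f x \<in> S"
        moreover have "open ((\<lambda>h::real \<Rightarrow> real. h x) -` S)"
          by (rule open_vimage[OF \<open>open S\<close> continuous_on_product_coordinates])
        ultimately show "\<forall>\<^sub>F h in nhds f. h x \<in> S"
          unfolding eventually_nhds by (intro exI[of _ "(\<lambda>h. h x) -` S"]) auto
      qed
    qed
    show "eventually Q (inf (nhds f) (filtermap A sequentially))"
      if "eventually (\<lambda>i. Q (A i)) sequentially" for Q
      by (rule filter_leD[OF inf_le2]) (use that in \<open>simp add: eventually_filtermap\<close>)
  qed
qed

text \<open>On each cell the integral exceeds \<open>\<delta> * \<phi> (y i)\<close> by at most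
  \<open>\<delta>\<close> times the variation there. The error depends on \<open>\<phi>\<close> only
  through \<open>V\<close>, so the bound passes to pointwise limits.\<close>

lemma variation_le_Riemann_sum:
  fixes \<phi> :: "real \<Rightarrow> real"
  assumes "variation_le \<phi> a (a + real k * \<delta>) V" "0 < \<delta>"
    and "\<And>i. i < k \<Longrightarrow> y i \<in> {a + real i * \<delta>..a + real (Suc i) * \<delta>}"
  shows "integral {a..a + real k * \<delta>} \<phi> \<le> \<delta> * (\<Sum>i<k. \<phi> (y i)) + \<delta> * V"
  using assms(1,3)
proof (induction k arbitrary: V)
  case 0
  then show ?case using variation_le_nonneg[of \<phi> a a V] assms(2) by simp
next
  case (Suc k)
  let ?m = "a + real k * \<delta>" and ?e = "a + real (Suc k) * \<delta>"
  have le: "a \<le> ?m" "?m < ?e" using assms(2) by (auto simp: algebra_simps)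
  obtain V1 V2 where V: "variation_le \<phi> a ?m V1" "variation_le \<phi> ?m ?e V2" "V1 + V2 = V"
    using variation_le_split[OF le(1) less_imp_le[OF le(2)] Suc(2)] .
  have int: "\<phi> integrable_on {a..?e}"
    using variation_le_integrable_on[OF Suc(2)] le by (intro integrable_on_lebesgue_on) auto
  have "integral {a..?m} \<phi> \<le> \<delta> * (\<Sum>i<k. \<phi> (y i)) + \<delta> * V1"
    by (rule Suc(1)[OF V(1)]) (use Suc(3) in auto)
  moreover have "integral {?m..?e} \<phi> \<le> integral {?m..?e} (\<lambda>_. \<phi> (y k) + V2)"
  proof (rule integral_le)
    show "\<phi> integrable_on {?m..?e}"
      by (rule integrable_on_subinterval[OF int]) (use le in auto)
    show "\<phi> x \<le> \<phi> (y k) + V2" if "x \<in> {?m..?e}" for x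
      using variation_le_bound[OF V(2) Suc(3)[of k] that] by auto
  qed auto
  moreover have "integral {?m..?e} (\<lambda>_. \<phi> (y k) + V2) = \<delta> * (\<phi> (y k) + V2)"
    using le by (simp add: algebra_simps)
  moreover have "integral {a..?e} \<phi> = integral {a..?m} \<phi> + integral {?m..?e} \<phi>"
    using Henstock_Kurzweil_Integration.integral_combine[OF le(1) less_imp_le[OF le(2)] int] by simp
  ultimately show ?case
    unfolding V(3)[symmetric] by (simp add: algebra_simps)
qed

lemma AE_lebesgue_interval_witness:
  fixes u v :: real
  assumes "AE x in lebesgue_on {a..b}. Q x" "a \<le> u" "u < v" "v \<le> b"
  shows "\<exists>x\<in>{u..v}. Q x"
proof (rule ccontr)
  assume "\<not> ?thesis"
  then have "{u..v} \<subseteq> {x \<in> {a..b}. \<not> Q x}" using assms(2-4) by auto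
  moreover have "negligible {x \<in> {a..b}. \<not> Q x}"
    using assms(1) by (simp add: AE_lebesgue_on_iff_negligible)
  ultimately have "negligible {u..v}" by (rule negligible_subset[rotated])
  then show False using assms(3) by (simp add: negligible_iff_null_sets null_sets_def)
qed

context proper_iwasawa_cf_map
begin

text \<open>Outside the domain of an inverse branch the clamped value is an endpoint, where
  \<open>weight\<close> is 0; this replaces the indicator of the domain.\<close>

lemma transfer_term_of_real:
  assumes "J \<in> P" "x \<notin> branch_ends"
  shows "transfer_term (\<lambda>y. complex_of_real (\<phi> y)) J x =
    complex_of_real (weight (inverse_clamp J x) * \<phi> (inverse_clamp J x))"
proof (cases "x \<in> branch \<iota> c J ` J")
  case True
  then obtain y where y: "y \<in> interior J" "x = branch \<iota> c J y"
    using branch_image_cases[OF assms(1) _ assms(2)] by blast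
  moreover have "inverse_clamp J x = y"
    using inverse_clamp_branch[OF assms(1)] y interior_subset by blast
  ultimately show ?thesis
    by (simp add: transfer_term_branch[OF assms(1)] weight_interior[OF assms(1)])
next
  case False
  have "inverse_clamp J x \<notin> interior J"
    using branch_inverse_clamp[OF assms(1)] inverse_clamp_in[OF assms(1)] False by (metis imageI)
  then have "weight (inverse_clamp J x) = 0"
    using piece_cases[OF assms(1) inverse_clamp_in[OF assms(1), of x]] weight_endpoint[OF assms(1)] by auto
  then show ?thesis by (simp add: transfer_term_outside[OF False])
qed

lemma AE_not_branch_ends: "AE x in M. x \<notin> branch_ends"
  by (rule AE_M_countable[OF countable_branch_ends])

lemma pointwise_transfer_nonneg:
  "(\<And>y. 0 \<le> \<phi> y) \<Longrightarrow> 0 \<le> pointwise_transfer \<phi> x"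
  unfolding pointwise_transfer_def by (intro infsum_nonneg mult_nonneg_nonneg weight_nonneg)

lemma H_of_real:
  assumes "\<And>y. y \<in> {a..b} \<Longrightarrow> \<bar>\<phi> y\<bar> \<le> B"
  shows "AE x in M. H (\<lambda>y. complex_of_real (\<phi> y)) x = complex_of_real (pointwise_transfer \<phi> x)"
  using AE_not_branch_ends
proof eventually_elim
  case (elim x)
  have "((\<lambda>J. complex_of_real (weight (inverse_clamp J x) * \<phi> (inverse_clamp J x))) has_sum
      complex_of_real (pointwise_transfer \<phi> x)) P"
    unfolding pointwise_transfer_def
    by (rule has_sum_bounded_linear[OF bounded_linear_of_real]) (rule has_sum_infsum[OF transfer_terms_summable[OF assms]])
  then show ?case
    unfolding H_eq using transfer_term_of_real[OF _ elim] by (intro infsumI) (simp cong: has_sum_cong)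
qed

lemma variation_le_abs_bound:
  fixes \<phi> :: "real \<Rightarrow> real"
  assumes "variation_le \<phi> a b V"
  shows "x \<in> {a..b} \<Longrightarrow> \<bar>\<phi> x\<bar> \<le> \<bar>\<phi> a\<bar> + V"
  using variation_le_bound[OF assms, of a x] nondegenerate by auto

lemma pointwise_transfer_variation_exists:
  assumes "variation_le \<phi> a b V"
  shows "\<exists>V'. variation_le (pointwise_transfer \<phi>) a b V'"
proof -
  obtain V1 where "variation_le (cocycle 1) a b V1" using cocycle_variation by blast
  moreover have "cocycle 1 = weight" by (simp add: fun_eq_iff)
  ultimately have w: "variation_le weight a b V1" by simp
  have "\<bar>\<phi> x\<bar> \<le> \<bar>\<phi> a\<bar> + V" if "x \<in> {a..b}" for x
    using variation_le_bound[OF assms _ that, of a] nondegenerate by auto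
  moreover have "\<bar>weight x\<bar> \<le> 1" for x
    using cocycle_le_1[of 1 x] weight_nonneg[of x] by simp
  ultimately have "variation_le (\<lambda>y. weight y * \<phi> y) a b (1 * V + (\<bar>\<phi> a\<bar> + V) * V1)"
    using nondegenerate by (intro variation_le_mult[OF assms w]) auto
  then show ?thesis using pointwise_transfer_variation by blast
qed

text \<open>For nonnegative functions the operator agrees almost everywhere with
  \<open>abs_transfer\<close>, which preserves mass.\<close>

lemma integral_pointwise_transfer:
  assumes "\<And>y. 0 \<le> \<phi> y" "variation_le \<phi> a b V"
  shows "integral\<^sup>L M (pointwise_transfer \<phi>) = integral\<^sup>L M \<phi>"
proof -
  have le: "a \<le> b" using nondegenerate by simp
  have i: "integrable M \<phi>" by (rule variation_le_integrable_on[OF assms(2) le])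
  then have ic: "integrable M (\<lambda>y. complex_of_real (\<phi> y))" by simp
  have i': "integrable M (pointwise_transfer \<phi>)"
    using pointwise_transfer_variation_exists[OF assms(2)] variation_le_integrable_on[OF _ le] by blast
  have eq: "AE x in M. abs_transfer (\<lambda>y. complex_of_real (\<phi> y)) x = ennreal (pointwise_transfer \<phi> x)"
    using AE_not_branch_ends AE_abs_transfer_finite[OF ic]
  proof eventually_elim
    case (elim x)
    then show ?case
      unfolding abs_transfer_eq[OF elim(2)] pointwise_transfer_def
      by (intro arg_cong[where f = ennreal] infsum_cong)
        (simp add: transfer_term_of_real norm_mult abs_mult weight_nonneg assms(1))
  qed
  have "ennreal (integral\<^sup>L M (pointwise_transfer \<phi>)) = (\<integral>\<^sup>+x. pointwise_transfer \<phi> x \<partial>M)"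
    by (rule nn_integral_eq_integral[symmetric]) (use i' pointwise_transfer_nonneg assms(1) in auto)
  also have "\<dots> = (\<integral>\<^sup>+x. abs_transfer (\<lambda>y. complex_of_real (\<phi> y)) x \<partial>M)"
    by (rule nn_integral_cong_AE) (use eq in auto)
  also have "\<dots> = (\<integral>\<^sup>+x. \<phi> x \<partial>M)"
    unfolding nn_integral_abs_transfer[OF ic] using assms(1) by simp
  also have "\<dots> = ennreal (integral\<^sup>L M \<phi>)"
    by (rule nn_integral_eq_integral) (use i assms(1) in auto)
  finally show ?thesis
    using assms(1) pointwise_transfer_nonneg[of \<phi>] by (simp add: integral_nonneg_AE)
qed

lemma pointwise_transfer_linear:
  assumes "\<And>y. y \<in> {a..b} \<Longrightarrow> \<bar>\<phi> y\<bar> \<le> B" "\<And>y. y \<in> {a..b} \<Longrightarrow> \<bar>\<psi> y\<bar> \<le> B'"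
  shows "pointwise_transfer (\<lambda>y. k * \<phi> y + l * \<psi> y) x = k * pointwise_transfer \<phi> x + l * pointwise_transfer \<psi> x"
proof -
  have "((\<lambda>J. k * (weight (inverse_clamp J x) * \<phi> (inverse_clamp J x)) +
       l * (weight (inverse_clamp J x) * \<psi> (inverse_clamp J x))) has_sum
     (k * pointwise_transfer \<phi> x + l * pointwise_transfer \<psi> x)) P"
    unfolding pointwise_transfer_def
    by (intro has_sum_add has_sum_cmult_right has_sum_infsum transfer_terms_summable[OF assms(1)]
        transfer_terms_summable[OF assms(2)])
  then show ?thesis
    unfolding pointwise_transfer_def[of "\<lambda>y. k * \<phi> y + l * \<psi> y"]
    by (intro infsumI) (simp add: algebra_simps)
qed

section \<open>Iterates of the uniform density and their Cesaro means\<close>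

definition iterate :: "nat \<Rightarrow> real \<Rightarrow> real" where
  "iterate k = (pointwise_transfer ^^ k) (\<lambda>_. 1 / (b - a))"

lemma iterate_Suc: "iterate (Suc k) = pointwise_transfer (iterate k)"
  by (simp add: iterate_def)

lemma iterate_add: "iterate (n + k) = (pointwise_transfer ^^ n) (iterate k)"
  by (simp add: iterate_def funpow_add)

lemma iterate_nonneg: "0 \<le> iterate k x"
proof (induction k arbitrary: x)
  case 0
  then show ?case using nondegenerate by (simp add: iterate_def)
qed (simp add: iterate_Suc pointwise_transfer_nonneg)

lemma iterate_variation_exists: "\<exists>V. variation_le (iterate k) a b V"
proof (induction k)
  case 0
  then show ?case using variation_le_const[of "1 / (b - a)" a b] by (auto simp: iterate_def)
qed (use pointwise_transfer_variation_exists in \<open>auto simp: iterate_Suc\<close>)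

lemma integral_iterate: "integral\<^sup>L M (iterate k) = 1"
proof (induction k)
  case 0
  then show ?case using nondegenerate by (simp add: iterate_def measure_restrict_space)
next
  case (Suc k)
  then show ?case
    using iterate_variation_exists[of k] integral_pointwise_transfer[of "iterate k"] iterate_nonneg
    by (auto simp: iterate_Suc)
qed

text \<open>Once \<open>5 * \<epsilon> \<le> 1 / 2\<close>, any bound \<open>V \<ge> 2 * K\<close>
  is reproduced by \<open>n\<close> steps:
  \<open>5 * \<epsilon> * V + K \<le> V / 2 + V / 2\<close>.\<close>

lemma iterate_uniform_variation: "\<exists>V. \<forall>k. variation_le (iterate k) a b V"
proof -
  define \<gamma> where "\<gamma> = max \<bar>a\<bar> \<bar>b\<bar>"
  have \<gamma>: "0 < \<gamma>" "\<gamma> < 1" using gamma_less_1 nondegenerate by (auto simp: \<gamma>_def)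
  \<comment> \<open>The value \<open>1 / 10\<close> makes the factor \<open>5 * \<epsilon>\<close>
    less than one half.\<close>
  obtain n where n: "(\<gamma>\<^sup>2) ^ n < 1 / 10"
    using real_arch_pow_inv[of "1 / 10" "\<gamma>\<^sup>2"] \<gamma> by (auto simp: power_less_one_iff)
  define \<epsilon> where "\<epsilon> = \<gamma> ^ (2 * n)"
  have \<epsilon>: "0 < \<epsilon>" "\<epsilon> < 1 / 10" using \<gamma> n by (auto simp: \<epsilon>_def power_mult)
  have n0: "0 < n" using n by (cases n) auto
  obtain VG where VG: "variation_le (cocycle n) a b VG" using cocycle_variation by blast
  have "\<exists>K\<ge>0. \<forall>\<phi> V. (\<forall>x\<in>{a..b}. 0 \<le> \<phi> x) \<longrightarrow> variation_le \<phi> a b V \<longrightarrow>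
    integral\<^sup>L M \<phi> \<le> 1 \<longrightarrow> variation_le (\<lambda>x. cocycle n x * \<phi> x) a b (5 * \<epsilon> * V + K)"
    by (rule variation_le_weighted[OF _ VG \<epsilon>(1)])
      (use cocycle_bounds[of n] nondegenerate in \<open>auto simp: \<epsilon>_def \<gamma>_def\<close>)
  then obtain K where K: "0 \<le> K" "\<forall>\<phi> V. (\<forall>x\<in>{a..b}. 0 \<le> \<phi> x) \<longrightarrow> variation_le \<phi> a b V \<longrightarrow>
    integral\<^sup>L M \<phi> \<le> 1 \<longrightarrow> variation_le (\<lambda>x. cocycle n x * \<phi> x) a b (5 * \<epsilon> * V + K)"
    by (elim exE conjE)
  obtain U where U: "\<And>k. variation_le (iterate k) a b (U k)"
    using iterate_variation_exists by metis
  have U0: "0 \<le> U k" for k using variation_le_nonneg[OF U] nondegenerate by simp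
  \<comment> \<open>The induction descends by \<open>n\<close>, so the bound must also cover the
    first \<open>n\<close> iterates; the sum does this.\<close>
  define V where "V = 2 * K + (\<Sum>k<n. U k)"
  have "0 \<le> (\<Sum>k<n. U k)" by (intro sum_nonneg U0)
  then have V: "2 * K \<le> V" "0 \<le> V" using K(1) by (auto simp: V_def)
  have "variation_le (iterate k) a b V" for k
  proof (induction k rule: less_induct)
    case (less k)
    show ?case
    proof (cases "k < n")
      case True
      have "U k \<le> (\<Sum>k<n. U k)"
        by (rule member_le_sum) (use True U0 in auto)
      then show ?thesis using K(1) by (intro variation_le_mono[OF U]) (simp add: V_def)
    next
      case False
      then have k: "k = n + (k - n)" by simp
      have "variation_le (iterate (k - n)) a b V" using less[of "k - n"] False n0 by simp
      then have "variation_le (\<lambda>x. cocycle n x * iterate (k - n) x) a b (5 * \<epsilon> * V + K)"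
        using K(2) by (simp add: iterate_nonneg integral_iterate)
      then have "variation_le (iterate (n + (k - n))) a b (5 * \<epsilon> * V + K)"
        unfolding iterate_add by (rule iterated_transfer_variation)
      moreover have "5 * \<epsilon> * V + K \<le> V"
      proof -
        have "5 * \<epsilon> * V \<le> 1 / 2 * V" using \<epsilon> V(2) by (intro mult_right_mono) auto
        then show ?thesis using V(1) by simp
      qed
      ultimately show ?thesis using k variation_le_mono by metis
    qed
  qed
  then show ?thesis by blast
qed

lemma exists_pointwise_invariant:
  obtains f V where "\<And>x. 0 \<le> f x" "variation_le f a b V" "\<And>x. x \<in> {a..b} \<Longrightarrow> pointwise_transfer f x = f x"
    "\<not> (AE x in M. f x = 0)"
proof -
  obtain V where V: "\<And>k. variation_le (iterate k) a b V" using iterate_uniform_variation by blast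
  have ab: "a \<le> b" using nondegenerate by simp
  have V0: "0 \<le> V" by (rule variation_le_nonneg[OF V ab])
  define B where "B = 1 / (b - a) + V"
  have B0: "0 \<le> B" using V0 nondegenerate by (simp add: B_def)
  have B: "\<bar>iterate k x\<bar> \<le> B" if "x \<in> {a..b}" for k x
    using variation_le_sup_bound[OF V nondegenerate _ that, of k 1] iterate_nonneg[of k x]
    by (simp add: integral_iterate B_def)
  define S where "S m x = (\<Sum>k<m. iterate k x)" for m x
  have S: "\<bar>S m x\<bar> \<le> real m * B" if "x \<in> {a..b}" for m x
  proof -
    have "\<bar>S m x\<bar> \<le> (\<Sum>k<m. \<bar>iterate k x\<bar>)" unfolding S_def by (rule sum_abs)
    also have "\<dots> \<le> (\<Sum>k<m. B)" by (intro sum_mono B that)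
    finally show ?thesis by simp
  qed
  \<comment> \<open>The operator shifts the index of each summand by one, so all but the outermost
    terms cancel.\<close>
  have ptS: "pointwise_transfer (S m) x = S m x + iterate m x - iterate 0 x" for m x
  proof (induction m)
    case 0
    then show ?case by (simp add: S_def[abs_def] pointwise_transfer_def)
  next
    case (Suc m)
    have "pointwise_transfer (\<lambda>y. 1 * S m y + 1 * iterate m y) x =
      1 * pointwise_transfer (S m) x + 1 * pointwise_transfer (iterate m) x"
      by (rule pointwise_transfer_linear[OF S B])
    then show ?case
      using Suc by (simp add: S_def[abs_def] iterate_Suc)
  qed
  \<comment> \<open>Setting the means to 0 outside the interval puts them into the cube
    \<open>{0..B}\<close> at every real point; \<open>Suc i\<close> keeps the divisor
    positive.\<close>
  define A where "A i x = (if x \<in> {a..b} then S (Suc i) x / real (Suc i) else 0)" for i x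
  have S_nonneg: "0 \<le> S m x" for m x unfolding S_def by (intro sum_nonneg iterate_nonneg)
  have A: "0 \<le> A i x \<and> A i x \<le> B" for i x
    using S[of x "Suc i"] B0 S_nonneg[of "Suc i" x]
    by (simp add: A_def pos_divide_le_eq mult.commute)
  have Aab: "x \<in> {a..b} \<Longrightarrow> A i x = 1 / real (Suc i) * S (Suc i) x" for i x
    by (simp add: A_def)
  have varA: "variation_le (A i) a b V" for i
  proof -
    have "variation_le (\<lambda>x. \<Sum>k<Suc i. iterate k x) a b (\<Sum>k<Suc i. V)"
      by (rule variation_le_sum) (rule V)
    then have "variation_le (\<lambda>x. 1 / real (Suc i) * S (Suc i) x) a b (norm (1 / real (Suc i)) * (\<Sum>k<Suc i. V))"
      unfolding S_def by (rule variation_le_cmult)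
    then have "variation_le (\<lambda>x. 1 / real (Suc i) * S (Suc i) x) a b V" by simp
    then show ?thesis by (rule variation_le_cong) (simp add: Aab)
  qed
  have intA: "integral\<^sup>L M (A i) = 1" for i
  proof -
    have "integral\<^sup>L M (A i) = integral\<^sup>L M (\<lambda>x. 1 / real (Suc i) * S (Suc i) x)"
      by (rule Bochner_Integration.integral_cong) (simp_all add: Aab)
    also have "\<dots> = 1 / real (Suc i) * (\<Sum>k<Suc i. integral\<^sup>L M (iterate k))"
      unfolding S_def using variation_le_integrable_on[OF V ab] by simp
    finally show ?thesis by (simp add: integral_iterate)
  qed
  have ptA: "\<bar>pointwise_transfer (A i) x - A i x\<bar> \<le> 2 * B / real (Suc i)" if x: "x \<in> {a..b}" for i x
  proof -
    \<comment> \<open>The summand \<open>0 * S 0 y\<close> only fills the second slot of the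
      linearity rule for two functions.\<close>
    have "pointwise_transfer (A i) x = pointwise_transfer (\<lambda>y. 1 / real (Suc i) * S (Suc i) y + 0 * S 0 y) x"
      unfolding pointwise_transfer_def using inverse_clamp_in piece_subset
      by (intro infsum_cong) (simp add: Aab subset_iff)
    also have "\<dots> = 1 / real (Suc i) * pointwise_transfer (S (Suc i)) x + 0 * pointwise_transfer (S 0) x"
      by (rule pointwise_transfer_linear[OF S S])
    finally have "pointwise_transfer (A i) x - A i x = (iterate (Suc i) x - iterate 0 x) / real (Suc i)"
      by (simp add: ptS Aab[OF x] field_simps)
    moreover have "\<bar>iterate (Suc i) x - iterate 0 x\<bar> \<le> 2 * B"
      using B[OF x, of "Suc i"] B[OF x, of 0] by linarith
    ultimately show ?thesis by (simp add: divide_right_mono)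
  qed
  obtain G f where G: "G \<noteq> bot" "\<And>x. ((\<lambda>h. h x) \<longlongrightarrow> f x) G" "\<And>x. 0 \<le> f x"
    "\<And>Q. eventually (\<lambda>i. Q (A i)) sequentially \<Longrightarrow> eventually Q G"
    using pointwise_cluster_filter[of A B] A by metis
  \<comment> \<open>Each increment sum involves finitely many points, so its bound passes to the
    pointwise limit.\<close>
  have var_f: "variation a b (\<lambda>x. complex_of_real (f x)) \<le> ennreal V"
    unfolding variation_def
  proof (rule SUP_least, clarsimp, rule ennreal_leI)
    fix t :: "nat \<Rightarrow> real" and n assume t: "mono t" "range t \<subseteq> {a..b}"
    have "(\<Sum>i<n. \<bar>f (t (Suc i)) - f (t i)\<bar>) \<le> V"
    proof (rule tendsto_upperbound[OF _ _ G(1)])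
      show "((\<lambda>h. \<Sum>i<n. \<bar>h (t (Suc i)) - h (t i)\<bar>) \<longlongrightarrow> (\<Sum>i<n. \<bar>f (t (Suc i)) - f (t i)\<bar>)) G"
        by (intro tendsto_intros G(2))
      show "\<forall>\<^sub>F h in G. (\<Sum>i<n. \<bar>h (t (Suc i)) - h (t i)\<bar>) \<le> V"
        using variation_le_sum_le[OF varA ab t] by (intro G(4)) simp
    qed
    then show "(\<Sum>i<n. norm (complex_of_real (f (t (Suc i))) - complex_of_real (f (t i)))) \<le> V"
      by (simp flip: of_real_diff)
  qed
  then have "variation a b (\<lambda>x. complex_of_real (f x)) < \<infinity>"
    by (rule le_less_trans) simp
  then obtain V' where "variation_le (\<lambda>x. complex_of_real (f x)) a b V'"
    using finite_variation_imp_variation_le ab by blast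
  then have f_var: "variation_le f a b V'" by (simp add: variation_le_of_real)
  have inv: "pointwise_transfer f x = f x" if x: "x \<in> {a..b}" for x
  proof -
    have "((\<lambda>h. \<Sum>\<^sub>\<infinity>J\<in>P. weight (inverse_clamp J x) * h (inverse_clamp J x)) \<longlongrightarrow>
        (\<Sum>\<^sub>\<infinity>J\<in>P. weight (inverse_clamp J x) * f (inverse_clamp J x))) G"
    proof (rule tendsto_infsum_dominated[OF G(1) _ _ summable_lo_hi_mult[of B]])
      show "((\<lambda>h. weight (inverse_clamp J x) * h (inverse_clamp J x)) \<longlongrightarrow>
          weight (inverse_clamp J x) * f (inverse_clamp J x)) G" for J
        by (intro tendsto_intros G(2))
      show "\<forall>\<^sub>F h in G. \<forall>J\<in>P. \<bar>weight (inverse_clamp J x) * h (inverse_clamp J x)\<bar> \<le> 3 * (lo J * hi J) * B"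
        by (intro G(4) always_eventually allI ballI weight_transfer_term_bound) (use A in auto)
    qed
    then have l1: "((\<lambda>h. pointwise_transfer h x) \<longlongrightarrow> pointwise_transfer f x) G"
      by (simp add: pointwise_transfer_def)
    have "((\<lambda>h. pointwise_transfer h x - h x) \<longlongrightarrow> 0) G"
    proof (rule tendstoI)
      fix e :: real assume e: "e > 0"
      have "(\<lambda>i. 2 * B / real (Suc i)) \<longlonglongrightarrow> 0" by real_asymp
      then have "\<forall>\<^sub>F i in sequentially. 2 * B / real (Suc i) < e"
        using e by (rule order_tendstoD)
      then have "\<forall>\<^sub>F i in sequentially. dist (pointwise_transfer (A i) x - A i x) 0 < e"
        by eventually_elim (use ptA[OF x] in \<open>fastforce intro: le_less_trans\<close>)
      then show "\<forall>\<^sub>F h in G. dist (pointwise_transfer h x - h x) 0 < e" by (rule G(4))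
    qed
    moreover have "((\<lambda>h. pointwise_transfer h x - h x) \<longlongrightarrow> pointwise_transfer f x - f x) G"
      by (intro tendsto_diff l1 G(2))
    ultimately have "pointwise_transfer f x - f x = 0"
      using tendsto_unique[OF G(1)] by blast
    then show ?thesis by simp
  qed
  have nz: "\<not> (AE x in M. f x = 0)"
  proof
    assume AE0: "AE x in M. f x = 0"
    \<comment> \<open>With this many cells the error \<open>\<delta> * V\<close> of the Riemann sum
      is below the integral 1 of every mean.\<close>
    obtain k :: nat where k: "(b - a) * V < real k" using reals_Archimedean2 by blast
    have k0: "0 < k" using k V0 nondegenerate by (cases k) (auto simp: mult_less_0_iff)
    define \<delta> where "\<delta> = (b - a) / real k"
    have \<delta>: "0 < \<delta>" "a + real k * \<delta> = b" "\<delta> * V < 1"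
      using k k0 nondegenerate by (auto simp: \<delta>_def divide_less_eq)
    \<comment> \<open>If \<open>f\<close> vanished almost everywhere, every cell would contain a
      zero of \<open>f\<close>. The Riemann sum at these zeros is at least
      \<open>1 - \<delta> * V\<close> for each mean, but 0 for the limit.\<close>
    have "\<exists>y. i < k \<longrightarrow> y \<in> {a + real i * \<delta>..a + real (Suc i) * \<delta>} \<and> f y = 0" for i
    proof (cases "i < k")
      case True
      have "real (Suc i) * \<delta> \<le> real k * \<delta>" using True \<delta>(1) by (intro mult_right_mono) auto
      then show ?thesis
        using AE_lebesgue_interval_witness[OF AE0, of "a + real i * \<delta>" "a + real (Suc i) * \<delta>"] \<delta>
        by (auto simp: algebra_simps)
    qed auto
    then obtain y where y: "\<And>i. i < k \<Longrightarrow> y i \<in> {a + real i * \<delta>..a + real (Suc i) * \<delta>}"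
      "\<And>i. i < k \<Longrightarrow> f (y i) = 0" by metis
    have "1 \<le> \<delta> * (\<Sum>i<k. A j (y i)) + \<delta> * V" for j
    proof -
      have "integral {a..b} (A j) = 1"
        using intA[of j] lebesgue_integral_eq_integral[OF variation_le_integrable_on[OF varA ab]] by simp
      then show ?thesis
        using variation_le_Riemann_sum[of "A j" a k \<delta> V y] varA[of j] \<delta> y(1) by simp
    qed
    then have "\<forall>\<^sub>F h in G. 1 \<le> \<delta> * (\<Sum>i<k. h (y i)) + \<delta> * V"
      by (intro G(4)) simp
    moreover have "((\<lambda>h. \<delta> * (\<Sum>i<k. h (y i)) + \<delta> * V) \<longlongrightarrow> \<delta> * (\<Sum>i<k. f (y i)) + \<delta> * V) G"
      by (intro tendsto_intros G(2))
    ultimately have "1 \<le> \<delta> * (\<Sum>i<k. f (y i)) + \<delta> * V"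
      by (intro tendsto_lowerbound[OF _ _ G(1)])
    then show False using \<delta> y(2) by simp
  qed
  show thesis by (rule that[OF G(3) f_var inv nz])
qed

lemma one_is_BV_eigenvalue: "BV_eigenvalue a b H 1"
proof -
  obtain f V where f: "\<And>x. 0 \<le> f x" "variation_le f a b V" "\<And>x. x \<in> {a..b} \<Longrightarrow> pointwise_transfer f x = f x"
    "\<not> (AE x in M. f x = 0)" by (rule exists_pointwise_invariant) (rule that)
  have ab: "a \<le> b" using nondegenerate by simp
  let ?f = "\<lambda>x. complex_of_real (f x)"
  have "variation a b ?f \<le> ennreal V"
    by (rule variation_le_imp_variation[OF _ ab]) (simp add: variation_le_of_real f(2))
  then have "variation a b ?f < \<infinity>" by (rule le_less_trans) simp
  moreover have "integrable M ?f" using variation_le_integrable_on[OF f(2) ab] by simp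
  ultimately have "?f \<in> BV a b" unfolding BV_def by (auto intro!: exI[of _ ?f])
  moreover have "AE x in M. H ?f x = 1 * ?f x"
  proof -
    have "AE x in M. x \<in> {a..b}" by (rule AE_I2) simp
    moreover have "AE x in M. H ?f x = complex_of_real (pointwise_transfer f x)"
      by (rule H_of_real) (rule variation_le_abs_bound[OF f(2)])
    ultimately show ?thesis
      by eventually_elim (use f(3) in simp)
  qed
  moreover have "\<not> (AE x in M. ?f x = 0)" using f(4) by simp
  ultimately show ?thesis unfolding BV_eigenvalue_def by (intro bexI[of _ ?f] conjI)
qed

end

section \<open>Eigenfunctions for eigenvalues of modulus one\<close>

context iwasawa_cf_map
begin

text \<open>The differentiable inverse branches carry null sets to null sets, and there are
  countably many. This pulls a statement valid for almost every \<open>x = T y\<close> back to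
  almost every \<open>y\<close>.\<close>

lemma negligible_T_preimage:
  assumes "negligible N"
  shows "negligible {y \<in> {a..b}. T y \<in> N}"
proof -
  let ?Q = "\<lambda>J. {y \<in> interior J. branch \<iota> c J y \<in> N}"
  have "negligible (?Q J)" if J: "J \<in> P" for J
  proof -
    have "negligible (inverse_branch \<iota> c J ` (N \<inter> branch \<iota> c J ` interior J))"
    proof (rule negligible_differentiable_image_negligible)
      show "negligible (N \<inter> branch \<iota> c J ` interior J)" by (rule negligible_subset[OF assms]) auto
      show "inverse_branch \<iota> c J differentiable_on (N \<inter> branch \<iota> c J ` interior J)"
        using inverse_branch_derivative[OF J]
        by (intro differentiable_at_imp_differentiable_on) (auto simp: real_differentiable_def)
    qed simp
    moreover have "?Q J \<subseteq> inverse_branch \<iota> c J ` (N \<inter> branch \<iota> c J ` interior J)"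
    proof
      fix y assume y: "y \<in> ?Q J"
      then have "inverse_branch \<iota> c J (branch \<iota> c J y) = y"
        using inverse_branch_branch[OF J] interior_subset by blast
      then show "y \<in> inverse_branch \<iota> c J ` (N \<inter> branch \<iota> c J ` interior J)"
        using y by (intro image_eqI[of _ _ "branch \<iota> c J y"]) auto
    qed
    ultimately show ?thesis by (rule negligible_subset)
  qed
  then have "negligible (\<Union>J\<in>P. ?Q J)"
    using countable_partition by (intro negligible_countable_Union) auto
  moreover have "negligible ({a..b} - (\<Union>J\<in>P. interior J))"
    by (rule countable_imp_negligible[OF countable_gaps])
  ultimately have "negligible ((\<Union>J\<in>P. ?Q J) \<union> ({a..b} - (\<Union>J\<in>P. interior J)))"
    by (rule negligible_Un)
  then show ?thesis
    by (rule negligible_subset) (auto simp: T_on_piece)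
qed

text \<open>The forward counterpart, used to discard an exceptional set from the positive-measure
  intersection in Condition star.\<close>

lemma negligible_T_image:
  assumes "negligible N" "N \<subseteq> {a..b}"
  shows "negligible (T ` N)"
proof -
  have "negligible (branch \<iota> c J ` (N \<inter> interior J))" if J: "J \<in> P" for J
  proof -
    have neg: "negligible (N \<inter> interior J)" by (rule negligible_subset[OF assms(1)]) auto
    have "(\<lambda>y. orient J / y + c J) differentiable_on (N \<inter> interior J)"
    proof (intro differentiable_at_imp_differentiable_on)
      fix y assume "y \<in> N \<inter> interior J"
      then have "y \<noteq> 0" using zero_notin_piece[OF J] interior_subset by blast
      then have "((\<lambda>y. orient J / y + c J) has_field_derivative - orient J / y\<^sup>2) (at y)"
        by (auto intro!: derivative_eq_intros simp: power2_eq_square)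
      then show "(\<lambda>y. orient J / y + c J) differentiable at y"
        by (auto simp: real_differentiable_def)
    qed
    then have "negligible ((\<lambda>y. orient J / y + c J) ` (N \<inter> interior J))"
      by (intro negligible_differentiable_image_negligible neg) simp_all
    moreover have "branch \<iota> c J ` (N \<inter> interior J) = (\<lambda>y. orient J / y + c J) ` (N \<inter> interior J)"
      using orient(2)[OF J] interior_subset by (intro image_cong) auto
    ultimately show ?thesis by simp
  qed
  then have "negligible (\<Union>J\<in>P. branch \<iota> c J ` (N \<inter> interior J))"
    using countable_partition by (intro negligible_countable_Union) auto
  moreover have "negligible (T ` ({a..b} - (\<Union>J\<in>P. interior J)))"
    by (rule countable_imp_negligible) (intro countable_image countable_gaps)
  ultimately have "negligible ((\<Union>J\<in>P. branch \<iota> c J ` (N \<inter> interior J)) \<union> T ` ({a..b} - (\<Union>J\<in>P. interior J)))"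
    by (rule negligible_Un)
  moreover have "T ` N \<subseteq> (\<Union>J\<in>P. branch \<iota> c J ` (N \<inter> interior J)) \<union> T ` ({a..b} - (\<Union>J\<in>P. interior J))"
  proof
    fix x assume "x \<in> T ` N"
    then obtain y where y: "y \<in> N" "x = T y" by blast
    show "x \<in> (\<Union>J\<in>P. branch \<iota> c J ` (N \<inter> interior J)) \<union> T ` ({a..b} - (\<Union>J\<in>P. interior J))"
    proof (cases "y \<in> (\<Union>J\<in>P. interior J)")
      case True
      then obtain J where J: "J \<in> P" "y \<in> interior J" by blast
      then have "x \<in> branch \<iota> c J ` (N \<inter> interior J)" using y by (simp add: T_on_piece)
      then show ?thesis using J(1) by blast
    next
      case False
      then show ?thesis using y assms(2) by blast
    qed
  qed
  ultimately show ?thesis by (rule negligible_subset)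
qed

lemma T_in: "y \<in> {a..b} \<Longrightarrow> T y \<in> {a..b}"
  using self_map by blast

lemma T_funpow_in: "y \<in> {a..b} \<Longrightarrow> (T ^^ n) y \<in> {a..b}"
  by (induction n) (simp_all add: T_in del: atLeastAtMost_iff)

lemma negligible_T_funpow_image:
  "negligible N \<Longrightarrow> N \<subseteq> {a..b} \<Longrightarrow> negligible ((T ^^ n) ` N)"
proof (induction n)
  case (Suc n)
  then have "negligible (T ` ((T ^^ n) ` N))"
    by (intro negligible_T_image) (auto intro!: T_funpow_in)
  then show ?case by (simp add: image_image)
qed simp

lemma negligible_T_funpow_preimage:
  "negligible N \<Longrightarrow> negligible {y \<in> {a..b}. (T ^^ n) y \<in> N}"
proof (induction n)
  case 0
  then show ?case by (auto intro: negligible_subset)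
next
  case (Suc n)
  have "negligible {y \<in> {a..b}. T y \<in> {y \<in> {a..b}. (T ^^ n) y \<in> N}}"
    by (rule negligible_T_preimage[OF Suc.IH[OF Suc.prems]])
  then show ?case
    by (rule negligible_subset) (auto simp: funpow_swap1 T_in simp del: atLeastAtMost_iff)
qed

section \<open>Modulus and phase of peripheral eigenfunctions\<close>

lemma eigenfunction_aligned:
  fixes f :: "real \<Rightarrow> complex"
  assumes "integrable M f" "AE x in M. H f x = \<mu> * f x" "norm \<mu> = 1"
  shows "AE x in M. (\<forall>J\<in>P. transfer_term f J x = norm (transfer_term f J x) * sgn (\<mu> * f x)) \<and>
    H (\<lambda>y. complex_of_real (norm (f y))) x = norm (f x)"
proof -
  have fin: "(\<integral>\<^sup>+x. norm (f x) \<partial>M) \<noteq> \<infinity>" using assms(1) by (auto simp: integrable_iff_bounded)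
  \<comment> \<open>The gap between the two sides is nonnegative almost everywhere and has integral
    0 by mass balance, so it vanishes; finiteness of the mass allows the subtraction in
    \<open>ennreal\<close>.\<close>
  have le: "AE x in M. ennreal (norm (f x)) \<le> abs_transfer f x"
    using AE_abs_transfer_finite[OF assms(1)] assms(2)
    by eventually_elim (use norm_H_le assms(3) in \<open>force simp: norm_mult\<close>)
  have "(\<integral>\<^sup>+x. abs_transfer f x - norm (f x) \<partial>M) = (\<integral>\<^sup>+x. abs_transfer f x \<partial>M) - (\<integral>\<^sup>+x. norm (f x) \<partial>M)"
    by (rule nn_integral_diff[OF abs_transfer_measurable[OF assms(1)] _ fin le]) (use assms(1) in simp)
  also have "\<dots> = 0" using fin by (simp add: nn_integral_abs_transfer[OF assms(1)])
  finally have "AE x in M. abs_transfer f x - norm (f x) = 0"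
    using abs_transfer_measurable[OF assms(1)] assms(1)
    by (subst (asm) nn_integral_0_iff_AE) auto
  with le AE_abs_transfer_finite[OF assms(1)] assms(2) show ?thesis
  proof eventually_elim
    case (elim x)
    have eq: "abs_transfer f x = norm (f x)"
      using elim(1,4) by (metis diff_eq_0_iff_ennreal antisym ennreal_less_top less_le)
    have s: "(\<lambda>J. norm (transfer_term f J x)) summable_on P"
      using elim(2) by (simp add: abs_transfer_finite_iff)
    have sum: "(\<Sum>\<^sub>\<infinity>J\<in>P. norm (transfer_term f J x)) = norm (f x)"
      using eq abs_transfer_eq[OF elim(2)] by (simp add: infsum_nonneg)
    have inf: "infsum (\<lambda>J. transfer_term f J x) P = \<mu> * f x"
      using elim(3) by (simp add: H_eq)
    have "norm (infsum (\<lambda>J. transfer_term f J x) P) = (\<Sum>\<^sub>\<infinity>J\<in>P. norm (transfer_term f J x))"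
      unfolding sum inf using assms(3) by (simp add: norm_mult)
    then have "\<forall>J\<in>P. transfer_term f J x = norm (transfer_term f J x) * sgn (\<mu> * f x)"
      using norm_infsum_eq_imp_aligned[OF s] unfolding inf by blast
    moreover have "H (\<lambda>y. complex_of_real (norm (f y))) x = norm (f x)"
    proof -
      have "transfer_term (\<lambda>y. complex_of_real (norm (f y))) J x = complex_of_real (norm (transfer_term f J x))" for J
        by (simp add: transfer_term_def norm_mult indicator_def)
      moreover have "((\<lambda>J. complex_of_real (norm (transfer_term f J x))) has_sum complex_of_real (norm (f x))) P"
        using has_sum_bounded_linear[OF bounded_linear_of_real has_sum_infsum[OF s]] by (simp add: sum)
      ultimately show ?thesis by (simp add: H_eq infsumI)
    qed
    ultimately show ?case by blast
  qed
qed

text \<open>Alignment is read at \<open>x = T y\<close> for the piece containing \<open>y\<close>,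
  whose term is \<open>y\<^sup>2 * f y\<close>; so \<open>f y\<close> is a nonnegative multiple of
  \<open>sgn (\<mu> * f (T y))\<close>. If \<open>f (T y)\<close> were 0, this would force
  \<open>f y = 0\<close>.\<close>

lemma eigenfunction_phase:
  fixes f :: "real \<Rightarrow> complex"
  assumes "integrable M f" "AE x in M. H f x = \<mu> * f x" "norm \<mu> = 1"
  shows "AE y in M. f y \<noteq> 0 \<longrightarrow> sgn (f y) = \<mu> * sgn (f (T y)) \<and> f (T y) \<noteq> 0"
proof -
  define N where "N = {x \<in> {a..b}. \<not> ((\<forall>J\<in>P. transfer_term f J x = norm (transfer_term f J x) * sgn (\<mu> * f x)) \<and>
    H (\<lambda>y. complex_of_real (norm (f y))) x = norm (f x))}"
  have "negligible N"
    using eigenfunction_aligned[OF assms] unfolding N_def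
    by (subst (asm) AE_lebesgue_on_iff_negligible) auto
  from negligible_T_preimage[OF this] have "AE y in M. \<not> T y \<in> N"
    by (subst AE_lebesgue_on_iff_negligible) auto
  moreover have "AE y in M. y \<in> {a..b}" by (rule AE_I2) simp
  ultimately show ?thesis using AE_M_interior
  proof eventually_elim
    case (elim y)
    then obtain J where J: "J \<in> P" "y \<in> interior J" by blast
    have Ty: "T y = branch \<iota> c J y" by (rule T_on_piece[OF J])
    have "T y \<in> {a..b}" using elim(2) self_map by blast
    then have "transfer_term f J (T y) = norm (transfer_term f J (T y)) * sgn (\<mu> * f (T y))"
      using elim(1) J(1) unfolding N_def by blast
    then have eq: "y\<^sup>2 * f y = (y\<^sup>2 * norm (f y)) * sgn (\<mu> * f (T y))"
      unfolding Ty transfer_term_branch[OF J] by (simp add: norm_mult norm_power)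
    have "y \<noteq> 0" using zero_notin_piece[OF J(1)] J(2) interior_subset by blast
    then have fy: "f y = norm (f y) * sgn (\<mu> * f (T y))" using eq by simp
    show ?case
    proof (intro impI conjI)
      assume f0: "f y \<noteq> 0"
      then have "sgn (f y) = sgn (\<mu> * f (T y))"
        by (subst fy) (simp add: sgn_mult sgn_of_real)
      also have "\<dots> = \<mu> * sgn (f (T y))" using assms(3) by (simp add: sgn_mult sgn_eq norm_mult)
      finally show "sgn (f y) = \<mu> * sgn (f (T y))" .
      show "f (T y) \<noteq> 0" using fy f0 by auto
    qed
  qed
qed

lemma eigenfunction_constant_phase:
  assumes star: "condition_star a b T" and f: "f \<in> BV a b"
    and eigen: "AE x in M. H f x = \<mu> * f x" "norm \<mu> = 1"
  shows "\<exists>u. AE x in M. f x = u * complex_of_real (norm (f x))"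
proof -
  have ab: "a \<le> b" using nondegenerate by simp
  obtain g where g: "integrable M f" "AE x in M. g x = f x" "variation a b g < \<infinity>"
    using f by (auto simp: BV_def)
  obtain V where "variation_le g a b V" using finite_variation_imp_variation_le[OF g(3) ab] by blast
  then obtain W where W: "\<And>x y. a \<le> x \<Longrightarrow> x \<le> y \<Longrightarrow> y \<le> b \<Longrightarrow> norm (g y - g x) \<le> W y - W x"
    "W a = 0" "W b \<le> V" "mono_on {a..b} W"
    by (rule variation_leE) (rule that)
  \<comment> \<open>A monotone majorant has countably many discontinuities, and \<open>g\<close> is
    continuous wherever \<open>W\<close> is. The endpoints are removed so that every other point has
    a neighbourhood inside the interval.\<close>
  define D where "D = {x \<in> {a..b}. \<not> continuous (at x within {a..b}) W} \<union> {a, b}"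
  have "countable D" unfolding D_def using mono_on_ctble_discont[OF W(4)] by auto
  define E where "E = {y \<in> {a..b}. \<not> (g y = f y \<and> (f y \<noteq> 0 \<longrightarrow> sgn (f y) = \<mu> * sgn (f (T y)) \<and> f (T y) \<noteq> 0))}"
  have "AE y in M. g y = f y \<and> (f y \<noteq> 0 \<longrightarrow> sgn (f y) = \<mu> * sgn (f (T y)) \<and> f (T y) \<noteq> 0)"
    using g(2) eigenfunction_phase[OF g(1) eigen] by eventually_elim blast
  then have E: "negligible E"
    unfolding E_def by (subst (asm) AE_lebesgue_on_iff_negligible) auto
  \<comment> \<open>Outside \<open>Z\<close> no point of the orbit is exceptional, so the phase
    relation can be iterated along all of it.\<close>
  define Z where "Z = (\<Union>n. {y \<in> {a..b}. (T ^^ n) y \<in> E})"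
  have Z: "negligible Z"
    unfolding Z_def by (rule negligible_Union_nat) (rule negligible_T_funpow_preimage[OF E])
  have Z_sub: "Z \<subseteq> {a..b}" by (auto simp: Z_def)
  have orbit: "sgn (f y) = \<mu> ^ n * sgn (f ((T ^^ n) y)) \<and> f ((T ^^ n) y) \<noteq> 0"
    if "y \<in> {a..b} - Z" "f y \<noteq> 0" for y n
  proof (induction n)
    case (Suc n)
    have "(T ^^ n) y \<notin> E" "(T ^^ n) y \<in> {a..b}"
      using that(1) T_funpow_in by (auto simp: Z_def)
    then have "sgn (f ((T ^^ n) y)) = \<mu> * sgn (f (T ((T ^^ n) y))) \<and> f (T ((T ^^ n) y)) \<noteq> 0"
      using Suc unfolding E_def by blast
    then show ?case using Suc by (simp add: mult.assoc mult.left_commute)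
  qed (use that in simp)
  have gf: "g y = f y" if "y \<in> {a..b} - Z" for y
    using that unfolding Z_def E_def by (auto dest: spec[of _ 0])
  have nbhd: "\<exists>d>0. {y - d<..<y + d} \<subseteq> {a..b} \<and> (\<forall>z\<in>{y - d<..<y + d}. norm (sgn (g z) - sgn (g y)) < e)"
    if y: "y \<in> {a..b} - Z - D" "f y \<noteq> 0" and e: "e > 0" for y e
  proof -
    have yab: "a < y" "y < b" using y(1) by (auto simp: D_def)
    have "continuous (at y within {a..b}) W" using y(1) by (auto simp: D_def)
    then have Wy: "(W \<longlongrightarrow> W y) (at y)"
      using yab by (simp add: continuous_within at_within_Icc_at)
    have "eventually (\<lambda>z. z \<in> {a<..<b}) (at y)"
      using yab by (intro eventually_at_in_open') auto
    then have "eventually (\<lambda>z. norm (g z - g y) \<le> \<bar>W z - W y\<bar>) (at y)"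
    proof eventually_elim
      case (elim z)
      then show ?case
        using W(1)[of z y] W(1)[of y z] yab by (cases "z \<le> y") (auto simp: norm_minus_commute)
    qed
    moreover have "((\<lambda>z. \<bar>W z - W y\<bar>) \<longlongrightarrow> 0) (at y)"
      using Wy by (intro tendsto_rabs_zero) (simp add: LIM_zero)
    ultimately have "((\<lambda>z. g z - g y) \<longlongrightarrow> 0) (at y)"
      by (rule Lim_null_comparison)
    then have "(g \<longlongrightarrow> g y) (at y)" by (rule LIM_zero_cancel)
    moreover have "g y \<noteq> 0" using gf y by auto
    ultimately have "((\<lambda>z. sgn (g z)) \<longlongrightarrow> sgn (g y)) (at y)" by (rule tendsto_sgn)
    then have "eventually (\<lambda>z. dist (sgn (g z)) (sgn (g y)) < e) (at y)" using e by (rule tendstoD)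
    then obtain d where d: "d > 0" "\<And>z. z \<noteq> y \<Longrightarrow> dist z y < d \<Longrightarrow> dist (sgn (g z)) (sgn (g y)) < e"
      unfolding eventually_at by auto
    define d' where "d' = min d (min (y - a) (b - y))"
    show ?thesis
    proof (intro exI[of _ d'] conjI ballI)
      show "d' > 0" using d(1) yab by (simp add: d'_def)
      show "{y - d'<..<y + d'} \<subseteq> {a..b}" by (auto simp: d'_def)
      fix z assume "z \<in> {y - d'<..<y + d'}"
      then have "dist z y < d" by (auto simp: d'_def dist_real_def)
      then show "norm (sgn (g z) - sgn (g y)) < e"
        using d(2)[of z] e by (cases "z = y") (auto simp: dist_norm)
    qed
  qed
  have same: "sgn (f y0) = sgn (f y1)"
    if y0: "y0 \<in> {a..b} - Z - D" "f y0 \<noteq> 0" and y1: "y1 \<in> {a..b} - Z - D" "f y1 \<noteq> 0" for y0 y1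
  proof (rule ccontr)
    assume ne: "sgn (f y0) \<noteq> sgn (f y1)"
    \<comment> \<open>Half the distance, so that two phases within \<open>e\<close> of the two given
      ones cannot coincide.\<close>
    define e where "e = norm (sgn (f y0) - sgn (f y1)) / 2"
    have e: "e > 0" using ne by (simp add: e_def)
    obtain d0 where d0: "d0 > 0" "{y0 - d0<..<y0 + d0} \<subseteq> {a..b}"
      "\<And>z. z \<in> {y0 - d0<..<y0 + d0} \<Longrightarrow> norm (sgn (g z) - sgn (g y0)) < e"
      using nbhd[OF y0 e] by auto
    obtain d1 where d1: "d1 > 0" "{y1 - d1<..<y1 + d1} \<subseteq> {a..b}"
      "\<And>z. z \<in> {y1 - d1<..<y1 + d1} \<Longrightarrow> norm (sgn (g z) - sgn (g y1)) < e"
      using nbhd[OF y1 e] by auto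
    let ?J = "{y0 - d0<..<y0 + d0}" and ?K = "{y1 - d1<..<y1 + d1}"
    have "nondegenerate_subinterval a b ?J" "nondegenerate_subinterval a b ?K"
      using d0 d1 by (auto simp: nondegenerate_subinterval_def is_interval_1 interior_open)
    then obtain N where N: "emeasure lebesgue ((T ^^ N) ` ?J \<inter> (T ^^ N) ` ?K) > 0"
      using star unfolding condition_star_def by blast
    \<comment> \<open>The common image has positive measure, so it contains a point none of whose
      preimages under \<open>T ^^ N\<close> lies in the exceptional set.\<close>
    have "\<not> (T ^^ N) ` ?J \<inter> (T ^^ N) ` ?K \<subseteq> (T ^^ N) ` Z"
    proof
      assume "(T ^^ N) ` ?J \<inter> (T ^^ N) ` ?K \<subseteq> (T ^^ N) ` Z"
      then have "negligible ((T ^^ N) ` ?J \<inter> (T ^^ N) ` ?K)"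
        by (rule negligible_subset[OF negligible_T_funpow_image[OF Z Z_sub]])
      then show False using N by (simp add: negligible_iff_null_sets null_sets_def)
    qed
    then obtain x where x: "x \<in> (T ^^ N) ` ?J" "x \<in> (T ^^ N) ` ?K" "x \<notin> (T ^^ N) ` Z" by blast
    obtain p where p1: "p \<in> ?J" "x = (T ^^ N) p" using x(1) by (rule imageE)
    obtain q where q1: "q \<in> ?K" "x = (T ^^ N) q" using x(2) by (rule imageE)
    have "p \<notin> Z" "q \<notin> Z" using x(3) p1(2) q1(2) by blast+
    with p1 q1 have pq: "p \<in> ?J" "q \<in> ?K" "(T ^^ N) p = (T ^^ N) q" "p \<notin> Z" "q \<notin> Z"
      by simp_all
    have p: "p \<in> {a..b} - Z" and q: "q \<in> {a..b} - Z" using pq d0(2) d1(2) by auto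
    have "norm (sgn (f p) - sgn (f y0)) < e" "norm (sgn (f q) - sgn (f y1)) < e"
      using d0(3)[OF pq(1)] d1(3)[OF pq(2)] gf[OF p] gf[OF q] gf[of y0] gf[of y1] y0(1) y1(1) by auto
    moreover have "sgn (f p) = sgn (f q)"
    proof -
      \<comment> \<open>Since \<open>sgn 0 = 0\<close> has distance 1 from any unit number,
        \<open>e \<le> 1\<close> guarantees that \<open>f\<close> does not vanish at
        \<open>p\<close> and \<open>q\<close>; the phase relation applies only there. Both orbits
        take \<open>N\<close> steps, so the factor \<open>\<mu> ^ N\<close> is the same.\<close>
      have "e \<le> 1"
        using norm_triangle_ineq4[of "sgn (f y0)" "sgn (f y1)"] y0(2) y1(2) by (simp add: e_def norm_sgn)
      then have "f p \<noteq> 0" "f q \<noteq> 0"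
        using calculation y0(2) y1(2) by (auto simp: norm_sgn)
      then show ?thesis using orbit[OF p, of N] orbit[OF q, of N] pq(3) by simp
    qed
    ultimately have "norm (sgn (f y0) - sgn (f y1)) < e + e"
      by (metis norm_minus_commute norm_diff_triangle_less)
    then show False by (simp add: e_def)
  qed
  have bad: "AE y in M. y \<in> {a..b} - Z - D"
  proof -
    have "negligible (Z \<union> D)" using Z countable_imp_negligible[OF \<open>countable D\<close>] by (rule negligible_Un)
    then have "negligible {y \<in> {a..b}. \<not> y \<in> {a..b} - Z - D}"
      by (rule negligible_subset) auto
    then show ?thesis by (subst AE_lebesgue_on_iff_negligible) auto
  qed
  show ?thesis
  proof (cases "\<exists>y0 \<in> {a..b} - Z - D. f y0 \<noteq> 0")
    case True
    then obtain y0 where y0: "y0 \<in> {a..b} - Z - D" "f y0 \<noteq> 0" by blast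
    have "f y = sgn (f y0) * norm (f y)" if "y \<in> {a..b} - Z - D" for y
      using same[OF y0 that] by (cases "f y = 0") (auto simp: sgn_eq)
    with bad have "AE y in M. f y = sgn (f y0) * norm (f y)" by (auto elim: eventually_mono)
    then show ?thesis by blast
  next
    case False
    with bad have "AE y in M. f y = 0 * complex_of_real (norm (f y))" by (auto elim: eventually_mono)
    then show ?thesis by blast
  qed
qed

end

section \<open>Triviality of the peripheral spectrum and simplicity of 1\<close>

lemma BV_iff:
  assumes "a \<le> b"
  shows "f \<in> BV a b \<longleftrightarrow> integrable (lebesgue_on {a..b}) f \<and>
    (\<exists>g V. (AE x in lebesgue_on {a..b}. g x = f x) \<and> variation_le g a b V)"
proof -
  have "variation a b g < \<infinity> \<longleftrightarrow> (\<exists>V. variation_le g a b V)" for g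
    using finite_variation_imp_variation_le[OF _ assms] variation_le_imp_variation[OF _ assms]
    by (metis ennreal_less_top infinity_ennreal_def le_less_trans)
  then show ?thesis unfolding BV_def by blast
qed

lemma BV_linear:
  assumes "a \<le> b" "f \<in> BV a b" "g \<in> BV a b"
  shows "(\<lambda>x. k * f x + l * g x) \<in> BV a b"
proof -
  obtain f' V where f: "integrable (lebesgue_on {a..b}) f" "AE x in lebesgue_on {a..b}. f' x = f x"
    "variation_le f' a b V" using assms(2) by (auto simp: BV_iff[OF assms(1)])
  obtain g' V' where g: "integrable (lebesgue_on {a..b}) g" "AE x in lebesgue_on {a..b}. g' x = g x"
    "variation_le g' a b V'" using assms(3) by (auto simp: BV_iff[OF assms(1)])
  have "AE x in lebesgue_on {a..b}. k * f' x + l * g' x = k * f x + l * g x"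
    using f(2) g(2) by eventually_elim simp
  moreover have "variation_le (\<lambda>x. k * f' x + l * g' x) a b (norm k * V + norm l * V')"
    by (intro variation_le_add variation_le_cmult f(3) g(3))
  ultimately show ?thesis using f(1) g(1) by (auto simp: BV_iff[OF assms(1)])
qed

context iwasawa_cf_map
begin

text \<open>The modulus of \<open>f\<close> is fixed by \<open>H\<close>; since \<open>f\<close> is
  a constant multiple of it, \<open>f\<close> is fixed too, and
  \<open>\<mu> * f = f\<close>.\<close>

lemma eigenvalue_modulus_one:
  assumes star: "condition_star a b T" and f: "f \<in> BV a b" "\<not> (AE x in M. f x = 0)"
    and eigen: "AE x in M. H f x = \<mu> * f x" "norm \<mu> = 1"
  shows "\<mu> = 1"
proof -
  have i: "integrable M f" using f(1) by (simp add: BV_def)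
  let ?n = "\<lambda>x. complex_of_real (norm (f x))"
  have ni: "integrable M ?n" using i by simp
  obtain u where u: "AE x in M. f x = u * complex_of_real (norm (f x))"
    using eigenfunction_constant_phase[OF star f(1) eigen] by blast
  have "AE x in M. f x = u * ?n x + 0 * ?n x" using u by simp
  then have "AE x in M. H f x = H (\<lambda>x. u * ?n x + 0 * ?n x) x"
    using i ni by (intro H_cong_AE) auto
  moreover have "AE x in M. H (\<lambda>x. u * ?n x + 0 * ?n x) x = u * H ?n x + 0 * H ?n x"
    by (rule H_linear[OF ni ni])
  moreover have "AE x in M. H ?n x = norm (f x)"
    using eigenfunction_aligned[OF i eigen] by eventually_elim simp
  ultimately have "AE x in M. \<mu> * f x = f x"
    using u eigen(1) by eventually_elim simp
  then have "\<mu> \<noteq> 1 \<Longrightarrow> AE x in M. f x = 0" by eventually_elim simp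
  then show ?thesis using f(2) by blast
qed

lemma eigenfunction_integral_zero:
  assumes star: "condition_star a b T" and f: "f \<in> BV a b"
    and eigen: "AE x in M. H f x = f x" and int: "integral\<^sup>L M f = 0"
  shows "AE x in M. f x = 0"
proof -
  have i: "integrable M f" using f by (simp add: BV_def)
  obtain u where u: "AE x in M. f x = u * complex_of_real (norm (f x))"
    using eigenfunction_constant_phase[OF star f, of 1] eigen by auto
  have "integral\<^sup>L M f = integral\<^sup>L M (\<lambda>x. u * complex_of_real (norm (f x)))"
    using u i by (intro integral_cong_AE) auto
  also have "\<dots> = u * complex_of_real (integral\<^sup>L M (\<lambda>x. norm (f x)))"
    using i by simp
  finally have "u = 0 \<or> integral\<^sup>L M (\<lambda>x. norm (f x)) = 0" using int by simp
  then show ?thesis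
  proof
    assume "u = 0"
    then show ?thesis using u by simp
  next
    assume "integral\<^sup>L M (\<lambda>x. norm (f x)) = 0"
    then show ?thesis
      using i by (subst (asm) integral_nonneg_eq_0_iff_AE) auto
  qed
qed

text \<open>\<open>H\<close> maps \<open>p + k q\<close> to \<open>p + (k + 1) q\<close>. The
  contraction keeps all these norms below that of \<open>p\<close>, so \<open>k\<close> times the
  norm of \<open>q\<close> stays bounded in \<open>k\<close>.\<close>

lemma no_Jordan_block:
  assumes p: "integrable M p" and q: "integrable M q"
    and Hp: "AE x in M. H p x = p x + q x" and Hq: "AE x in M. H q x = q x"
  shows "AE x in M. q x = 0"
proof -
  have bound: "(LINT x|M. norm (1 * p x + of_nat k * q x)) \<le> (LINT x|M. norm (p x))" for k
  proof (induction k)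
    case (Suc k)
    let ?g = "\<lambda>x. 1 * p x + of_nat k * q x"
    have g: "integrable M ?g" using p q by simp
    have "AE x in M. 1 * p x + of_nat (Suc k) * q x = H ?g x"
      using H_linear[OF p q, of 1 "of_nat k"] Hp Hq
      by eventually_elim (simp add: algebra_simps)
    then have "(LINT x|M. norm (1 * p x + of_nat (Suc k) * q x)) = (LINT x|M. norm (H ?g x))"
      using p q H_integrable[OF g] by (intro integral_cong_AE) auto
    also have "\<dots> \<le> (LINT x|M. norm (?g x))" by (rule integral_norm_H_le[OF g])
    finally show ?case using Suc by linarith
  qed simp
  have "real k * (LINT x|M. norm (q x)) \<le> 2 * (LINT x|M. norm (p x))" for k
  proof -
    have "real k * (LINT x|M. norm (q x)) = (LINT x|M. norm (of_nat k * q x))"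
      by (simp add: norm_mult)
    also have "\<dots> \<le> (LINT x|M. norm (1 * p x + of_nat k * q x) + norm (p x))"
    proof (rule integral_mono)
      fix x show "norm (of_nat k * q x) \<le> norm (1 * p x + of_nat k * q x) + norm (p x)"
        using norm_triangle_ineq4[of "1 * p x + of_nat k * q x" "p x"] by simp
    qed (use p q in auto)
    also have "\<dots> = (LINT x|M. norm (1 * p x + of_nat k * q x)) + (LINT x|M. norm (p x))"
      using p q by (intro Bochner_Integration.integral_add) auto
    finally show ?thesis using bound[of k] by linarith
  qed
  then have "(LINT x|M. norm (q x)) \<le> 0"
    by (metis mult.commute not_le reals_Archimedean3)
  then have "(LINT x|M. norm (q x)) = 0"
    by (intro antisym integral_nonneg_AE) auto
  then show ?thesis using q by (subst (asm) integral_nonneg_eq_0_iff_AE) auto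
qed

text \<open>The exponent is lowered one at a time, with \<open>p = (D ^^ n) f\<close> and
  \<open>q = (D ^^ Suc n) f\<close>. The descent takes place among integrable functions.\<close>

lemma generalized_eigenfunction_is_eigenfunction:
  fixes f :: "real \<Rightarrow> complex"
  defines "D \<equiv> \<lambda>(g :: real \<Rightarrow> complex) x. H g x - 1 * g x"
  assumes "integrable M f" "AE x in M. (D ^^ Suc n) f x = 0"
  shows "AE x in M. H f x = f x"
proof -
  have D_int: "integrable M ((D ^^ n) f)" for n
  proof (induction n)
    case (Suc n)
    then show ?case using H_integrable[OF Suc] unfolding D_def by simp
  qed (use assms(2) in simp)
  have "AE x in M. D f x = 0"
    using assms(3)
  proof (induction n)
    case (Suc n)
    have "AE x in M. (D ^^ Suc n) f x = 0"
    proof (rule no_Jordan_block[OF D_int D_int])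
      show "AE x in M. H ((D ^^ n) f) x = (D ^^ n) f x + (D ^^ Suc n) f x"
        by (simp add: D_def)
      show "AE x in M. H ((D ^^ Suc n) f) x = (D ^^ Suc n) f x"
        using Suc.prems by (simp add: D_def)
    qed
    then show ?case by (rule Suc.IH)
  qed simp
  then show ?thesis by (simp add: D_def)
qed

lemma simple_eigenvalue_one:
  assumes star: "condition_star a b T" and ev: "BV_eigenvalue a b H 1"
  shows "BV_simple_eigenvalue a b H 1"
proof -
  have ab: "a \<le> b" using nondegenerate by simp
  obtain e where e: "e \<in> BV a b" "\<not> (AE x in M. e x = 0)" "AE x in M. H e x = 1 * e x"
    using ev unfolding BV_eigenvalue_def by blast
  have ei: "integrable M e" using e(1) by (simp add: BV_def)
  have He: "AE x in M. H e x = e x" using e(3) by simp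
  have int_e: "integral\<^sup>L M e \<noteq> 0"
    using eigenfunction_integral_zero[OF star e(1) He] e(2) by blast
  have "\<exists>k. AE x in M. f x = k * e x" if f: "f \<in> BV_generalized_eigenspace a b H 1" for f
  proof -
    obtain n where n: "f \<in> BV a b" "AE x in M. ((\<lambda>g x. H g x - 1 * g x) ^^ n) f x = 0"
      using f unfolding BV_generalized_eigenspace_def by blast
    have fi: "integrable M f" using n(1) by (simp add: BV_def)
    show ?thesis
    proof (cases n)
      case 0
      then show ?thesis using n(2) by (intro exI[of _ 0]) simp
    next
      case (Suc m)
      have Hf: "AE x in M. H f x = f x"
        by (rule generalized_eigenfunction_is_eigenfunction[OF fi n(2)[unfolded Suc]])
      \<comment> \<open>This ratio makes the integral of \<open>f - k e\<close> vanish, and an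
        eigenfunction of integral 0 is null.\<close>
      define k where "k = integral\<^sup>L M f / integral\<^sup>L M e"
      let ?p = "\<lambda>x. 1 * f x + (- k) * e x"
      have "AE x in M. ?p x = 0"
      proof (rule eigenfunction_integral_zero[OF star])
        show "?p \<in> BV a b" by (rule BV_linear[OF ab n(1) e(1)])
        show "AE x in M. H ?p x = ?p x"
          using H_linear[OF fi ei, of 1 "- k"] Hf He by eventually_elim simp
        show "integral\<^sup>L M ?p = 0" using fi ei int_e by (simp add: k_def)
      qed
      then show ?thesis by (intro exI[of _ k]) (auto elim: eventually_mono)
    qed
  qed
  moreover have "e \<in> BV_generalized_eigenspace a b H 1"
    unfolding BV_generalized_eigenspace_def using e(1) He by (auto intro!: exI[of _ 1])
  ultimately show ?thesis
    unfolding BV_simple_eigenvalue_def using ev e(2) by blast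
qed

end

theorem theorem2:
  fixes a b :: real
    and T \<iota> :: "real \<Rightarrow> real"
    and P :: "real set set"
    and c :: "real set \<Rightarrow> real"
  assumes "iwasawa_cf_map a b T \<iota> P c"
    and "proper a b"
    and "condition_star a b T"
  shows "BV_simple_eigenvalue a b (transfer_operator \<iota> P c) 1 \<and>
    (\<forall>\<mu>. BV_eigenvalue a b (transfer_operator \<iota> P c) \<mu> \<and> norm \<mu> = 1 \<longrightarrow> \<mu> = 1)"
proof -
  interpret proper_iwasawa_cf_map a b T \<iota> P c
    using assms(1,2) by (intro proper_iwasawa_cf_map.intro proper_iwasawa_cf_map_axioms.intro)
  show ?thesis
  proof (intro conjI allI impI)
    show "BV_simple_eigenvalue a b (transfer_operator \<iota> P c) 1"
      by (rule simple_eigenvalue_one[OF assms(3) one_is_BV_eigenvalue])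
    show "\<mu> = 1" if "BV_eigenvalue a b (transfer_operator \<iota> P c) \<mu> \<and> norm \<mu> = 1" for \<mu>
      using that eigenvalue_modulus_one[OF assms(3)] unfolding BV_eigenvalue_def by blast
  qed
qed

end
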